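(* Let $k$ be a field, let $\alpha_1,\dots,\alpha_n\ge 1$ and let $\mathfrak{c}=(x_1^{\alpha_1},\dots,x_n^{\alpha_n})\subseteq k[x_1,\dots,x_n]$. Let $\mathfrak{j}\subseteq k[x_1,\dots,x_n]$ be an Artin monomial ideal strictly containing $\mathfrak{c}$ (the powers $x_i^{\alpha_i}$ need not be minimal generators of $\mathfrak{j}$). Let $A$ be a finite set and $A\to\{x_1,\dots,x_n\}$ a map whose fiber $A_i$ over $x_i$ has cardinality $\alpha_i$. Then any polarization $J\subseteq k[A]$ of $\mathfrak{j}$ is the Stanley-Reisner ideal of a full-dimensional simplicial ball on the simplicial sphere $\partial\Delta(A_1)*\partial\Delta(A_2)*\cdots*\partial\Delta(A_n)$, i.e. of a full-dimensional subcomplex of this sphere whose geometric realization is homeomorphic to a ball. Moreover, any proper polarization of $\mathfrak{j}$ is, when followed by a suitable extension (adding variables), isomorphic to such a polarization $J\subseteq k[A]$.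
   Context: An Artin monomial ideal in $k[x_1,\dots,x_n]$ is a (proper) monomial ideal containing a power of each variable. For a finite set $V$, $k[V]$ is the polynomial ring with the elements of $V$ as variables. For $R\subseteq V$ let $m(R)=\prod_{v\in R}v$. The Stanley-Reisner ideal of a simplicial complex $X$ on $V$ is generated by the $m(R)$ with $R\subseteq V$, $R\notin X$. Simplicial spheres: $\Delta(V)$ is the full simplex on $V$ and $\partial\Delta(V)$ is its boundary, the complex of all proper subsets of $V$. The join $X*Y$ of complexes on disjoint vertex sets is $\{F\cup G: F\in X, G\in Y\}$. The join $\partial\Delta(A_1)*\cdots*\partial\Delta(A_n)$ is a simplicial sphere of dimension $\sum_i|A_i|-1-n$; its facets are the sets $A\setminus\{a_1,\dots,a_n\}$ with $a_i\in A_i$. A subcomplex is full-dimensional if it has the same dimension as this sphere. Separations and polarizations: Let $V'\to V$ be a surjection of finite sets with $|V'|=|V|+1$ and let $v_1\ne v_2$ in $V'$ be the two elements with the same image. A monomial ideal $J'\subseteq k[V']$ is a simple separation of a monomial ideal $J\subseteq k[V]$ if (i) $J$ is the image of $J'$ under $k[V']\to k[V]$; (ii) both variables $x_{v_1},x_{v_2}$ occur in some minimal generators of $J'$; (iii) $x_{v_1}-x_{v_2}$ is a non-zero divisor in $k[V']/J'$. For a general surjection $V'\to V$, $J'\subseteq k[V']$ is a proper separation of $J$ if it is obtained from $J$ by a succession of simple separations. If further $V'\subseteq V''$ is an inclusion, the extension ideal $(J')\subseteq k[V'']$ is a separation of $J$; equivalently it is obtained by a sequence of simple separations in which (ii) is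 not required. A (proper) polarization of $J$ is a squarefree (proper) separation of $J$. A polarization $J\subseteq k[A]$ of $\mathfrak{j}$ is taken with respect to the given map $A\to\{x_1,\dots,x_n\}$; so $J$ maps onto $\mathfrak{j}$ under $k[A]\to k[x_1,\dots,x_n]$, and the differences of variables in common fibers give a regular sequence for $k[A]/J$. Isomorphic means corresponding under a bijection of the variables compatible with the maps to $\{x_1,\dots,x_n\}$. *)

theory Defs
  imports
    "HOL-Analysis.Abstract_Euclidean_Space"
    "HOL-Algebra.QuotRing"
    "HOL-Library.Poly_Mapping"
    "HOL-Library.Infinite_Typeclass"
begin

section \<open>The polynomial ring on a set of variables\<close>

text \<open>
  An exponent vector is a finitely supported function from variables to naturals, and a
  polynomial is a finitely supported function from exponent vectors to coefficients. The ring
  \<open>k[V]\<close> consists of the polynomials that only involve variables from \<open>V\<close>.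
\<close>

type_synonym 'v expo = "'v \<Rightarrow>\<^sub>0 nat"
type_synonym ('v, 'k) mpoly = "'v expo \<Rightarrow>\<^sub>0 'k"

definition mon :: "'v expo \<Rightarrow> ('v, 'k::field) mpoly"
  where "mon m = Poly_Mapping.single m 1"

definition var :: "'v \<Rightarrow> ('v, 'k::field) mpoly"
  where "var v = mon (Poly_Mapping.single v 1)"

definition vars :: "('v, 'k::field) mpoly \<Rightarrow> 'v set"
  where "vars f = (\<Union>m\<in>Poly_Mapping.keys f. Poly_Mapping.keys m)"

definition poly_ring :: "'v set \<Rightarrow> ('v, 'k::field) mpoly ring"
  where "poly_ring V =
    \<lparr>carrier = {f. vars f \<subseteq> V}, mult = (*), one = 1, zero = 0, add = (+)\<rparr>"

lemma vars_zero: "vars 0 = {}"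
  by (simp add: vars_def)

lemma vars_one: "vars 1 = {}"
  by (simp add: vars_def)

lemma vars_add: "vars (f + g) \<subseteq> vars f \<union> vars g"
  unfolding vars_def using Poly_Mapping.keys_add[of f g] by blast

lemma vars_uminus: "vars (- f) = vars f"
  by (simp add: vars_def)

lemma vars_mult: "vars (f * g) \<subseteq> vars f \<union> vars g"
proof
  fix v assume "v \<in> vars (f * g)"
  then obtain m where m: "m \<in> Poly_Mapping.keys (f * g)" "v \<in> Poly_Mapping.keys m"
    by (auto simp: vars_def)
  obtain a b where ab: "m = a + b" "a \<in> Poly_Mapping.keys f" "b \<in> Poly_Mapping.keys g"
    using m(1) Poly_Mapping.keys_mult[of f g] by blast
  have "v \<in> Poly_Mapping.keys a \<union> Poly_Mapping.keys b"
    using m(2) ab(1) Poly_Mapping.keys_add[of a b] by blast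
  then show "v \<in> vars f \<union> vars g"
    using ab by (auto simp: vars_def)
qed

lemma cring_poly_ring: "cring (poly_ring V :: ('v, 'k::field) mpoly ring)"
proof (rule cringI)
  have add: "vars (f + g) \<subseteq> V" and mult: "vars (f * g) \<subseteq> V"
    if "vars f \<subseteq> V" "vars g \<subseteq> V" for f g :: "('v, 'k) mpoly"
    using that vars_add[of f g] vars_mult[of f g] by blast+
  show "abelian_group (poly_ring V :: ('v, 'k) mpoly ring)"
  proof (rule abelian_groupI)
    fix f :: "('v, 'k) mpoly"
    assume "f \<in> carrier (poly_ring V)"
    then show "\<exists>g\<in>carrier (poly_ring V). g \<oplus>\<^bsub>poly_ring V\<^esub> f = \<zero>\<^bsub>poly_ring V\<^esub>"
      by (intro bexI[of _ "- f"]) (auto simp: poly_ring_def vars_uminus)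
  qed (simp_all add: poly_ring_def vars_zero add add_ac)
  show "Group.comm_monoid (poly_ring V :: ('v, 'k) mpoly ring)"
    by (rule comm_monoidI) (simp_all add: poly_ring_def vars_one mult mult_ac)
qed (simp add: poly_ring_def distrib_right)

text \<open>
  The ring homomorphism between polynomial rings that is induced by a map \<open>p\<close> of variables:
  every variable \<open>v\<close> is sent to the variable \<open>p v\<close>.
\<close>

definition expo_map :: "('v \<Rightarrow> 'w) \<Rightarrow> 'v expo \<Rightarrow> 'w expo"
  where "expo_map p m =
    (\<Sum>v\<in>Poly_Mapping.keys m. Poly_Mapping.single (p v) (Poly_Mapping.lookup m v))"

definition var_map :: "('v \<Rightarrow> 'w) \<Rightarrow> ('v, 'k::field) mpoly \<Rightarrow> ('w, 'k) mpoly"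
  where "var_map p f =
    (\<Sum>m\<in>Poly_Mapping.keys f. Poly_Mapping.single (expo_map p m) (Poly_Mapping.lookup f m))"

lemma var_map_var: "var_map p (var v :: ('v, 'k::field) mpoly) = var (p v)"
  by (simp add: var_map_def expo_map_def var_def mon_def)


section \<open>Monomial ideals\<close>

abbreviation gen_ideal :: "'v set \<Rightarrow> ('v, 'k::field) mpoly set \<Rightarrow> ('v, 'k) mpoly set"
  where "gen_ideal V S \<equiv> genideal (poly_ring V) S"

definition monomial_ideal :: "'v set \<Rightarrow> ('v, 'k::field) mpoly set \<Rightarrow> bool"
  where "monomial_ideal V J \<longleftrightarrow>
    (\<exists>S \<subseteq> {m. Poly_Mapping.keys m \<subseteq> V}. J = gen_ideal V (mon ` S))"

definition squarefree_expo :: "'v expo \<Rightarrow> bool"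
  where "squarefree_expo m \<longleftrightarrow> (\<forall>v. Poly_Mapping.lookup m v \<le> 1)"

definition squarefree_monomial_ideal :: "'v set \<Rightarrow> ('v, 'k::field) mpoly set \<Rightarrow> bool"
  where "squarefree_monomial_ideal V J \<longleftrightarrow>
    (\<exists>S \<subseteq> {m. Poly_Mapping.keys m \<subseteq> V \<and> squarefree_expo m}. J = gen_ideal V (mon ` S))"

definition artin_monomial_ideal :: "'v set \<Rightarrow> ('v, 'k::field) mpoly set \<Rightarrow> bool"
  where "artin_monomial_ideal V J \<longleftrightarrow>
    monomial_ideal V J \<and> J \<noteq> carrier (poly_ring V) \<and> (\<forall>v\<in>V. \<exists>e\<ge>1. var v ^ e \<in> J)"

definition expo_dvd :: "'v expo \<Rightarrow> 'v expo \<Rightarrow> bool"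
  where "expo_dvd a b \<longleftrightarrow> (\<forall>v. Poly_Mapping.lookup a v \<le> Poly_Mapping.lookup b v)"

definition min_gens :: "('v, 'k::field) mpoly set \<Rightarrow> 'v expo set"
  where "min_gens J = {m. mon m \<in> J \<and> (\<forall>m'. mon m' \<in> J \<longrightarrow> expo_dvd m' m \<longrightarrow> m' = m)}"


section \<open>Separations and polarizations\<close>

definition non_zero_divisor :: "('a, 'b) ring_scheme \<Rightarrow> 'a \<Rightarrow> bool"
  where "non_zero_divisor R a \<longleftrightarrow>
    a \<in> carrier R \<and> (\<forall>b\<in>carrier R. a \<otimes>\<^bsub>R\<^esub> b = \<zero>\<^bsub>R\<^esub> \<longrightarrow> b = \<zero>\<^bsub>R\<^esub>)"

text \<open>
  In the following predicates, the ideal \<open>J\<close> of \<open>k[V]\<close> comes first, followed by the ideal \<open>J'\<close>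
  of \<open>k[V']\<close> that separates it along a map \<open>p\<close>. Only the values of \<open>p\<close> on \<open>V'\<close> matter.
\<close>

definition simple_separation ::
    "'w set \<Rightarrow> ('w, 'k::field) mpoly set \<Rightarrow>
     'v set \<Rightarrow> ('v \<Rightarrow> 'w) \<Rightarrow> ('v, 'k) mpoly set \<Rightarrow> bool"
  where "simple_separation V J V' p J' \<longleftrightarrow>
    finite V \<and> finite V' \<and> p ` V' = V \<and> card V' = card V + 1 \<and>
    monomial_ideal V J \<and> monomial_ideal V' J' \<and>
    J = var_map p ` J' \<and>
    (\<exists>v1\<in>V'. \<exists>v2\<in>V'. v1 \<noteq> v2 \<and> p v1 = p v2 \<and>
      (\<exists>m\<in>min_gens J'. v1 \<in> Poly_Mapping.keys m) \<and>
      (\<exists>m\<in>min_gens J'. v2 \<in> Poly_Mapping.keys m) \<and>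
      non_zero_divisor (poly_ring V' Quot J') (J' +>\<^bsub>poly_ring V'\<^esub> (var v1 - var v2)))"

text \<open>
  A succession of simple separations. The empty succession allows a renaming of the variables,
  so that the variables \<open>V\<close> and \<open>V'\<close> may have different types; in a longer succession
  such renamings are absorbed by the surjections.
\<close>

inductive proper_separation ::
    "'w set \<Rightarrow> ('w, 'k::field) mpoly set \<Rightarrow>
     'v set \<Rightarrow> ('v \<Rightarrow> 'w) \<Rightarrow> ('v, 'k) mpoly set \<Rightarrow> bool"
  for V J where
  rename: "\<lbrakk>finite V; monomial_ideal V J; bij_betw p V' V; monomial_ideal V' J'; J = var_map p ` J'\<rbrakk>
    \<Longrightarrow> proper_separation V J V' p J'"
| step: "\<lbrakk>proper_separation V J V1 p J1; simple_separation V1 J1 V2 q J2; \<forall>v\<in>V2. r v = p (q v)\<rbrakk>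
    \<Longrightarrow> proper_separation V J V2 r J2"

definition separation ::
    "'w set \<Rightarrow> ('w, 'k::field) mpoly set \<Rightarrow>
     'v set \<Rightarrow> ('v \<Rightarrow> 'w) \<Rightarrow> ('v, 'k) mpoly set \<Rightarrow> bool"
  where "separation V J W p I \<longleftrightarrow>
    finite W \<and> p ` W \<subseteq> V \<and>
    (\<exists>V' J'. V' \<subseteq> W \<and> proper_separation V J V' p J' \<and> I = gen_ideal W J')"

definition proper_polarization ::
    "'w set \<Rightarrow> ('w, 'k::field) mpoly set \<Rightarrow>
     'v set \<Rightarrow> ('v \<Rightarrow> 'w) \<Rightarrow> ('v, 'k) mpoly set \<Rightarrow> bool"
  where "proper_polarization V J V' p J' \<longleftrightarrow>
    proper_separation V J V' p J' \<and> squarefree_monomial_ideal V' J'"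

definition polarization ::
    "'w set \<Rightarrow> ('w, 'k::field) mpoly set \<Rightarrow>
     'v set \<Rightarrow> ('v \<Rightarrow> 'w) \<Rightarrow> ('v, 'k) mpoly set \<Rightarrow> bool"
  where "polarization V J W p I \<longleftrightarrow>
    separation V J W p I \<and> squarefree_monomial_ideal W I"

definition isomorphic_over ::
    "'v set \<Rightarrow> ('v \<Rightarrow> 'w) \<Rightarrow> ('v, 'k::field) mpoly set \<Rightarrow>
     'u set \<Rightarrow> ('u \<Rightarrow> 'w) \<Rightarrow> ('u, 'k) mpoly set \<Rightarrow> bool"
  where "isomorphic_over W q I A \<pi> J \<longleftrightarrow>
    (\<exists>\<phi>. bij_betw \<phi> W A \<and> (\<forall>w\<in>W. \<pi> (\<phi> w) = q w) \<and> var_map \<phi> ` I = J)"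


section \<open>Simplicial complexes\<close>

text \<open>
  Complexes on \<open>V\<close> contain the empty face, and elements of \<open>V\<close> need not be vertices of
  the complex.
\<close>

definition complex_on :: "'v set \<Rightarrow> 'v set set \<Rightarrow> bool"
  where "complex_on V X \<longleftrightarrow>
    finite V \<and> X \<subseteq> Pow V \<and> {} \<in> X \<and> (\<forall>F\<in>X. \<forall>G. G \<subseteq> F \<longrightarrow> G \<in> X)"

definition complex_dim :: "'v set set \<Rightarrow> int"
  where "complex_dim X = int (Max (card ` X)) - 1"

definition boundary_simplex :: "'v set \<Rightarrow> 'v set set"
  where "boundary_simplex V = {F. F \<subset> V}"

definition join :: "'v set set \<Rightarrow> 'v set set \<Rightarrow> 'v set set"
  where "join X Y = {F \<union> G | F G. F \<in> X \<and> G \<in> Y}"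

definition join_family :: "'i set \<Rightarrow> ('i \<Rightarrow> 'v set set) \<Rightarrow> 'v set set"
  where "join_family I X = {\<Union>i\<in>I. F i | F. \<forall>i\<in>I. F i \<in> X i}"

lemma join_family_empty: "join_family {} X = {{}}"
  by (auto simp: join_family_def)

lemma join_family_insert:
  assumes "i \<notin> I"
  shows "join_family (insert i I) X = join (X i) (join_family I X)"
proof
  show "join_family (insert i I) X \<subseteq> join (X i) (join_family I X)"
  proof
    fix H assume "H \<in> join_family (insert i I) X"
    then obtain F where F: "H = F i \<union> (\<Union>l\<in>I. F l)" "F i \<in> X i" "\<forall>l\<in>I. F l \<in> X l"
      unfolding join_family_def by auto
    then have "(\<Union>l\<in>I. F l) \<in> join_family I X"
      unfolding join_family_def by blast
    with F show "H \<in> join (X i) (join_family I X)"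
      unfolding join_def by blast
  qed
  show "join (X i) (join_family I X) \<subseteq> join_family (insert i I) X"
  proof
    fix H assume "H \<in> join (X i) (join_family I X)"
    then obtain G F where GF: "H = G \<union> (\<Union>l\<in>I. F l)" "G \<in> X i" "\<forall>l\<in>I. F l \<in> X l"
      unfolding join_family_def join_def by blast
    have "(\<Union>l\<in>insert i I. (F(i := G)) l) = H"
      using assms GF(1) by auto
    moreover have "\<forall>l\<in>insert i I. (F(i := G)) l \<in> X l"
      using GF by auto
    ultimately show "H \<in> join_family (insert i I) X"
      unfolding join_family_def by blast
  qed
qed

text \<open>
  The geometric realization of a finite complex in barycentric coordinates: points are the
  nonnegative functions with sum 1 whose support is a face.
\<close>

definition geom_realization :: "'v set set \<Rightarrow> ('v \<Rightarrow> real) topology"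
  where "geom_realization X = subtopology (powertop_real UNIV)
    {t. (\<forall>v. 0 \<le> t v) \<and> {v. t v \<noteq> 0} \<in> X \<and> (\<Sum>v | t v \<noteq> 0. t v) = 1}"

definition closed_unit_ball :: "nat \<Rightarrow> (nat \<Rightarrow> real) topology"
  where "closed_unit_ball d = subtopology (Euclidean_space d) {x. (\<Sum>i<d. x i ^ 2) \<le> 1}"

definition simplicial_ball :: "'v set set \<Rightarrow> bool"
  where "simplicial_ball X \<longleftrightarrow>
    (\<exists>d. complex_dim X = int d \<and> geom_realization X homeomorphic_space closed_unit_ball d)"

definition set_monomial :: "'v set \<Rightarrow> ('v, 'k::field) mpoly"
  where "set_monomial R = (\<Prod>v\<in>R. var v)"

definition stanley_reisner_ideal :: "'v set \<Rightarrow> 'v set set \<Rightarrow> ('v, 'k::field) mpoly set"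
  where "stanley_reisner_ideal V X = gen_ideal V (set_monomial ` {R. R \<subseteq> V \<and> R \<notin> X})"

end

(*
  On exponent vectors, x - y being a non-zero-divisor modulo a monomial ideal says that, for fixed
  exponents of the other variables, the exponents of x and y of the monomials in the ideal form a
  quadrant. Hence along a sequence of separations purity is preserved: every monomial outside J
  survives localization at the complement of some transversal of the fibers A_i. So J is the
  Stanley-Reisner ideal of a complex X whose facets are complements of transversals. The same
  analysis injects the monomials outside j into these facets. Since, conversely, a monomial in j
  yields a box B in A, of the complementary size, all of whose transversals are complements of
  nonfacets, the set U of these transversals is extremal: it has as many elements as there are sizes
  of boxes B with all transversals in U (in general there are at most as many sizes).

  Extremality passes to the two sets P and Q of transversals of A - {v} that come from those
  transversals in U that avoid v, respectively contain v, and to their union and intersection. The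
  complex whose facets are the complements of the members of U is the union of a cone over the complex
  of P with apex v and a cone over the complex of Q with apex the barycenter of the rest of the fiber
  of v. By induction the bases are hemispheres of a smaller sphere, and by Alexander's trick the two
  cones glue to a ball. The complementary complex X is treated alike.

  In a proper polarization all variables occur in minimal generators, so purity bounds the size of the
  fiber over x_i by alpha_i; adding variables then gives fibers of size alpha_i.
*)
theory Submission
  imports Defs
begin

section \<open>Discs, spheres and cones\<close>

text \<open>Two discs glued along part of their boundaries give a disc when that part and its
  complement in the boundary sphere are discs as well. This shapes the induction: it has to deliver
  \<open>U\<close> and its complement at once, as hemispheres with a common boundary, and it has to
  apply to the intersection of P and Q, along which the two cones meet, and to their union, whose
  complement plays that role for the complementary complex. The closure of extremality under both
  operations is therefore the heart of the matter. Extremality is the equality case of a reverse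
  Sauer inequality: if all fibers have two elements, the sizes of boxes are the directions of
  subcubes contained in \<open>U\<close>, and the extremal sets are the shattering-extremal set
  systems. The barycenter enters because the complement of a transversal through v contains the
  whole rest of the fiber of v, and a full simplex is the cone from its barycenter over its
  boundary.\<close>

instance "fun" :: (type, t2_space) t2_space
proof
  fix x y :: "'a \<Rightarrow> 'b" assume "x \<noteq> y"
  then obtain i where "x i \<noteq> y i" by auto
  then obtain U V where UV: "open U" "open V" "x i \<in> U" "y i \<in> V" "U \<inter> V = {}" by (meson hausdorff)
  have c: "continuous_on UNIV (\<lambda>f::'a\<Rightarrow>'b. f i)"
    by (rule continuous_on_product_then_coordinatewise) (rule continuous_on_id)
  show "\<exists>U V. open U \<and> open V \<and> x \<in> U \<and> y \<in> V \<and> U \<inter> V = {}"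
    using UV open_vimage[OF UV(1) c] open_vimage[OF UV(2) c]
    by (intro exI[of _ "(\<lambda>f. f i) -` U"] exI[of _ "(\<lambda>f. f i) -` V"]) auto
qed

text \<open>No inverse is asked for: on a compact set a continuous injection into a Hausdorff space
  is a homeomorphism onto its image. The spaces in question are sets of real-valued functions, hence
  the instance above.\<close>

definition homeo :: "'x::t2_space set \<Rightarrow> 'y::t2_space set \<Rightarrow> ('x \<Rightarrow> 'y) \<Rightarrow> bool"
  where "homeo X Y h \<longleftrightarrow> compact X \<and> continuous_on X h \<and> inj_on h X \<and> h ` X = Y"

lemma homeo_compact: assumes "homeo X Y h" shows "compact X" "compact Y"
  using assms unfolding homeo_def by (auto intro: compact_continuous_image)

lemma homeo_inv:
  assumes "homeo X Y h"
  shows "homeo Y X (inv_into X h)"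
proof -
  have "continuous_on (h ` X) (inv_into X h)"
    using assms by (intro continuous_on_inv) (auto simp: homeo_def)
  then show ?thesis
    using assms homeo_compact[OF assms]
    by (auto simp: homeo_def inj_on_inv_into inv_into_image_cancel)
qed

lemma homeo_comp: "homeo X Y f \<Longrightarrow> homeo Y Z g \<Longrightarrow> homeo X Z (g \<circ> f)"
  unfolding homeo_def using continuous_on_compose[of X f g] comp_inj_on[of f X g] by (auto simp: image_comp)

lemma homeo_id: "compact X \<Longrightarrow> homeo X X id"
  by (simp add: homeo_def)

lemma homeo_subset:
  assumes "homeo X Y h" "closed X'" "X' \<subseteq> X"
  shows "homeo X' (h ` X') h"
  using assms compact_Int_closed[of X X'] unfolding homeo_def
  by (auto intro: continuous_on_subset inj_on_subset simp: Int_absorb1)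

text \<open>Continuity is the pasting lemma for two closed sets. The last hypothesis lets the images
  meet only over the common part, which is what injectivity of the glued map needs.\<close>

lemma homeo_glue:
  assumes "homeo X Y f" "homeo X' Y' g" "\<And>x. x \<in> X \<inter> X' \<Longrightarrow> f x = g x" "Y \<inter> Y' \<subseteq> f ` (X \<inter> X')"
  obtains h where "homeo (X \<union> X') (Y \<union> Y') h" "\<And>x. x \<in> X \<Longrightarrow> h x = f x" "\<And>x. x \<in> X' \<Longrightarrow> h x = g x"
proof -
  define h where "h x = (if x \<in> X then f x else g x)" for x
  have hX: "h x = f x" if "x \<in> X" for x using that by (simp add: h_def)
  have hX': "h x = g x" if "x \<in> X'" for x using that assms(3) by (auto simp: h_def)
  have cl: "closed X" "closed X'"
    using assms(1,2) by (auto simp: homeo_def intro: compact_imp_closed)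
  have "continuous_on X h" "continuous_on X' h"
    using assms(1,2) hX hX' by (auto simp: homeo_def cong: continuous_on_cong)
  then have 1: "continuous_on (X \<union> X') h"
    using cl by (intro continuous_on_closed_Un)
  have img: "h ` (X \<union> X') = Y \<union> Y'"
    using assms(1,2) hX hX' by (auto simp: homeo_def image_Un)
  have aux: "x = y" if xy: "x \<in> X" "y \<in> X'" "h x = h y" for x y
  proof -
    have "f x = g y" using xy hX hX' by auto
    moreover have "f x \<in> Y" "g y \<in> Y'" using xy assms(1,2) by (auto simp: homeo_def)
    ultimately obtain z where z: "z \<in> X \<inter> X'" "f x = f z" using assms(4) by auto
    then have "x = z" using xy(1) assms(1) by (auto simp: homeo_def inj_on_def)
    moreover have "g z = g y" using z assms(3) \<open>f x = g y\<close> by auto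
    then have "z = y" using z xy(2) assms(2) by (auto simp: homeo_def inj_on_def)
    ultimately show ?thesis by simp
  qed
  have "inj_on h (X \<union> X')"
  proof (rule inj_onI)
    fix x y assume xy: "x \<in> X \<union> X'" "y \<in> X \<union> X'" "h x = h y"
    consider "x \<in> X" "y \<in> X" | "x \<in> X'" "y \<in> X'" | "x \<in> X" "y \<in> X'" | "x \<in> X'" "y \<in> X" using xy by auto
    then show "x = y"
    proof cases
      case 1 then show ?thesis using xy hX assms(1) by (auto simp: homeo_def inj_on_def)
    next
      case 2 then show ?thesis using xy hX' assms(2) by (auto simp: homeo_def inj_on_def)
    next
      case 3 then show ?thesis using aux xy by auto
    next
      case 4 then show ?thesis using aux[of y x] xy by auto
    qed
  qed
  with 1 img have "homeo (X \<union> X') (Y \<union> Y') h"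
    using assms(1,2) by (auto simp: homeo_def)
  then show thesis using hX hX' that by blast
qed

text \<open>A continuous map out of a compact set is closed, so closed sets have closed preimages
  under the induced map \<open>h\<close>. This serves to define homeomorphisms in polar or cone
  coordinates, which are not injective at the origin or the apex.\<close>

lemma quotient_homeo:
  fixes q :: "'z::t2_space \<Rightarrow> 'x::t2_space" and q' :: "'z \<Rightarrow> 'y::t2_space"
  assumes K: "compact K" and q: "continuous_on K q" and q': "continuous_on K q'"
    and ker: "\<And>x y. x \<in> K \<Longrightarrow> y \<in> K \<Longrightarrow> q x = q y \<longleftrightarrow> q' x = q' y"
  obtains h where "homeo (q ` K) (q' ` K) h" "\<And>x. x \<in> K \<Longrightarrow> h (q x) = q' x"
proof -
  define h where "h z = q' (inv_into K q z)" for z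
  have hq: "h (q x) = q' x" if "x \<in> K" for x
  proof -
    have "q (inv_into K q (q x)) = q x" "inv_into K q (q x) \<in> K"
      using that by (auto simp: f_inv_into_f inv_into_into)
    then show ?thesis using ker that unfolding h_def by blast
  qed
  have "closed (h -` C \<inter> q ` K)" if "closed C" for C
  proof -
    have "h -` C \<inter> q ` K = q ` (q' -` C \<inter> K)" using hq by force
    moreover have "closed (q' -` C \<inter> K)"
      using iffD1[OF continuous_on_closed_vimage[OF compact_imp_closed[OF K]] q'] that by blast
    then have "compact (q' -` C \<inter> K)"
      using K by (metis compact_Int_closed inf.commute inf.right_idem)
    then have "compact (q ` (q' -` C \<inter> K))"
      by (intro compact_continuous_image continuous_on_subset[OF q]) auto
    ultimately show ?thesis by (simp add: compact_imp_closed)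
  qed
  moreover have c: "compact (q ` K)" using q K by (rule compact_continuous_image)
  ultimately have "continuous_on (q ` K) h"
    using iffD2[OF continuous_on_closed_vimage[OF compact_imp_closed[OF c]]] by blast
  moreover have "inj_on h (q ` K)" using hq ker by (auto simp: inj_on_def)
  moreover have "h ` q ` K = q' ` K" using hq by (force simp: image_image)
  ultimately have "homeo (q ` K) (q' ` K) h" using c by (simp add: homeo_def)
  then show thesis using hq that by blast
qed

section \<open>Balls and spheres in coordinates\<close>

definition RR :: "nat \<Rightarrow> (nat \<Rightarrow> real) set"
  where "RR k = {x. \<forall>i\<ge>k. x i = 0}"

definition nrm :: "nat \<Rightarrow> (nat \<Rightarrow> real) \<Rightarrow> real"
  where "nrm k x = L2_set x {..<k}"

text \<open>Balls of all dimensions live in the one type \<open>nat \<Rightarrow> real\<close> with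
  its product topology, in agreement with \<open>closed_unit_ball\<close>.\<close>

definition DD :: "nat \<Rightarrow> (nat \<Rightarrow> real) set"
  where "DD k = {x \<in> RR k. nrm k x \<le> 1}"

text \<open>The sphere of dimension \<open>k - 1\<close>; for \<open>k = 0\<close> it is empty, the
  boundary of a point.\<close>

definition SS :: "nat \<Rightarrow> (nat \<Rightarrow> real) set"
  where "SS k = {x \<in> RR k. nrm k x = 1}"

lemma nrm_scale: "c \<ge> 0 \<Longrightarrow> nrm k (\<lambda>i. c * x i) = c * nrm k x"
  unfolding nrm_def by (simp add: L2_set_right_distrib)

lemma nrm_nonneg: "nrm k x \<ge> 0"
  by (simp add: nrm_def)

lemma nrm_eq_0: "x \<in> RR k \<Longrightarrow> nrm k x = 0 \<longleftrightarrow> x = (\<lambda>_. 0)"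
  unfolding nrm_def RR_def by (auto simp: L2_set_eq_0_iff fun_eq_iff not_le intro: leI)

lemma continuous_on_coord [continuous_intros]:
  fixes X :: "('i \<Rightarrow> 'b::topological_space) set" and Y :: "('c::topological_space \<times> ('i \<Rightarrow> 'b)) set"
  shows "continuous_on X (\<lambda>x. x i)" "continuous_on Y (\<lambda>x. snd x i)"
  by (rule continuous_on_product_then_coordinatewise, intro continuous_on_id continuous_on_snd)+

lemma continuous_on_nrm [continuous_intros]:
  assumes "continuous_on X f" shows "continuous_on X (\<lambda>x. nrm k (f x))"
proof -
  have c: "continuous_on X (\<lambda>x. f x i)" for i
    using assms by (rule continuous_on_product_then_coordinatewise)
  show ?thesis
    unfolding nrm_def L2_set_def
    by (rule continuous_on_real_sqrt, rule continuous_on_sum, rule continuous_on_power, rule c)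
qed

lemma abs_le_nrm: "i < k \<Longrightarrow> \<bar>x i\<bar> \<le> nrm k x"
proof -
  assume "i < k"
  then have "\<bar>x i\<bar> \<le> L2_set (\<lambda>i. \<bar>x i\<bar>) {..<k}"
    by (intro member_le_L2_set) auto
  then show ?thesis by (simp add: nrm_def L2_set_def)
qed

lemma compact_box:
  fixes K :: "'i \<Rightarrow> real set"
  assumes "\<And>i. compact (K i)"
  shows "compact {x. \<forall>i. x i \<in> K i}"
proof -
  have "compactin (powertop_real UNIV) (PiE UNIV K)"
    using assms by (simp add: compactin_PiE)
  moreover have "PiE UNIV K = {x. \<forall>i. x i \<in> K i}" by (auto simp: PiE_def)
  ultimately show ?thesis by (simp add: euclidean_product_topology)
qed

lemma closed_RR: "closed (RR k)"
proof -
  have "RR k = (\<Inter>i\<in>{k..}. {x. x i = 0})" by (auto simp: RR_def)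
  moreover have "closed {x::nat\<Rightarrow>real. x i = 0}" for i
    by (intro closed_Collect_eq continuous_intros)
  ultimately show ?thesis by auto
qed

lemma compact_DD: "compact (DD k)" and compact_SS: "compact (SS k)"
proof -
  let ?B = "{x::nat\<Rightarrow>real. \<forall>i. x i \<in> {-1..1}}"
  have B: "compact ?B" by (rule compact_box) simp
  have sub: "DD k \<subseteq> ?B"
  proof
    fix x assume x: "x \<in> DD k"
    have "x i \<in> {-1..1}" for i
    proof (cases "i < k")
      case True
      then show ?thesis using abs_le_nrm[of i k x] x by (auto simp: DD_def)
    next
      case False
      then show ?thesis using x by (auto simp: DD_def RR_def)
    qed
    then show "x \<in> ?B" by blast
  qed
  have c: "closed (DD k)" "closed (SS k)"
    unfolding DD_def SS_def
    by (auto intro!: closed_Int[of "RR k", simplified Int_def mem_Collect_eq] closed_RR closed_Collect_le closed_Collect_eq continuous_intros simp: Collect_conj_eq)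
  show "compact (DD k)" using compact_Int_closed[OF B c(1)] sub by (simp add: Int_absorb1)
  have "SS k \<subseteq> ?B" using sub by (auto simp: SS_def DD_def)
  then show "compact (SS k)" using compact_Int_closed[OF B c(2)] by (simp add: Int_absorb1)
qed

lemma DD_0: "DD 0 = {\<lambda>_. 0}" and SS_0: "SS 0 = {}"
  by (auto simp: DD_def SS_def RR_def nrm_def)

text \<open>The boundary \<open>E\<close> is carried along as data: gluings have to say which part
  of the boundary is used, and reading it off from \<open>D\<close> alone would take invariance of
  domain.\<close>

definition disc :: "nat \<Rightarrow> 'x::t2_space set \<Rightarrow> 'x set \<Rightarrow> bool"
  where "disc k D E \<longleftrightarrow> E \<subseteq> D \<and> (\<exists>h. homeo D (DD k) h \<and> h ` E = SS k)"

definition sphere_like :: "nat \<Rightarrow> 'x::t2_space set \<Rightarrow> bool"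
  where "sphere_like k S \<longleftrightarrow> (\<exists>h. homeo S (SS k) h)"

lemma polar:
  assumes "k > 0"
  shows "(\<lambda>(r,u) i. r * u i) ` ({0..1} \<times> SS k) = DD k"
proof (intro equalityI subsetI)
  fix x assume "x \<in> (\<lambda>(r::real,u) i. r * u i) ` ({0..1} \<times> SS k)"
  then show "x \<in> DD k" by (auto simp: DD_def SS_def RR_def nrm_scale)
next
  fix x assume x: "x \<in> DD k"
  define r where "r = nrm k x"
  show "x \<in> (\<lambda>(r::real,u) i. r * u i) ` ({0..1} \<times> SS k)"
  proof (cases "r = 0")
    case True
    then have x0: "x = (\<lambda>_. 0)" using x nrm_eq_0 by (auto simp: r_def DD_def)
    define u :: "nat \<Rightarrow> real" where "u i = (if i = 0 then 1 else 0)" for i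
    have "L2_set u {..<k} = 1"
    proof -
      have "(\<Sum>i<k. (u i)\<^sup>2) = (\<Sum>i<k. if i = 0 then 1 else 0)" by (intro sum.cong) (auto simp: u_def)
      then show ?thesis using assms by (simp add: L2_set_def)
    qed
    then have "u \<in> SS k" using assms by (auto simp: SS_def RR_def nrm_def u_def)
    then show ?thesis using x0 by (auto intro!: image_eqI[of _ _ "(0,u)"])
  next
    case False
    then have r: "r > 0" "r \<le> 1" using x nrm_nonneg[of k x] by (auto simp: r_def DD_def)
    define u where "u = (\<lambda>i. (1/r) * x i)"
    have "nrm k u = 1" unfolding u_def using r by (subst nrm_scale) (auto simp: r_def)
    then have "u \<in> SS k" using x by (auto simp: SS_def RR_def DD_def u_def)
    moreover have "x = (\<lambda>i. r * u i)" using r by (auto simp: u_def)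
    ultimately show ?thesis using r by (auto intro!: image_eqI[of _ _ "(r,u)"])
  qed
qed

lemma polar_inj:
  assumes "u \<in> SS k" "u' \<in> SS k" "r \<ge> 0" "r' \<ge> 0"
  shows "(\<lambda>i. r * u i) = (\<lambda>i. r' * u' i) \<longleftrightarrow> r = r' \<and> (r = 0 \<or> u = u')"
proof
  assume eq: "(\<lambda>i. r * u i) = (\<lambda>i. r' * u' i)"
  then have "nrm k (\<lambda>i. r * u i) = nrm k (\<lambda>i. r' * u' i)" by simp
  then have "r = r'" using assms by (simp add: nrm_scale SS_def)
  moreover have "u = u'" if "r \<noteq> 0"
    using eq that \<open>r = r'\<close> by (auto simp: fun_eq_iff)
  ultimately show "r = r' \<and> (r = 0 \<or> u = u')" by blast
qed auto

lemma disc_sphere_compact: "disc k D E \<Longrightarrow> compact D" "disc k D E \<Longrightarrow> closed E"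
proof -
  assume d: "disc k D E"
  then obtain h where h: "homeo D (DD k) h" "h ` E = SS k" "E \<subseteq> D" by (auto simp: disc_def)
  show "compact D" using h homeo_compact by blast
  have g: "homeo (DD k) D (inv_into D h)" using h homeo_inv by blast
  have "SS k \<subseteq> DD k" by (auto simp: SS_def DD_def)
  then have "compact (inv_into D h ` SS k)" using g compact_SS
    unfolding homeo_def by (meson compact_continuous_image continuous_on_subset)
  moreover have "inv_into D h ` SS k = E"
    using h inv_into_image_cancel[of h D E] by (auto simp: homeo_def)
  ultimately show "closed E" by (simp add: compact_imp_closed)
qed

lemma disc_homeo:
  assumes "disc k D E" "homeo D D' f" "f ` E = E'"
  shows "disc k D' E'"
proof -
  obtain h where h: "homeo D (DD k) h" "h ` E = SS k" "E \<subseteq> D" using assms by (auto simp: disc_def)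
  have "homeo D' (DD k) (h \<circ> inv_into D f)"
    using homeo_comp[OF homeo_inv[OF assms(2)] h(1)] .
  moreover have "inv_into D f ` E' = E" using assms h(3)
    by (metis inv_into_image_cancel homeo_def)
  then have "(h \<circ> inv_into D f) ` E' = SS k" using h by (metis image_comp)
  moreover have "E' \<subseteq> D'" using assms h(3) by (auto simp: homeo_def)
  ultimately show ?thesis unfolding disc_def by blast
qed

lemma sphere_like_homeo:
  assumes "sphere_like k S" "homeo S S' f" shows "sphere_like k S'"
  using assms homeo_comp[OF homeo_inv[OF assms(2)]] unfolding sphere_like_def by blast

lemma disc_boundary_sphere: assumes "disc k D E" shows "sphere_like k E"
proof -
  obtain h where h: "homeo D (DD k) h" "h ` E = SS k" "E \<subseteq> D" using assms by (auto simp: disc_def)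
  then have "homeo E (SS k) h" using homeo_subset disc_sphere_compact(2)[OF assms] by metis
  then show ?thesis by (auto simp: sphere_like_def)
qed

text \<open>Alexander's trick: extend radially.\<close>

lemma alexander:
  assumes "disc k D E" "disc k D' E'" "homeo E E' f"
  obtains h where "homeo D D' h" "\<And>x. x \<in> E \<Longrightarrow> h x = f x"
\<comment> \<open>Polar coordinates miss the one-point ball, whose boundary sphere is empty.\<close>
proof (cases "k = 0")
  case True
  from assms obtain g g' where g: "homeo D (DD k) g" "g ` E = SS k" "homeo D' (DD k) g'"
    by (auto simp: disc_def)
  have "homeo D D' (inv_into D' g' \<circ> g)" using homeo_comp[OF g(1) homeo_inv[OF g(3)]] .
  moreover have "E = {}" using g True by (auto simp: SS_0)
  ultimately show thesis using that by auto
next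
  case False
  from assms obtain g g' where g: "homeo D (DD k) g" "g ` E = SS k" "E \<subseteq> D"
      "homeo D' (DD k) g'" "g' ` E' = SS k" "E' \<subseteq> D'"
    by (auto simp: disc_def)
  have gE: "homeo E (SS k) g" and gE': "homeo E' (SS k) g'"
    using homeo_subset g disc_sphere_compact(2)[OF assms(1)] disc_sphere_compact(2)[OF assms(2)] by metis+
  \<comment> \<open>\<open>f\<close> transported to the unit sphere. The extension sends the point
    at radius \<open>r\<close> over \<open>u\<close> to the point at radius \<open>r\<close> over
    \<open>\<phi> u\<close>.\<close>
  define \<phi> where "\<phi> = g' \<circ> (f \<circ> inv_into E g)"
  have \<phi>: "homeo (SS k) (SS k) \<phi>"
    unfolding \<phi>_def by (rule homeo_comp[OF homeo_comp[OF homeo_inv[OF gE] assms(3)] gE'])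
  define q where "q = (\<lambda>(r::real,u) (i::nat). r * u i)"
  define q' where "q' = (\<lambda>(r::real,u) i. r * \<phi> u i)"
  have img': "q' ` ({0..1} \<times> SS k) = q ` ({0..1} \<times> SS k)"
  proof -
    have "q' ` ({0..1} \<times> SS k) = q ` ((\<lambda>(r,u). (r, \<phi> u)) ` ({0..1} \<times> SS k))"
      unfolding image_image q_def q'_def by (rule image_cong) auto
    also have "(\<lambda>(r,u). (r, \<phi> u)) ` ({0..1::real} \<times> SS k) = {0..1} \<times> (\<phi> ` SS k)" by force
    finally show ?thesis using \<phi> by (simp add: homeo_def)
  qed
  obtain H where H: "homeo (q ` ({0..1} \<times> SS k)) (q' ` ({0..1} \<times> SS k)) H"
      "\<And>x. x \<in> {0..1} \<times> SS k \<Longrightarrow> H (q x) = q' x"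
  proof (rule quotient_homeo[of "{0..1} \<times> SS k" q q'])
    show "compact ({0..1::real} \<times> SS k)" by (intro compact_Times compact_SS) simp
    have c: "continuous_on (SS k) \<phi>" using \<phi> by (simp add: homeo_def)
    show "continuous_on ({0..1} \<times> SS k) q" unfolding q_def split_def
      by (intro continuous_on_coordinatewise_then_product continuous_on_mult continuous_on_fst continuous_on_coord continuous_on_id)
    have "continuous_on ({0..1::real} \<times> SS k) (\<lambda>x. \<phi> (snd x))"
      by (rule continuous_on_compose2[OF c]) (auto intro!: continuous_intros)
    then show "continuous_on ({0..1} \<times> SS k) q'" unfolding q'_def split_def
      by (intro continuous_on_coordinatewise_then_product continuous_on_mult continuous_on_fst continuous_on_id)
        (rule continuous_on_product_then_coordinatewise)
    fix x y :: "real \<times> (nat \<Rightarrow> real)" assume xy: "x \<in> {0..1} \<times> SS k" "y \<in> {0..1} \<times> SS k"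
    then have "\<phi> (snd x) \<in> SS k" "\<phi> (snd y) \<in> SS k" "\<phi> (snd x) = \<phi> (snd y) \<longleftrightarrow> snd x = snd y"
      using \<phi> by (auto simp: homeo_def inj_on_def)
    then show "q x = q y \<longleftrightarrow> q' x = q' y"
      using xy unfolding q_def q'_def split_def by (subst (1 2) polar_inj[where k=k]) auto
  qed blast
  have q: "q ` ({0..1} \<times> SS k) = DD k" unfolding q_def using polar False by blast
  define h where "h = inv_into D' g' \<circ> (H \<circ> g)"
  have "homeo D D' h" 
    unfolding h_def using homeo_comp[OF homeo_comp[OF g(1)] homeo_inv[OF g(4)]] H(1) q img' by metis
  moreover have "h x = f x" if "x \<in> E" for x
  proof -
    have gx: "g x \<in> SS k" using g that by auto
    have fx: "f x \<in> E'" using assms(3) that by (auto simp: homeo_def)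
    have "H (q (1, g x)) = q' (1, g x)" by (rule H) (use gx in auto)
    then have "H (g x) = \<phi> (g x)" by (simp add: q_def q'_def)
    also have "\<dots> = g' (f x)" unfolding \<phi>_def using gE that by (auto simp: homeo_def)
    finally have "h x = inv_into D' g' (g' (f x))" by (simp add: h_def)
    then show ?thesis using g fx by (auto simp: homeo_def)
  qed
  ultimately show thesis using that by blast
qed

text \<open>A positively homogeneous function that is positive on the unit sphere has a unit
  sublevel set star-shaped about the origin, and radial rescaling by \<open>g\<close> carries the
  round ball onto it. Cones and double cones, which are not round, are recognized as balls in this
  way.\<close>

lemma gauge_disc:
  assumes c: "continuous_on (SS k) g"
    and sc: "\<And>x r. x \<in> SS k \<Longrightarrow> r \<ge> 0 \<Longrightarrow> g (\<lambda>i. r * x i) = r * g x"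
    and pos: "\<And>x. x \<in> SS k \<Longrightarrow> g x > 0" and zero: "g (\<lambda>_. 0) = 0"
  shows "disc k {x \<in> RR k. g x \<le> 1} {x \<in> RR k. g x = (1::real)}"
proof (cases "k = 0")
  case True
  have "homeo {x \<in> RR k. g x \<le> 1} (DD k) id"
  proof -
    have "{x \<in> RR k. g x \<le> 1} = {\<lambda>_. 0}" using True zero by (auto simp: RR_def)
    then show ?thesis using True by (simp add: homeo_def DD_0)
  qed
  moreover have "{x \<in> RR k. g x = 1} = {}" 
  proof -
    have "x = (\<lambda>_. 0)" if "x \<in> RR k" for x using True that by (auto simp: RR_def)
    then show ?thesis using zero by fastforce
  qed
  ultimately show ?thesis using True by (auto simp: disc_def SS_0)
next
  case False
  define q where "q = (\<lambda>(r::real,u) (i::nat). r * u i)"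
  define q' where "q' = (\<lambda>(r::real,u) i. (r / g u) * u i)"
  have q'_g: "g (q' (r,u)) = r" if "u \<in> SS k" "r \<in> {0..1}" for r u
    using that pos[of u] sc[of u "r / g u"] by (auto simp: q'_def)
  have img: "q' ` ({0..1} \<times> SS k) = {x \<in> RR k. g x \<le> 1}"
  proof (intro equalityI subsetI)
    fix x assume "x \<in> q' ` ({0..1} \<times> SS k)"
    then show "x \<in> {x \<in> RR k. g x \<le> 1}"
      using q'_g by (auto simp: q'_def SS_def RR_def)
  next
    fix x assume x: "x \<in> {x \<in> RR k. g x \<le> 1}"
    show "x \<in> q' ` ({0..1} \<times> SS k)"
    proof (cases "x = (\<lambda>_. 0)")
      case True
      have "(\<lambda>_. 0) \<in> DD k" by (auto simp: DD_def RR_def nrm_def L2_set_def)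
      then obtain u where "u \<in> SS k" using polar[of k] False by blast
      then show ?thesis using True by (auto intro!: image_eqI[of _ _ "(0,u)"] simp: q'_def)
    next
      case False
      then have n: "nrm k x > 0" using nrm_eq_0[of x k] x nrm_nonneg[of k x] by auto
      define u where "u = (\<lambda>i. (1/nrm k x) * x i)"
      have "nrm k u = 1" unfolding u_def using n by (subst nrm_scale) auto
      then have u: "u \<in> SS k" using x by (auto simp: SS_def RR_def u_def)
      have xu: "x = (\<lambda>i. nrm k x * u i)" using n by (auto simp: u_def)
      then have gx: "g x = nrm k x * g u" using sc[OF u, of "nrm k x"] n by simp
      then have "g x / g u = nrm k x" using pos[OF u] by simp
      then have "q' (g x, u) = (\<lambda>i. nrm k x * u i)" unfolding q'_def by (simp only: prod.case)
      then have "x = q' (g x, u)" using xu by simp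
      moreover have "g x \<in> {0..1}" using x gx n pos[OF u] by simp
      ultimately show ?thesis using u by (auto intro!: image_eqI[of _ _ "(g x,u)"])
    qed
  qed
  obtain H where H: "homeo (q ` ({0..1} \<times> SS k)) (q' ` ({0..1} \<times> SS k)) H"
      "\<And>x. x \<in> {0..1} \<times> SS k \<Longrightarrow> H (q x) = q' x"
  proof (rule quotient_homeo[of "{0..1} \<times> SS k" q q'])
    show "compact ({0..1::real} \<times> SS k)" by (intro compact_Times compact_SS) simp
    show "continuous_on ({0..1} \<times> SS k) q" unfolding q_def split_def
      by (intro continuous_on_coordinatewise_then_product continuous_on_mult continuous_on_fst continuous_on_coord continuous_on_id)
    have "continuous_on ({0..1::real} \<times> SS k) (\<lambda>x. g (snd x))"
      by (rule continuous_on_compose2[OF c]) (auto intro!: continuous_intros)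
    moreover have "g (snd x) \<noteq> 0" if "x \<in> {0..1::real} \<times> SS k" for x using pos[of "snd x"] that by auto
    ultimately show "continuous_on ({0..1} \<times> SS k) q'" unfolding q'_def split_def
      by (intro continuous_on_coordinatewise_then_product continuous_on_mult continuous_on_divide
          continuous_on_fst continuous_on_coord continuous_on_id) auto
    fix x y :: "real \<times> (nat \<Rightarrow> real)" assume xy: "x \<in> {0..1} \<times> SS k" "y \<in> {0..1} \<times> SS k"
    obtain r u r' u' where ru: "x = (r,u)" "y = (r',u')" by (cases x, cases y)
    have "q x = q y \<longleftrightarrow> r = r' \<and> (r = 0 \<or> u = u')"
      using xy ru polar_inj[of u k u' r r'] unfolding q_def by auto
    moreover have "q' x = q' y \<longleftrightarrow> r / g u = r' / g u' \<and> (r / g u = 0 \<or> u = u')"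
      using xy ru pos[of u] pos[of u'] polar_inj[of u k u' "r / g u" "r' / g u'"] unfolding q'_def by auto
    moreover have "g u > 0" "g u' > 0" using pos xy ru by auto
    ultimately show "q x = q y \<longleftrightarrow> q' x = q' y" by auto
  qed blast
  have q: "q ` ({0..1} \<times> SS k) = DD k" unfolding q_def using polar False by blast
  have "disc k (DD k) (SS k)"
    using homeo_id[OF compact_DD[of k]] unfolding disc_def
    by (intro conjI exI[of _ id]) (auto simp: DD_def SS_def)
  moreover have "H ` SS k = {x \<in> RR k. g x = 1}"
  proof -
    have e: "H u = q' (1, u)" if "u \<in> SS k" for u
      using H(2)[of "(1,u)"] that by (simp add: q_def)
    show ?thesis
    proof (intro equalityI subsetI)
      fix x assume "x \<in> H ` SS k"
      then obtain u where u: "u \<in> SS k" "x = q' (1,u)" using e by auto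
      then have "g x = 1" using q'_g by auto
      moreover have "x \<in> RR k" using u img by force
      ultimately show "x \<in> {x \<in> RR k. g x = 1}" by simp
    next
      fix x assume x: "x \<in> {x \<in> RR k. g x = 1}"
      then have "x \<in> q' ` ({0..1} \<times> SS k)" using img by auto
      then obtain r u where ru: "x = q' (r,u)" "r \<in> {0..1}" "u \<in> SS k" by auto
      then have "r = 1" using q'_g[OF ru(3,2)] x by simp
      then show "x \<in> H ` SS k" using e ru by auto
    qed
  qed
  ultimately show ?thesis using disc_homeo H(1) q img by metis
qed

section \<open>Cones\<close>

definition cp :: "('v \<Rightarrow> real) \<Rightarrow> real \<Rightarrow> ('v \<Rightarrow> real) \<Rightarrow> 'v \<Rightarrow> real"
  where "cp c s y = (\<lambda>i. (1 - s) * c i + s * y i)"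

text \<open>The apex is inserted explicitly, so that the cone over the empty set is a point: the
  cone over the empty sphere is then the disc of dimension 0.\<close>

definition cone_over :: "('v \<Rightarrow> real) \<Rightarrow> ('v \<Rightarrow> real) set \<Rightarrow> ('v \<Rightarrow> real) set"
  where "cone_over c Y = insert c ((\<lambda>(s,y). cp c s y) ` ({0..1} \<times> Y))"

text \<open>The height function \<open>\<l>\<close> makes the cone parameter of a point unique.\<close>

definition coneable :: "('v \<Rightarrow> real) \<Rightarrow> ('v \<Rightarrow> real) set \<Rightarrow> bool"
  where "coneable c Y \<longleftrightarrow> (\<exists>\<l>. \<forall>s\<in>{0..1}. \<forall>y\<in>Y. \<l> (cp c s y) = 1 - s)"

lemma coneable_subset: "coneable c Y \<Longrightarrow> X \<subseteq> Y \<Longrightarrow> coneable c X"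
  unfolding coneable_def by blast

lemma cp_0 [simp]: "cp c 0 y = c" and cp_1 [simp]: "cp c 1 y = y"
  by (auto simp: cp_def)

lemma cp_eq_iff:
  assumes "coneable c Y" "s \<in> {0..1}" "s' \<in> {0..1}" "y \<in> Y" "y' \<in> Y"
  shows "cp c s y = cp c s' y' \<longleftrightarrow> s = s' \<and> (s = 0 \<or> y = y')"
proof
  assume eq: "cp c s y = cp c s' y'"
  obtain \<l> where "\<forall>s\<in>{0..1}. \<forall>y\<in>Y. \<l> (cp c s y) = 1 - s"
    using assms(1) by (auto simp: coneable_def)
  then have "1 - s = 1 - s'" using eq assms by metis
  moreover have "y = y'" if "s \<noteq> 0"
    using eq that \<open>1 - s = 1 - s'\<close> by (auto simp: cp_def fun_eq_iff)
  ultimately show "s = s' \<and> (s = 0 \<or> y = y')" by auto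
qed auto

lemma apex_notin:
  assumes "coneable c Y" shows "c \<notin> Y"
proof
  assume c: "c \<in> Y"
  have "cp c 0 c = cp c 1 c" by simp
  then show False using cp_eq_iff[OF assms, of 0 1 c c] c by simp
qed

lemma cone_iff: "x \<in> cone_over c Y \<longleftrightarrow> x = c \<or> (\<exists>s y. 0 \<le> s \<and> s \<le> 1 \<and> y \<in> Y \<and> x = cp c s y)"
  unfolding cone_over_def by auto

lemma cone_mono: "X \<subseteq> Y \<Longrightarrow> cone_over c X \<subseteq> cone_over c Y"
  unfolding cone_over_def by auto

lemma subset_cone: "Y \<subseteq> cone_over c Y"
proof
  fix y assume "y \<in> Y"
  then show "y \<in> cone_over c Y" unfolding cone_iff by (intro disjI2 exI[of _ 1] exI[of _ y]) auto
qed

lemma cone_empty [simp]: "cone_over c {} = {c}"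
  by (simp add: cone_over_def)

lemma cone_Int_base:
  assumes "coneable c Y" "Q \<subseteq> Y" "P \<subseteq> Y" shows "cone_over c Q \<inter> P = Q \<inter> P"
proof (intro equalityI subsetI)
  fix x assume x: "x \<in> cone_over c Q \<inter> P"
  then have "x \<noteq> c" using apex_notin[OF assms(1)] assms by auto
  then obtain s y where sy: "0 \<le> s" "s \<le> 1" "y \<in> Q" "x = cp c s y" using x by (auto simp: cone_iff)
  have "cp c 1 x = cp c s y" using sy by simp
  then have "x = y" using cp_eq_iff[OF assms(1), of 1 s x y] sy x assms by auto
  then show "x \<in> Q \<inter> P" using sy x by simp
qed (use subset_cone in blast)

lemma cone_Int_cone:
  assumes "coneable c Y" "Q \<subseteq> Y" "P \<subseteq> Y" shows "cone_over c Q \<inter> cone_over c P = cone_over c (Q \<inter> P)"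
proof (intro equalityI subsetI)
  fix x assume x: "x \<in> cone_over c Q \<inter> cone_over c P"
  show "x \<in> cone_over c (Q \<inter> P)"
  proof (cases "x = c")
    case False
    then obtain s y s' y' where sy: "0 \<le> s" "s \<le> 1" "y \<in> Q" "x = cp c s y"
      "0 \<le> s'" "s' \<le> 1" "y' \<in> P" "x = cp c s' y'" using x by (auto simp: cone_iff)
    have "s = s' \<and> (s = 0 \<or> y = y')" using cp_eq_iff[OF assms(1), of s s' y y'] sy assms by auto
    then show ?thesis using sy False by (auto simp: cone_iff)
  qed (simp add: cone_iff)
qed (auto simp: cone_iff)

lemma continuous_on_cp:
  "continuous_on (A :: (real \<times> ('v \<Rightarrow> real)) set) (\<lambda>x. cp c (fst x) (snd x))"
  unfolding cp_def
  by (intro continuous_on_coordinatewise_then_product continuous_on_add continuous_on_mult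
      continuous_on_diff continuous_on_const continuous_on_fst continuous_on_coord continuous_on_id)

text \<open>\<open>f\<close> is extended linearly along the rays. The conclusion about all
  \<open>Q \<subseteq> P\<close> serves to follow the boundary of a disc through the map.\<close>

lemma cone_map:
  fixes c :: "'v \<Rightarrow> real" and c' :: "'w \<Rightarrow> real"
  assumes f: "homeo P P' f" and c: "coneable c P" "coneable c' P'"
  obtains h where "homeo (cone_over c P) (cone_over c' P') h"
    "\<And>x. x \<in> P \<Longrightarrow> h x = f x" "\<And>Q. Q \<subseteq> P \<Longrightarrow> h ` cone_over c Q = cone_over c' (f ` Q)"
proof (cases "P = {}")
  case True
  then have "P' = {}" using f by (auto simp: homeo_def)
  have "homeo {c} {c'} (\<lambda>_. c')" by (simp add: homeo_def)
  then show thesis using that[of "\<lambda>_. c'"] True \<open>P' = {}\<close> by auto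
next
  case False
  define q where "q x = cp c (fst x) (snd x)" for x
  define q' where "q' x = cp c' (fst x) (f (snd x))" for x
  have fP: "f ` P = P'" "continuous_on P f" "inj_on f P" "compact P" using f by (auto simp: homeo_def)
  have img: "q ` ({0..1} \<times> Q) = cone_over c Q" "q' ` ({0..1} \<times> Q) = cone_over c' (f ` Q)" if Q: "Q \<noteq> {}" for Q
  proof -
    obtain y where y: "y \<in> Q" using Q by auto
    have "c \<in> q ` ({0..1} \<times> Q)" using y by (auto intro!: image_eqI[of _ _ "(0,y)"] simp: q_def)
    then show "q ` ({0..1} \<times> Q) = cone_over c Q" unfolding cone_over_def q_def split_def by auto
    have "c' \<in> q' ` ({0..1} \<times> Q)" using y by (auto intro!: image_eqI[of _ _ "(0,y)"] simp: q'_def)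
    moreover have "q' ` ({0..1} \<times> Q) = (\<lambda>(s,y). cp c' s y) ` ({0..1} \<times> f ` Q)"
      unfolding q'_def by force
    ultimately show "q' ` ({0..1} \<times> Q) = cone_over c' (f ` Q)" unfolding cone_over_def using insert_absorb by metis
  qed
  obtain h where h: "homeo (q ` ({0..1} \<times> P)) (q' ` ({0..1} \<times> P)) h"
      "\<And>x. x \<in> {0..1} \<times> P \<Longrightarrow> h (q x) = q' x"
  proof (rule quotient_homeo[of "{0..1} \<times> P" q q'])
    show "compact ({0..1::real} \<times> P)" using fP by (intro compact_Times) simp_all
    show "continuous_on ({0..1} \<times> P) q" unfolding q_def by (rule continuous_on_cp)
    have c2: "continuous_on ({0..1::real} \<times> P) (\<lambda>x. f (snd x))"
      by (rule continuous_on_compose2[OF fP(2)]) (auto intro!: continuous_intros)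
    have "continuous_on ({0..1::real} \<times> P) (\<lambda>x. (fst x, f (snd x)))"
      by (intro continuous_on_Pair continuous_on_fst continuous_on_id c2)
    then show "continuous_on ({0..1} \<times> P) q'"
      using continuous_on_compose2[OF continuous_on_cp[of UNIV c']] unfolding q'_def by fastforce
    fix x y :: "real \<times> ('v \<Rightarrow> real)" assume xy: "x \<in> {0..1} \<times> P" "y \<in> {0..1} \<times> P"
    have "f (snd x) \<in> P'" "f (snd y) \<in> P'" "f (snd x) = f (snd y) \<longleftrightarrow> snd x = snd y"
      using xy fP by (auto simp: inj_on_def)
    then show "q x = q y \<longleftrightarrow> q' x = q' y"
      using xy cp_eq_iff[OF c(1), of "fst x" "fst y" "snd x" "snd y"]
        cp_eq_iff[OF c(2), of "fst x" "fst y" "f (snd x)" "f (snd y)"]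
      unfolding q_def q'_def by auto
  qed blast
  show thesis
  proof (rule that[of h])
    show "homeo (cone_over c P) (cone_over c' P') h" using h(1) img[OF False] fP by simp
    fix x assume "x \<in> P"
    then show "h x = f x" using h(2)[of "(1,x)"] by (simp add: q_def q'_def)
  next
    fix Q assume Q: "Q \<subseteq> P"
    show "h ` cone_over c Q = cone_over c' (f ` Q)"
    proof (cases "Q = {}")
      case True
      obtain y where "y \<in> P" using False by auto
      then have "h c = c'" using h(2)[of "(0,y)"] by (simp add: q_def q'_def)
      then show ?thesis using True by simp
    next
      case False
      then have "h ` cone_over c Q = h ` q ` ({0..1} \<times> Q)" using img by simp
      also have "\<dots> = q' ` ({0..1} \<times> Q)" unfolding image_image
        by (rule image_cong) (use h(2) Q in auto)
      finally show ?thesis using img False by simp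
    qed
  qed
qed

text \<open>The rays from the apex become the radii of the ball, the cone parameter becoming the
  radius.\<close>

lemma cone_sphere_disc:
  fixes c :: "'v \<Rightarrow> real"
  assumes S: "sphere_like k S" and c: "coneable c S"
  shows "disc k (cone_over c S) S"
proof (cases "k = 0")
  case True
  then have "S = {}" using S by (auto simp: sphere_like_def homeo_def SS_0)
  moreover have "homeo {c} (DD k) (\<lambda>_ _. 0)" using True by (simp add: homeo_def DD_0)
  ultimately show ?thesis using True by (auto simp: disc_def SS_0)
next
  case False
  obtain f where f: "f ` S = SS k" "continuous_on S f" "inj_on f S" "compact S"
    using S by (auto simp: homeo_def sphere_like_def)
  have "DD k \<noteq> {}" by (auto simp: DD_def RR_def nrm_def L2_set_def intro!: exI[of _ "\<lambda>_. 0"])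
  then have "SS k \<noteq> {}" using polar[of k] False by auto
  then obtain y where y: "y \<in> S" using f by auto
  define q where "q x = cp c (fst x) (snd x)" for x
  define q' where "q' x = (\<lambda>i. fst x * f (snd x) i)" for x :: "real \<times> ('v \<Rightarrow> real)"
  have "c \<in> q ` ({0..1} \<times> S)" using y by (auto intro!: image_eqI[of _ _ "(0,y)"] simp: q_def)
  then have q: "q ` ({0..1} \<times> S) = cone_over c S" unfolding cone_over_def q_def split_def by auto
  have "q' ` ({0..1} \<times> S) = (\<lambda>(r,u) i. r * u i) ` ({0..1} \<times> f ` S)"
    unfolding q'_def by force
  then have q': "q' ` ({0..1} \<times> S) = DD k" using polar f False by simp
  obtain h where h: "homeo (q ` ({0..1} \<times> S)) (q' ` ({0..1} \<times> S)) h"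
      "\<And>x. x \<in> {0..1} \<times> S \<Longrightarrow> h (q x) = q' x"
  proof (rule quotient_homeo[of "{0..1} \<times> S" q q'])
    show "compact ({0..1::real} \<times> S)" using f by (intro compact_Times) simp_all
    show "continuous_on ({0..1} \<times> S) q" unfolding q_def by (rule continuous_on_cp)
    have c2: "continuous_on ({0..1::real} \<times> S) (\<lambda>x. f (snd x))"
      by (rule continuous_on_compose2[OF f(2)]) (auto intro!: continuous_intros)
    have c3: "continuous_on ({0..1::real} \<times> S) (\<lambda>x. f (snd x) i)" for i
      by (rule continuous_on_product_then_coordinatewise[OF c2])
    show "continuous_on ({0..1} \<times> S) q'" unfolding q'_def
      by (intro continuous_on_coordinatewise_then_product continuous_on_mult c3 continuous_on_fst continuous_on_id)
    fix x y :: "real \<times> ('v \<Rightarrow> real)" assume xy: "x \<in> {0..1} \<times> S" "y \<in> {0..1} \<times> S"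
    have "f (snd x) \<in> SS k" "f (snd y) \<in> SS k" "f (snd x) = f (snd y) \<longleftrightarrow> snd x = snd y"
      using xy f by (auto simp: inj_on_def)
    then show "q x = q y \<longleftrightarrow> q' x = q' y"
      using xy cp_eq_iff[OF c(1), of "fst x" "fst y" "snd x" "snd y"]
        polar_inj[of "f (snd x)" k "f (snd y)" "fst x" "fst y"]
      unfolding q_def q'_def by auto
  qed blast
  have "h x = f x" if "x \<in> S" for x using h(2)[of "(1,x)"] that by (simp add: q_def q'_def)
  then have "h ` S = SS k" using f by auto
  then show ?thesis using h(1) q q' subset_cone unfolding disc_def by metis
qed

section \<open>Model cones and suspensions\<close>

definition pole :: "nat \<Rightarrow> real \<Rightarrow> nat \<Rightarrow> real"
  where "pole k \<sigma> = (\<lambda>i. if i = k then \<sigma> else 0)"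

lemma coneable_pole: "\<sigma> = 1 \<or> \<sigma> = -1 \<Longrightarrow> coneable (pole k \<sigma>) (RR k)"
  unfolding coneable_def by (rule exI[of _ "\<lambda>x. \<sigma> * x k"]) (auto simp: cp_def pole_def RR_def)

lemma nrm_cong: "(\<And>i. i < k \<Longrightarrow> x i = y i) \<Longrightarrow> nrm k x = nrm k y"
  unfolding nrm_def by (rule L2_set_cong) auto

text \<open>On the ray to a point \<open>y\<close> of the base, at parameter \<open>s\<close>, the
  norm of the first \<open>k\<close> coordinates is \<open>s * nrm k y\<close> and the height is
  \<open>1 - s\<close> in absolute value. So the cones over the ball are the two halves of the unit
  ball of the norm \<open>nrm k x + \<bar>x k\<bar>\<close>.\<close>

lemma cone_pole:
  assumes s: "\<sigma> = 1 \<or> \<sigma> = (-1::real)"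
  shows "cone_over (pole k \<sigma>) (DD k) = {x \<in> RR (Suc k). nrm k x + \<bar>x k\<bar> \<le> 1 \<and> \<sigma> * x k \<ge> 0}" (is "?A = ?B")
    "cone_over (pole k \<sigma>) (SS k) = {x \<in> RR (Suc k). nrm k x + \<bar>x k\<bar> = 1 \<and> \<sigma> * x k \<ge> 0}" (is "?C = ?D")
proof -
  have val: "nrm k (cp (pole k \<sigma>) s y) = s * nrm k y" "cp (pole k \<sigma>) s y k = (1 - s) * \<sigma>"
    "cp (pole k \<sigma>) s y \<in> RR (Suc k)" if "s \<ge> 0" "y \<in> RR k" for s y
  proof -
    have "nrm k (cp (pole k \<sigma>) s y) = nrm k (\<lambda>i. s * y i)"
      by (rule nrm_cong) (auto simp: cp_def pole_def)
    then show "nrm k (cp (pole k \<sigma>) s y) = s * nrm k y" using that by (simp add: nrm_scale)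
    show "cp (pole k \<sigma>) s y k = (1 - s) * \<sigma>" "cp (pole k \<sigma>) s y \<in> RR (Suc k)"
      using that by (auto simp: cp_def pole_def RR_def)
  qed
  have val0: "pole k \<sigma> \<in> RR (Suc k)" "nrm k (pole k \<sigma>) = 0" "pole k \<sigma> k = \<sigma>"
    by (auto simp: pole_def RR_def nrm_def L2_set_def)
  have inv: "x = pole k \<sigma> \<or> (\<exists>s y. 0 \<le> s \<and> s \<le> 1 \<and> y \<in> RR k \<and> nrm k y = nrm k x / (1 - \<bar>x k\<bar>) \<and> x = cp (pole k \<sigma>) s y \<and> \<bar>x k\<bar> < 1)"
    if x: "x \<in> ?B" for x
  proof (cases "\<bar>x k\<bar> = 1")
    case True
    then have "nrm k x = 0" using x nrm_nonneg[of k x] by auto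
    then have "x i = 0" if "i < k" for i using abs_le_nrm[OF that, of x] by simp
    moreover have "x k = \<sigma>" using True s x by (auto simp: abs_if split: if_splits)
    moreover have "x i = 0" if "i > k" for i using x that by (auto simp: RR_def)
    ultimately have "x = pole k \<sigma>" by (auto simp: pole_def fun_eq_iff) (metis linorder_neqE_nat)
    then show ?thesis by simp
  next
    case False
    then have lt: "\<bar>x k\<bar> < 1" using x nrm_nonneg[of k x] by auto
    define s where "s = 1 - \<bar>x k\<bar>"
    define y where "y i = (if i < k then (1/s) * x i else 0)" for i
    have "nrm k y = nrm k (\<lambda>i. (1/s) * x i)" by (rule nrm_cong) (simp add: y_def)
    also have "\<dots> = (1/s) * nrm k x" by (rule nrm_scale) (use lt in \<open>simp add: s_def\<close>)
    finally have "nrm k y = nrm k x / (1 - \<bar>x k\<bar>)" by (simp add: s_def)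
    moreover have "y \<in> RR k" by (auto simp: y_def RR_def)
    moreover have "x = cp (pole k \<sigma>) s y"
    proof
      fix i
      consider "i < k" | "i = k" | "i > k" by linarith
      then show "x i = cp (pole k \<sigma>) s y i"
        using lt x s by cases (auto simp: cp_def pole_def y_def s_def RR_def abs_if split: if_splits)
    qed
    moreover have "0 \<le> s" "s \<le> 1" using lt by (simp_all add: s_def)
    ultimately show ?thesis using lt by blast
  qed
  have bound: "\<bar>(1 - r) * \<sigma>\<bar> = 1 - r \<and> 0 \<le> \<sigma> * ((1 - r) * \<sigma>)" if "r \<le> 1" for r :: real
    using s that by auto
  show "?A = ?B"
  proof (intro equalityI subsetI)
    fix x assume "x \<in> ?A"
    then consider "x = pole k \<sigma>" | r y where "0 \<le> r" "r \<le> 1" "y \<in> DD k" "x = cp (pole k \<sigma>) r y"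
      by (auto simp: cone_iff)
    then show "x \<in> ?B"
    proof cases
      case 1 then show ?thesis using val0 s by auto
    next
      case 2
      have "r * nrm k y \<le> r" using 2 by (simp add: DD_def mult_left_le)
      then show ?thesis using 2 val[of r y] bound[of r] by (auto simp: DD_def)
    qed
  next
    fix x assume x: "x \<in> ?B"
    have n: "nrm k x / (1 - \<bar>x k\<bar>) \<le> 1" if "\<bar>x k\<bar> < 1" using x that by simp
    show "x \<in> ?A" using inv[OF x]
    proof (elim disjE exE conjE)
      fix r y assume "0 \<le> r" "r \<le> 1" "y \<in> RR k" "nrm k y = nrm k x / (1 - \<bar>x k\<bar>)"
        "x = cp (pole k \<sigma>) r y" "\<bar>x k\<bar> < 1"
      moreover from this n have "y \<in> DD k" by (simp add: DD_def)
      ultimately show "x \<in> ?A" unfolding cone_iff by blast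
    qed (simp add: cone_iff)
  qed
  show "?C = ?D"
  proof (intro equalityI subsetI)
    fix x assume "x \<in> ?C"
    then consider "x = pole k \<sigma>" | r y where "0 \<le> r" "r \<le> 1" "y \<in> SS k" "x = cp (pole k \<sigma>) r y"
      by (auto simp: cone_iff)
    then show "x \<in> ?D"
    proof cases
      case 1 then show ?thesis using val0 s by auto
    next
      case 2
      then show ?thesis using val[of r y] bound[of r] by (auto simp: SS_def)
    qed
  next
    fix x assume x: "x \<in> ?D"
    have n: "nrm k x / (1 - \<bar>x k\<bar>) = 1" if "\<bar>x k\<bar> < 1" using x that by simp
    have "x \<in> ?B" using x by auto
    from inv[OF this] show "x \<in> ?C"
    proof (elim disjE exE conjE)
      fix r y assume "0 \<le> r" "r \<le> 1" "y \<in> RR k" "nrm k y = nrm k x / (1 - \<bar>x k\<bar>)"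
        "x = cp (pole k \<sigma>) r y" "\<bar>x k\<bar> < 1"
      moreover from this n have "y \<in> SS k" by (simp add: SS_def)
      ultimately show "x \<in> ?C" unfolding cone_iff by blast
    qed (simp add: cone_iff)
  qed
qed

lemma nrm_Suc_zero: "x \<in> RR (Suc k) \<Longrightarrow> nrm k x = 0 \<Longrightarrow> x k = 0 \<Longrightarrow> x = (\<lambda>_. 0)"
proof -
  assume x: "x \<in> RR (Suc k)" "nrm k x = 0" "x k = 0"
  have "x \<in> RR k" using x by (auto simp: RR_def) (metis Suc_leI le_neq_implies_less)
  then show ?thesis using x nrm_eq_0 by blast
qed

lemma SS_Suc_nonzero: "x \<in> SS (Suc k) \<Longrightarrow> nrm k x \<noteq> 0 \<or> x k \<noteq> 0"
  using nrm_Suc_zero[of x k] by (auto simp: SS_def nrm_def L2_set_def)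

lemma model_susp_disc:
  "disc (Suc k) (cone_over (pole k 1) (DD k) \<union> cone_over (pole k (-1)) (DD k))
     (cone_over (pole k 1) (SS k) \<union> cone_over (pole k (-1)) (SS k))"
proof -
  have "disc (Suc k) {x \<in> RR (Suc k). nrm k x + \<bar>x k\<bar> \<le> 1} {x \<in> RR (Suc k). nrm k x + \<bar>x k\<bar> = 1}"
  proof (rule gauge_disc)
    show "continuous_on (SS (Suc k)) (\<lambda>x. nrm k x + \<bar>x k\<bar>)"
      by (intro continuous_on_add continuous_on_nrm continuous_on_rabs continuous_on_coord continuous_on_id)
    show "nrm k (\<lambda>i. r * x i) + \<bar>r * x k\<bar> = r * (nrm k x + \<bar>x k\<bar>)" if "0 \<le> r" for r :: real and x
      using that by (simp add: nrm_scale abs_mult distrib_left)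
    show "0 < nrm k x + \<bar>x k\<bar>" if "x \<in> SS (Suc k)" for x
      using SS_Suc_nonzero[OF that] nrm_nonneg[of k x] by auto
  qed (simp add: nrm_def L2_set_def)
  moreover have "cone_over (pole k 1) (DD k) \<union> cone_over (pole k (-1)) (DD k) = {x \<in> RR (Suc k). nrm k x + \<bar>x k\<bar> \<le> 1}"
    by (subst (1 2) cone_pole) auto
  moreover have "cone_over (pole k 1) (SS k) \<union> cone_over (pole k (-1)) (SS k) = {x \<in> RR (Suc k). nrm k x + \<bar>x k\<bar> = 1}"
    by (subst (1 2) cone_pole) auto
  ultimately show ?thesis by simp
qed

lemma model_cone_disc:
  "disc (Suc k) (cone_over (pole k 1) (DD k)) (DD k \<union> cone_over (pole k 1) (SS k))"
proof -
  \<comment> \<open>The origin lies on the boundary of the cone, so the gauge describes the cone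
    moved down by \<open>1/3\<close>, and \<open>T\<close> moves it back up. After the shift the two
    faces are \<open>x k \<ge> -1/3\<close> and \<open>nrm k x + x k \<le> 2/3\<close>, which scale
    to the two terms of the maximum.\<close>
  define g where "g x = max (-3 * x k) ((3/2) * (nrm k x + x k))" for x
  define T where "T x = (\<lambda>i. x i + pole k (1/3) i)" for x
  have T: "nrm k (T x) = nrm k x" "T x k = x k + 1/3" "T x \<in> RR (Suc k) \<longleftrightarrow> x \<in> RR (Suc k)" for x
    by (auto intro!: nrm_cong simp: T_def pole_def RR_def)
  have D: "disc (Suc k) {x \<in> RR (Suc k). g x \<le> 1} {x \<in> RR (Suc k). g x = 1}"
  proof (rule gauge_disc)
    show "continuous_on (SS (Suc k)) g" unfolding g_def
      by (intro continuous_on_max continuous_on_mult continuous_on_const continuous_on_add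
          continuous_on_nrm continuous_on_coord continuous_on_id)
    show "g (\<lambda>i. r * x i) = r * g x" if "0 \<le> r" for r :: real and x
      using that by (simp add: g_def nrm_scale max_mult_distrib_left algebra_simps add_divide_distrib)
    show "0 < g x" if "x \<in> SS (Suc k)" for x
      using SS_Suc_nonzero[OF that] nrm_nonneg[of k x] unfolding g_def by (cases "x k < 0") auto
  qed (simp add: g_def nrm_def L2_set_def)
  have compact: "compact {x \<in> RR (Suc k). g x \<le> 1}" using D disc_sphere_compact by blast
  have inj: "inj T" by (auto simp: inj_def T_def fun_eq_iff)
  have surj: "T ` {x \<in> RR (Suc k). P x} = {x \<in> RR (Suc k). P (\<lambda>i. x i - pole k (1/3) i)}" for P
  proof (intro equalityI subsetI)
    fix x assume x: "x \<in> {x \<in> RR (Suc k). P (\<lambda>i. x i - pole k (1/3) i)}"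
    then show "x \<in> T ` {x \<in> RR (Suc k). P x}"
      by (intro image_eqI[of _ _ "\<lambda>i. x i - pole k (1/3) i"]) (auto simp: T_def RR_def pole_def)
  qed (auto simp: T_def RR_def pole_def)
  have gT: "g (\<lambda>i. x i - pole k (1/3) i) = max (1 - 3 * x k) ((3/2) * (nrm k x + x k) - 1/2)" for x
  proof -
    have "nrm k (\<lambda>i. x i - pole k (1/3) i) = nrm k x" by (rule nrm_cong) (simp add: pole_def)
    then show ?thesis unfolding g_def by (simp add: pole_def algebra_simps)
  qed
  have le: "max (1 - 3 * a) ((3/2) * (b + a) - 1/2) \<le> 1 \<longleftrightarrow> 0 \<le> a \<and> b + \<bar>a\<bar> \<le> 1" for a b :: real
    by (auto simp: field_simps)
  have eq: "max (1 - 3 * a) ((3/2) * (b + a) - 1/2) = 1 \<longleftrightarrow> 0 \<le> a \<and> b + \<bar>a\<bar> \<le> 1 \<and> (a = 0 \<or> b + \<bar>a\<bar> = 1)" for a b :: real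
    by (auto simp: max_def field_simps)
  have "homeo {x \<in> RR (Suc k). g x \<le> 1} (T ` {x \<in> RR (Suc k). g x \<le> 1}) T"
    unfolding homeo_def using compact inj
    by (auto simp: T_def inj_on_def inj_def intro!: continuous_on_coordinatewise_then_product
        continuous_on_add continuous_on_coord continuous_on_const)
  then have "disc (Suc k) (T ` {x \<in> RR (Suc k). g x \<le> 1}) (T ` {x \<in> RR (Suc k). g x = 1})"
    using disc_homeo[OF D] by blast
  moreover have "T ` {x \<in> RR (Suc k). g x \<le> 1} = cone_over (pole k 1) (DD k)"
    unfolding surj gT le by (subst cone_pole) auto
  moreover have "T ` {x \<in> RR (Suc k). g x = 1} = DD k \<union> cone_over (pole k 1) (SS k)"
  proof -
    have R: "x \<in> RR k \<longleftrightarrow> x \<in> RR (Suc k) \<and> x k = 0" for x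
      unfolding RR_def mem_Collect_eq by (metis Suc_leD Suc_leI le_neq_implies_less order_refl)
    have D: "DD k = {x \<in> RR (Suc k). nrm k x + \<bar>x k\<bar> \<le> 1 \<and> x k = 0}"
      unfolding DD_def R by force
    have S: "cone_over (pole k 1) (SS k) = {x \<in> RR (Suc k). nrm k x + \<bar>x k\<bar> = 1 \<and> 1 * x k \<ge> 0}"
      by (rule cone_pole) simp
    show ?thesis
      unfolding surj gT eq unfolding D S by auto
  qed
  ultimately show ?thesis by simp
qed

lemma DD_SS_RR: "DD k \<subseteq> RR k" "SS k \<subseteq> RR k" "SS k \<subseteq> DD k"
  by (auto simp: DD_def SS_def)

lemma cone_disc:
  assumes D: "disc k P E" and c: "coneable c P"
  shows "disc (Suc k) (cone_over c P) (P \<union> cone_over c E)"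
proof -
  obtain f where f: "homeo P (DD k) f" "f ` E = SS k" "E \<subseteq> P" using D by (auto simp: disc_def)
  then have g: "homeo (DD k) P (inv_into P f)" using homeo_inv by blast
  have gE: "inv_into P f ` SS k = E"
    using f inv_into_image_cancel[of f P E] by (auto simp: homeo_def)
  obtain h where h: "homeo (cone_over (pole k 1) (DD k)) (cone_over c P) h"
    "\<And>x. x \<in> DD k \<Longrightarrow> h x = inv_into P f x" "\<And>Q. Q \<subseteq> DD k \<Longrightarrow> h ` cone_over (pole k 1) Q = cone_over c (inv_into P f ` Q)"
    using cone_map[OF g coneable_subset[OF coneable_pole DD_SS_RR(1)] c, of 1] by auto
  have "h ` DD k = P" using h(2) g by (auto simp: homeo_def)
  then have "h ` (DD k \<union> cone_over (pole k 1) (SS k)) = P \<union> cone_over c E"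
    using h(3)[of "SS k"] gE DD_SS_RR by (simp add: image_Un)
  then show ?thesis using disc_homeo[OF model_cone_disc h(1)] by simp
qed

lemma pole_Int: "cone_over (pole k 1) (DD k) \<inter> cone_over (pole k (-1)) (DD k) \<subseteq> DD k"
proof
  fix x assume "x \<in> cone_over (pole k 1) (DD k) \<inter> cone_over (pole k (-1)) (DD k)"
  then have "x \<in> RR (Suc k)" "nrm k x \<le> 1" "x k = 0" by (auto simp: cone_pole)
  then show "x \<in> DD k" by (auto simp: DD_def RR_def) (metis Suc_leI le_neq_implies_less)
qed

text \<open>The two cone maps agree on the common base and glue because the cones have nothing else
  in common. Taking \<open>M\<close> to be the ball gives suspensions of discs, taking it to be the
  sphere gives suspensions of spheres.\<close>

lemma susp_map:
  assumes f: "homeo K M f" "M \<subseteq> DD k" and c: "coneable c1 K" "coneable c2 K" and Int: "cone_over c1 K \<inter> cone_over c2 K = K"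
  obtains h where "homeo (cone_over c1 K \<union> cone_over c2 K) (cone_over (pole k 1) M \<union> cone_over (pole k (-1)) M) h"
    "\<And>Q. Q \<subseteq> K \<Longrightarrow> h ` (cone_over c1 Q \<union> cone_over c2 Q) = cone_over (pole k 1) (f ` Q) \<union> cone_over (pole k (-1)) (f ` Q)"
proof -
  have M: "M \<subseteq> RR k" using f DD_SS_RR by blast
  have p: "coneable (pole k 1) M" "coneable (pole k (-1)) M"
    using coneable_subset[OF coneable_pole M] by auto
  obtain h1 where h1: "homeo (cone_over c1 K) (cone_over (pole k 1) M) h1"
    "\<And>x. x \<in> K \<Longrightarrow> h1 x = f x" "\<And>Q. Q \<subseteq> K \<Longrightarrow> h1 ` cone_over c1 Q = cone_over (pole k 1) (f ` Q)"
    using cone_map[OF f(1) c(1) p(1)] by metis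
  obtain h2 where h2: "homeo (cone_over c2 K) (cone_over (pole k (-1)) M) h2"
    "\<And>x. x \<in> K \<Longrightarrow> h2 x = f x" "\<And>Q. Q \<subseteq> K \<Longrightarrow> h2 ` cone_over c2 Q = cone_over (pole k (-1)) (f ` Q)"
    using cone_map[OF f(1) c(2) p(2)] by metis
  have "cone_over (pole k 1) M \<inter> cone_over (pole k (-1)) M \<subseteq> M"
  proof
    fix x assume x: "x \<in> cone_over (pole k 1) M \<inter> cone_over (pole k (-1)) M"
    then have "x \<in> DD k" using pole_Int cone_mono[OF f(2)] by blast
    moreover have "cone_over (pole k 1) M \<inter> DD k = M \<inter> DD k"
      using cone_Int_base[OF coneable_pole[of 1 k] M DD_SS_RR(1)] by auto
    ultimately show "x \<in> M" using x by auto
  qed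
  also have "M = h1 ` (cone_over c1 K \<inter> cone_over c2 K)" using h1(2) Int f by (auto simp: homeo_def)
  finally obtain h where h: "homeo (cone_over c1 K \<union> cone_over c2 K) (cone_over (pole k 1) M \<union> cone_over (pole k (-1)) M) h"
      "\<And>x. x \<in> cone_over c1 K \<Longrightarrow> h x = h1 x" "\<And>x. x \<in> cone_over c2 K \<Longrightarrow> h x = h2 x"
    using homeo_glue[OF h1(1) h2(1)] h1(2) h2(2) Int by metis
  show thesis
  proof (rule that[OF h(1)])
    fix Q assume Q: "Q \<subseteq> K"
    have "h ` cone_over c1 Q = h1 ` cone_over c1 Q" "h ` cone_over c2 Q = h2 ` cone_over c2 Q"
      using h(2,3) cone_mono[OF Q] by (auto intro!: image_cong)
    then show "h ` (cone_over c1 Q \<union> cone_over c2 Q) = cone_over (pole k 1) (f ` Q) \<union> cone_over (pole k (-1)) (f ` Q)"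
      using h1(3) h2(3) Q by (simp add: image_Un)
  qed
qed

lemma susp_disc:
  assumes D: "disc k K E" and c: "coneable c1 K" "coneable c2 K" and Int: "cone_over c1 K \<inter> cone_over c2 K = K"
  shows "disc (Suc k) (cone_over c1 K \<union> cone_over c2 K) (cone_over c1 E \<union> cone_over c2 E)"
proof -
  obtain f where f: "homeo K (DD k) f" "f ` E = SS k" "E \<subseteq> K" using D by (auto simp: disc_def)
  obtain h where h: "homeo (cone_over c1 K \<union> cone_over c2 K) (cone_over (pole k 1) (DD k) \<union> cone_over (pole k (-1)) (DD k)) h"
    "\<And>Q. Q \<subseteq> K \<Longrightarrow> h ` (cone_over c1 Q \<union> cone_over c2 Q) = cone_over (pole k 1) (f ` Q) \<union> cone_over (pole k (-1)) (f ` Q)"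
    using susp_map[OF f(1) subset_refl c Int] by metis
  have "inv_into (cone_over c1 K \<union> cone_over c2 K) h ` (cone_over (pole k 1) (SS k) \<union> cone_over (pole k (-1)) (SS k)) = cone_over c1 E \<union> cone_over c2 E"
    using h(2)[OF f(3)] f(2) inv_into_image_cancel[of h "cone_over c1 K \<union> cone_over c2 K" "cone_over c1 E \<union> cone_over c2 E"]
      h(1) cone_mono[OF f(3)] unfolding homeo_def by (metis Un_mono)
  then show ?thesis using disc_homeo[OF model_susp_disc homeo_inv[OF h(1)]] by blast
qed

lemma susp_sphere:
  assumes S: "sphere_like k S" and c: "coneable c1 S" "coneable c2 S" and Int: "cone_over c1 S \<inter> cone_over c2 S = S"
  shows "sphere_like (Suc k) (cone_over c1 S \<union> cone_over c2 S)"
proof -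
  obtain f where f: "homeo S (SS k) f" using S by (auto simp: sphere_like_def)
  obtain h where h: "homeo (cone_over c1 S \<union> cone_over c2 S) (cone_over (pole k 1) (SS k) \<union> cone_over (pole k (-1)) (SS k)) h"
    using susp_map[OF f DD_SS_RR(3) c Int] by metis
  then show ?thesis
    using sphere_like_homeo[OF disc_boundary_sphere[OF model_susp_disc] homeo_inv[OF h]] by blast
qed

section \<open>Gluing two cones over hemispheres\<close>

definition hemispheres :: "nat \<Rightarrow> 'x::t2_space set \<Rightarrow> 'x set \<Rightarrow> bool"
  where "hemispheres e P P' \<longleftrightarrow> disc e P (P \<inter> P') \<and> disc e P' (P \<inter> P')"

lemma hemispheres_sym: "hemispheres e P P' \<Longrightarrow> hemispheres e P' P"
  by (simp add: hemispheres_def Int_commute)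

text \<open>The disc \<open>C\<close> has boundary \<open>P \<union> E\<close>, which can be straightened to \<open>S\<close> without moving \<open>P\<close>.\<close>

definition cap :: "nat \<Rightarrow> 'x::t2_space set \<Rightarrow> 'x set \<Rightarrow> 'x set \<Rightarrow> 'x set \<Rightarrow> bool"
  where "cap k S C P E \<longleftrightarrow> disc k C (P \<union> E) \<and> (\<exists>j. homeo (P \<union> E) S j \<and> (\<forall>x\<in>P. j x = x))"

lemma cap_full:
  assumes "sphere_like k S" "coneable c S" shows "cap k S (cone_over c S) S {}"
proof -
  have "compact S" using assms(1) homeo_compact by (auto simp: sphere_like_def)
  then show ?thesis
    using cone_sphere_disc[OF assms] homeo_id[of S] by (auto simp: cap_def)
qed

text \<open>The cone over \<open>P \<inter> P'\<close> and the set \<open>P'\<close> are two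
  \<open>e\<close>-discs with the same boundary \<open>P \<inter> P'\<close>. Alexander's trick maps
  one onto the other and fixes this boundary; the identity on \<open>P\<close> completes it to a map
  onto \<open>S\<close>.\<close>

lemma cap_hemisphere:
  assumes h: "hemispheres e P P'" and S: "P \<union> P' = S" and c: "coneable c S"
  shows "cap (Suc e) S (cone_over c P) P (cone_over c (P \<inter> P'))"
proof -
  let ?E = "P \<inter> P'"
  have d: "disc e P ?E" "disc e P' ?E" using h by (auto simp: hemispheres_def)
  have cP: "coneable c P" "coneable c ?E" using coneable_subset[OF c] S by auto
  have sE: "sphere_like e ?E" using disc_boundary_sphere[OF d(1)] .
  then have cE: "compact ?E" using homeo_compact by (auto simp: sphere_like_def)
  have D: "disc (Suc e) (cone_over c P) (P \<union> cone_over c ?E)" by (rule cone_disc[OF d(1) cP(1)])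
  obtain g where g: "homeo (cone_over c ?E) P' g" "\<And>x. x \<in> ?E \<Longrightarrow> g x = id x"
    using alexander[OF cone_sphere_disc[OF sE cP(2)] d(2) homeo_id[OF cE]] by metis
  have Int: "P \<inter> cone_over c ?E = ?E" using cone_Int_base[OF cP(1), of ?E P] by auto
  have cPc: "compact P" using disc_sphere_compact(1)[OF d(1)] .
  obtain j where "homeo (P \<union> cone_over c ?E) (P \<union> P') j" "\<And>x. x \<in> P \<Longrightarrow> j x = id x"
    by (rule homeo_glue[OF homeo_id[OF cPc] g(1)]) (use g(2) Int in auto)
  then show ?thesis using D S unfolding cap_def by auto
qed

text \<open>Both boundary spheres are straightened to the same \<open>S\<close> by maps that fix
  \<open>K\<close>. They are thus identified over \<open>S\<close>, and the identification extends
  over the discs. The clause about \<open>N\<close> records what remains of the boundary once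
  \<open>N\<close> is glued away.\<close>

lemma cap_map:
  assumes C: "cap k S C P E" and M: "cap k S M K F" and K: "K \<subseteq> P"
  obtains h where "homeo C M h" "\<And>x. x \<in> K \<Longrightarrow> h x = x"
    "\<And>N. N \<subseteq> K \<Longrightarrow> h ` (P \<union> E - N) = K \<union> F - N"
proof -
  obtain i j where i: "homeo (P \<union> E) S i" "\<forall>x\<in>P. i x = x" and j: "homeo (K \<union> F) S j" "\<forall>x\<in>K. j x = x"
    using C M by (auto simp: cap_def)
  define f where "f = inv_into (K \<union> F) j \<circ> i"
  have f: "homeo (P \<union> E) (K \<union> F) f" unfolding f_def using homeo_comp[OF i(1) homeo_inv[OF j(1)]] .
  have fK: "f x = x" if "x \<in> K" for x
  proof -
    have "i x = j x" using i(2) j(2) that K by auto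
    then show ?thesis unfolding f_def using j(1) that by (simp add: homeo_def inv_into_f_f)
  qed
  have dC: "disc k C (P \<union> E)" and dM: "disc k M (K \<union> F)" using C M by (auto simp: cap_def)
  obtain h where h: "homeo C M h" "\<And>x. x \<in> P \<union> E \<Longrightarrow> h x = f x"
    using alexander[OF dC dM f] by metis
  show thesis
  proof (rule that[OF h(1)])
    show hK: "h x = x" if "x \<in> K" for x using that K h(2) fK by auto
    fix N assume N: "N \<subseteq> K"
    have "P \<union> E \<subseteq> C" using dC by (simp add: disc_def)
    then have "inj_on h (P \<union> E)" using h(1) by (auto simp: homeo_def intro: inj_on_subset)
    then have "h ` (P \<union> E - N) = h ` (P \<union> E) - h ` N"
      by (rule inj_on_image_set_diff) (use N K in auto)
    also have "h ` (P \<union> E) = K \<union> F" using h(2) f by (auto simp: homeo_def)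
    also have "h ` N = N" using hK N by force
    finally show "h ` (P \<union> E - N) = K \<union> F - N" .
  qed
qed

text \<open>
  Both caps are straightened to cones over \<open>P \<inter> Q\<close>, so that their union becomes the suspension of the
  disc \<open>P \<inter> Q\<close>.
\<close>

lemma two_cones_disc:
  assumes sph: "sphere_like (Suc e) S" and c: "coneable c1 S" "coneable c2 S"
    and Int: "cone_over c1 S \<inter> cone_over c2 S = S" and PQ: "P \<union> P' = S" "Q \<union> Q' = S"
    and P: "P' = {} \<and> E1 = {} \<or> hemispheres e P P' \<and> E1 = cone_over c1 (P \<inter> P')"
    and Q: "Q' = {} \<and> E2 = {} \<or> hemispheres e Q Q' \<and> E2 = cone_over c2 (Q \<inter> Q')"
    and K: "hemispheres e (P \<inter> Q) (P' \<union> Q')"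
  shows "disc (Suc e) (cone_over c1 P \<union> cone_over c2 Q) (E1 \<union> E2 \<union> ((P \<union> Q) \<inter> (P' \<union> Q')))"
proof -
  let ?K = "P \<inter> Q" and ?K' = "P' \<union> Q'"
  have KS: "?K \<union> ?K' = S" using PQ by auto
  define F1 F2 where "F1 = cone_over c1 (?K \<inter> ?K')" and "F2 = cone_over c2 (?K \<inter> ?K')"
  have capP: "cap (Suc e) S (cone_over c1 P) P E1"
    using P cap_full[OF sph c(1)] cap_hemisphere[OF _ PQ(1) c(1)] PQ by auto
  have capQ: "cap (Suc e) S (cone_over c2 Q) Q E2"
    using Q cap_full[OF sph c(2)] cap_hemisphere[OF _ PQ(2) c(2)] PQ by auto
  have capK: "cap (Suc e) S (cone_over c1 ?K) ?K F1" "cap (Suc e) S (cone_over c2 ?K) ?K F2"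
    using cap_hemisphere[OF K KS] c by (auto simp: F1_def F2_def)
  have sub: "P \<subseteq> S" "Q \<subseteq> S" "?K \<subseteq> S" using PQ by auto
  have Int': "cone_over c1 P' \<inter> cone_over c2 Q' = P' \<inter> Q'" if "P' \<subseteq> S" "Q' \<subseteq> S" for P' Q'
  proof (intro equalityI subsetI)
    fix x assume x: "x \<in> cone_over c1 P' \<inter> cone_over c2 Q'"
    then have "x \<in> S" using Int cone_mono[OF that(1)] cone_mono[OF that(2)] by blast
    then show "x \<in> P' \<inter> Q'"
      using x cone_Int_base[OF c(1) that(1) subset_refl] cone_Int_base[OF c(2) that(2) subset_refl] by blast
  qed (use subset_cone in blast)
  obtain h1 where h1: "homeo (cone_over c1 P) (cone_over c1 ?K) h1" "\<And>x. x \<in> ?K \<Longrightarrow> h1 x = x"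
    "\<And>N. N \<subseteq> ?K \<Longrightarrow> h1 ` (P \<union> E1 - N) = ?K \<union> F1 - N" using cap_map[OF capP capK(1)] by blast
  obtain h2 where h2: "homeo (cone_over c2 Q) (cone_over c2 ?K) h2" "\<And>x. x \<in> ?K \<Longrightarrow> h2 x = x"
    "\<And>N. N \<subseteq> ?K \<Longrightarrow> h2 ` (Q \<union> E2 - N) = ?K \<union> F2 - N" using cap_map[OF capQ capK(2)] by blast
  have I: "cone_over c1 P \<inter> cone_over c2 Q = ?K" "cone_over c1 ?K \<inter> cone_over c2 ?K = ?K" using Int' sub by auto
  have img: "?K \<subseteq> h1 ` ?K" using h1(2) by force
  obtain h where h: "homeo (cone_over c1 P \<union> cone_over c2 Q) (cone_over c1 ?K \<union> cone_over c2 ?K) h"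
      "\<And>x. x \<in> cone_over c1 P \<Longrightarrow> h x = h1 x" "\<And>x. x \<in> cone_over c2 Q \<Longrightarrow> h x = h2 x"
    using homeo_glue[OF h1(1) h2(1)] h1(2) h2(2) img unfolding I by metis
  \<comment> \<open>The interior of the disc \<open>P \<inter> Q\<close>. After gluing it lies
    inside the union, so it has to leave the boundaries of both pieces.\<close>
  define N where "N = ?K - ?K'"
  have E1: "E1 \<inter> S \<subseteq> ?K'" "E1 \<subseteq> cone_over c1 P"
    using P cone_Int_base[OF c(1), of "P \<inter> P'" S] sub cone_mono[of "P \<inter> P'" P c1] by auto
  have E2: "E2 \<inter> S \<subseteq> ?K'" "E2 \<subseteq> cone_over c2 Q"
    using Q cone_Int_base[OF c(2), of "Q \<inter> Q'" S] sub cone_mono[of "Q \<inter> Q'" Q c2] by auto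
  have B1: "P \<union> E1 - N = E1 \<union> (P \<inter> ?K')" "Q \<union> E2 - N = E2 \<union> (Q \<inter> ?K')"
    using E1 E2 sub PQ unfolding N_def by blast+
  have F: "F1 \<inter> S \<subseteq> ?K'" "?K \<inter> ?K' \<subseteq> F1" "F2 \<inter> S \<subseteq> ?K'" "?K \<inter> ?K' \<subseteq> F2"
    using cone_Int_base[OF c(1), of "?K \<inter> ?K'" S] cone_Int_base[OF c(2), of "?K \<inter> ?K'" S] sub subset_cone
    by (auto simp: F1_def F2_def)
  have B2: "?K \<union> F1 - N = F1" "?K \<union> F2 - N = F2"
    using F sub unfolding N_def by blast+
  have NK: "N \<subseteq> ?K" by (auto simp: N_def)
  have "h ` (E1 \<union> (P \<inter> ?K')) = h1 ` (E1 \<union> (P \<inter> ?K'))" "h ` (E2 \<union> (Q \<inter> ?K')) = h2 ` (E2 \<union> (Q \<inter> ?K'))"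
    using h(2,3) E1 E2 subset_cone[of P c1] subset_cone[of Q c2] by (auto intro!: image_cong)
  then have "h ` (E1 \<union> (P \<inter> ?K')) = F1" "h ` (E2 \<union> (Q \<inter> ?K')) = F2"
    using h1(3)[OF NK] h2(3)[OF NK] B1 B2 by auto
  then have hB: "h ` (E1 \<union> E2 \<union> ((P \<union> Q) \<inter> ?K')) = F1 \<union> F2"
    by (metis Int_Un_distrib2 image_Un sup_assoc sup_left_commute)
  have sE: "E1 \<union> E2 \<union> ((P \<union> Q) \<inter> ?K') \<subseteq> cone_over c1 P \<union> cone_over c2 Q"
    using E1 E2 subset_cone[of P c1] subset_cone[of Q c2] by blast
  have "disc (Suc e) (cone_over c1 ?K \<union> cone_over c2 ?K) (F1 \<union> F2)"
    unfolding F1_def F2_def using K I(2) coneable_subset[OF c(1) sub(3)] coneable_subset[OF c(2) sub(3)]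
    by (intro susp_disc) (auto simp: hemispheres_def)
  moreover have "inv_into (cone_over c1 P \<union> cone_over c2 Q) h ` (F1 \<union> F2) = E1 \<union> E2 \<union> ((P \<union> Q) \<inter> ?K')"
    using inv_into_image_cancel[of h _ "E1 \<union> E2 \<union> ((P \<union> Q) \<inter> ?K')"] h(1) sE hB by (metis homeo_def)
  ultimately show ?thesis using disc_homeo homeo_inv[OF h(1)] by blast
qed

lemma disc_ball:
  assumes "disc d (X :: ('v \<Rightarrow> real) set) E"
  shows "subtopology (powertop_real UNIV) X homeomorphic_space closed_unit_ball d"
proof -
  obtain h where h: "homeo X (DD d) h" using assms by (auto simp: disc_def)
  then obtain g where "homeomorphism X (DD d) h g"
    using homeomorphism_compact[of X h "DD d"] by (auto simp: homeo_def)
  then have "top_of_set X homeomorphic_space top_of_set (DD d)"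
    unfolding homeomorphic_space_def homeomorphic_maps_def homeomorphism_def
    by (intro exI[of _ h] exI[of _ g]) (auto simp: continuous_map_in_subtopology)
  moreover have "top_of_set (DD d) = closed_unit_ball d"
  proof -
    have "DD d = {x. \<forall>i\<ge>d. x i = 0} \<inter> {x. (\<Sum>i<d. (x i)\<^sup>2) \<le> 1}"
      by (auto simp: DD_def RR_def nrm_def L2_set_def)
    then show ?thesis
      by (simp add: closed_unit_ball_def Euclidean_space_def subtopology_subtopology euclidean_product_topology)
  qed
  ultimately show ?thesis by (simp add: euclidean_product_topology)
qed

section \<open>Extremal sets of transversals\<close>

definition fiber :: "('a \<Rightarrow> 'i) \<Rightarrow> 'a set \<Rightarrow> 'i \<Rightarrow> 'a set"
  where "fiber \<pi> B i = {x \<in> B. \<pi> x = i}"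

context
  fixes \<pi> :: "'a \<Rightarrow> 'i" and I :: "'i set"
begin

definition hits :: "'a set \<Rightarrow> bool"
  where "hits B \<longleftrightarrow> (\<forall>i\<in>I. \<exists>x\<in>B. \<pi> x = i)"

definition transversals :: "'a set \<Rightarrow> 'a set set"
  where "transversals B = {a. a \<subseteq> B \<and> (\<forall>i\<in>I. \<exists>!x. x \<in> a \<and> \<pi> x = i)}"

definition box_size :: "'a set \<Rightarrow> 'i \<Rightarrow> nat"
  where "box_size B = (\<lambda>i. card (fiber \<pi> B i))"

text \<open>Only sizes count: several boxes of equal size give one trace. The traces correspond to
  the strongly shattered sets of a set system.\<close>

definition traces :: "'a set \<Rightarrow> 'a set set \<Rightarrow> ('i \<Rightarrow> nat) set"
  where "traces A U = box_size ` {B. B \<subseteq> A \<and> hits B \<and> transversals B \<subseteq> U}"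

lemma tracesI: "B \<subseteq> A \<Longrightarrow> hits B \<Longrightarrow> transversals B \<subseteq> U \<Longrightarrow> box_size B \<in> traces A U"
  unfolding traces_def by blast

lemma tracesE:
  assumes "u \<in> traces A U"
  obtains B where "u = box_size B" "B \<subseteq> A" "hits B" "transversals B \<subseteq> U"
  using assms unfolding traces_def by blast

definition ground :: "'a set \<Rightarrow> bool"
  where "ground A \<longleftrightarrow> finite A \<and> \<pi> ` A \<subseteq> I \<and> hits A"

definition extremal :: "'a set \<Rightarrow> 'a set set \<Rightarrow> bool"
  where "extremal A U \<longleftrightarrow> U \<subseteq> transversals A \<and> card (traces A U) = card U"

lemma hitsE: assumes "hits B" "i \<in> I" obtains x where "x \<in> B" "\<pi> x = i"
  using assms unfolding hits_def by metis

lemma hitsI: "(\<And>i. i \<in> I \<Longrightarrow> \<exists>x. x \<in> B \<and> \<pi> x = i) \<Longrightarrow> hits B"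
  unfolding hits_def by metis

lemma transversals_mono: "B \<subseteq> C \<Longrightarrow> transversals B \<subseteq> transversals C"
  unfolding transversals_def by blast

lemma transversals_restrict: "a \<in> transversals C \<Longrightarrow> a \<subseteq> B \<Longrightarrow> a \<in> transversals B"
  unfolding transversals_def by blast

lemma finite_transversals: "finite A \<Longrightarrow> finite (transversals A)"
  unfolding transversals_def by (rule finite_subset[of _ "Pow A"]) auto

lemma finite_traces: "finite A \<Longrightarrow> finite (traces A U)"
  unfolding traces_def by (rule finite_imageI, rule finite_subset[of _ "Pow A"]) auto

lemma traces_mono: "U \<subseteq> W \<Longrightarrow> A \<subseteq> B \<Longrightarrow> traces A U \<subseteq> traces B W"
  unfolding traces_def by blast

lemma exists_transversal:
  assumes "hits B" obtains a where "a \<in> transversals B"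
proof -
  from assms obtain f where f: "\<And>i. i \<in> I \<Longrightarrow> f i \<in> B \<and> \<pi> (f i) = i" unfolding hits_def by metis
  have "f ` I \<in> transversals B" unfolding transversals_def using f by (auto intro!: ex1I)
  then show thesis using that by blast
qed

lemma transversals_subset: "a \<in> transversals B \<Longrightarrow> a \<subseteq> B"
  by (simp add: transversals_def)

lemma transversal_ex1: "a \<in> transversals B \<Longrightarrow> i \<in> I \<Longrightarrow> \<exists>!x. x \<in> a \<and> \<pi> x = i"
  by (simp add: transversals_def)

lemma transversal_unique:
  assumes "a \<in> transversals B" "x \<in> a" "y \<in> a" "\<pi> x = \<pi> y" "\<pi> x \<in> I" shows "x = y"
proof -
  have "\<exists>!z. z \<in> a \<and> \<pi> z = \<pi> x" using assms by (simp add: transversals_def)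
  then show ?thesis using assms by metis
qed

lemma transversal_point:
  assumes "a \<in> transversals B" "i \<in> I" obtains x where "x \<in> a" "x \<in> B" "\<pi> x = i"
proof -
  have "\<exists>!z. z \<in> a \<and> \<pi> z = i" using assms by (simp add: transversals_def)
  then show thesis using that assms transversals_subset by blast
qed

lemma transversals_self:
  assumes "a \<in> transversals B" "\<pi> ` B \<subseteq> I" shows "transversals a = {a}"
proof (rule Set.set_eqI, safe)
  fix b assume b: "b \<in> transversals a"
  show "x \<in> a" if "x \<in> b" for x using b that transversals_subset by blast
  show "x \<in> b" if x: "x \<in> a" for x
  proof -
    have i: "\<pi> x \<in> I" using x assms transversals_subset by blast
    obtain y where "y \<in> b" "y \<in> a" "\<pi> y = \<pi> x" using transversal_point[OF b i] by metis
    then show ?thesis using transversal_unique[OF assms(1), of y x] x i by simp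
  qed
next
  show "a \<in> transversals a" using assms(1) by (auto simp: transversals_def)
qed

lemma hits_transversal: "a \<in> transversals B \<Longrightarrow> hits a"
  unfolding transversals_def hits_def by blast

lemma traces_nonempty_iff:
  assumes "\<pi> ` A \<subseteq> I" "U \<subseteq> transversals A" shows "traces A U \<noteq> {} \<longleftrightarrow> U \<noteq> {}"
proof
  assume "traces A U \<noteq> {}"
  then obtain B where "hits B" "transversals B \<subseteq> U" by (auto simp: traces_def)
  then show "U \<noteq> {}" using exists_transversal by blast
next
  assume "U \<noteq> {}"
  then obtain a where a: "a \<in> U" by auto
  then have aA: "a \<in> transversals A" using assms by auto
  have "hits a" "transversals a = {a}" "a \<subseteq> A"
    using hits_transversal[OF aA] transversals_self[OF aA assms(1)] transversals_subset[OF aA] by auto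
  then have "box_size a \<in> traces A U" unfolding traces_def using a by auto
  then show "traces A U \<noteq> {}" by auto
qed

definition ones :: "'i \<Rightarrow> nat"
  where "ones = (\<lambda>i. if i \<in> I then 1 else 0)"

lemma box_size_transversal:
  assumes "a \<in> transversals A" "\<pi> ` A \<subseteq> I" shows "box_size a = ones"
proof
  fix i
  show "box_size a i = ones i"
  proof (cases "i \<in> I")
    case True
    then obtain x where "x \<in> a" "\<pi> x = i" "\<And>y. y \<in> a \<Longrightarrow> \<pi> y = i \<Longrightarrow> y = x"
      using transversal_point[OF assms(1)] transversal_unique[OF assms(1)] by metis
    then have "fiber \<pi> a i = {x}" unfolding fiber_def by blast
    then show ?thesis using True by (simp add: box_size_def ones_def)
  next
    case False
    then have "fiber \<pi> a i = {}" using assms by (auto simp: fiber_def transversals_def)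
    then show ?thesis using False by (simp add: box_size_def ones_def)
  qed
qed

lemma ones_in_traces:
  assumes "\<pi> ` A \<subseteq> I" "U \<subseteq> transversals A" "U \<noteq> {}" shows "ones \<in> traces A U"
proof -
  obtain a where a: "a \<in> U" using assms by auto
  then have aA: "a \<in> transversals A" using assms by auto
  have "transversals a \<subseteq> U" using transversals_self[OF aA assms(1)] a by simp
  then show ?thesis
    using tracesI[OF transversals_subset[OF aA] hits_transversal[OF aA]] box_size_transversal[OF aA assms(1)]
    by metis
qed

lemma traces_shrink:
  assumes u: "u \<in> traces A U" and A: "finite A" and i: "u i \<ge> 2"
  shows "u(i := u i - 1) \<in> traces A U"
proof -
  obtain B where B: "u = box_size B" "B \<subseteq> A" "hits B" "transversals B \<subseteq> U" using u by (auto simp: traces_def)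
  have fin: "finite (fiber \<pi> B i)" using B A by (auto simp: fiber_def intro: finite_subset)
  have c: "card (fiber \<pi> B i) \<ge> 2" using i B by (simp add: box_size_def)
  then have "fiber \<pi> B i \<noteq> {}" by auto
  then obtain x where x: "x \<in> fiber \<pi> B i" by blast
  have "card (fiber \<pi> B i - {x}) \<ge> 1" using c x fin by simp
  then have "fiber \<pi> B i - {x} \<noteq> {}" by (metis card.empty not_one_le_zero)
  then obtain y where y: "y \<in> fiber \<pi> B i - {x}" by blast
  let ?B = "B - {x}"
  have "hits ?B" using B(3) x y unfolding hits_def fiber_def by blast
  moreover have "transversals ?B \<subseteq> U" using B(4) transversals_mono[of ?B B] by auto
  moreover have "box_size ?B = u(i := u i - 1)"
  proof
    fix j
    have "fiber \<pi> ?B j = (if j = i then fiber \<pi> B i - {x} else fiber \<pi> B j)"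
      using x by (auto simp: fiber_def)
    then show "box_size ?B j = (u(i := u i - 1)) j" using x fin B by (simp add: box_size_def)
  qed
  ultimately show ?thesis unfolding traces_def using B(2) by (auto intro!: image_eqI[of _ _ ?B])
qed

lemma traces_outside:
  assumes "u \<in> traces A U" "\<pi> ` A \<subseteq> I" "i \<notin> I" shows "u i = 0"
proof -
  obtain B where B: "u = box_size B" "B \<subseteq> A" using assms by (auto simp: traces_def)
  then have "fiber \<pi> B i = {}" using assms by (auto simp: fiber_def)
  then show ?thesis using B by (simp add: box_size_def)
qed

lemma traces_pos: "u \<in> traces A U \<Longrightarrow> finite A \<Longrightarrow> i \<in> I \<Longrightarrow> u i \<ge> 1"
proof -
  assume u: "u \<in> traces A U" and A: "finite A" and i: "i \<in> I"
  obtain B where B: "u = box_size B" "B \<subseteq> A" "hits B" using u by (auto simp: traces_def)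
  have "finite (fiber \<pi> B i)" "fiber \<pi> B i \<noteq> {}"
    using B A i by (auto simp: fiber_def hits_def intro: finite_subset)
  then show ?thesis using B by (simp add: box_size_def Suc_le_eq card_gt_0_iff)
qed

text \<open>
  The inductions remove an element \<open>v\<close> from a fiber that has another element. The set \<open>U\<close> then leaves
  two sets of transversals of \<open>A - {v}\<close>: \<open>without v U\<close> and \<open>spread v A U\<close>.
\<close>

definition without :: "'a \<Rightarrow> 'a set set \<Rightarrow> 'a set set"
  where "without v U = {a \<in> U. v \<notin> a}"

definition swap_in :: "'a \<Rightarrow> 'a set \<Rightarrow> 'a set"
  where "swap_in v a = insert v {x \<in> a. \<pi> x \<noteq> \<pi> v}"

definition spread :: "'a \<Rightarrow> 'a set \<Rightarrow> 'a set set \<Rightarrow> 'a set set"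
  where "spread v A U = {a \<in> transversals (A - {v}). swap_in v a \<in> U}"

text \<open>The ground set with the fiber of \<open>v\<close> shrunk to \<open>v\<close>; the
  members of \<open>U\<close> through \<open>v\<close> are transversals of it.\<close>

definition pinned :: "'a \<Rightarrow> 'a set \<Rightarrow> 'a set"
  where "pinned v A = insert v {x \<in> A. \<pi> x \<noteq> \<pi> v}"

lemma swap_in_transversal:
  assumes "a \<in> transversals B" "v \<in> C" "{x \<in> a. \<pi> x \<noteq> \<pi> v} \<subseteq> C"
  shows "swap_in v a \<in> transversals C"
proof -
  have "\<exists>!x. x \<in> swap_in v a \<and> \<pi> x = i" if i: "i \<in> I" for i
  proof (cases "i = \<pi> v")
    case True
    then show ?thesis by (auto simp: swap_in_def intro!: ex1I[of _ v])
  next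
    case False
    have "\<exists>!x. x \<in> a \<and> \<pi> x = i" using assms(1) i unfolding transversals_def by blast
    then show ?thesis using False by (auto simp: swap_in_def)
  qed
  moreover have "swap_in v a \<subseteq> C" using assms(2,3) by (auto simp: swap_in_def)
  ultimately show ?thesis by (simp add: transversals_def)
qed

lemma swap_in_id: "a \<in> transversals B \<Longrightarrow> v \<in> a \<Longrightarrow> \<pi> v \<in> I \<Longrightarrow> swap_in v a = a"
  unfolding swap_in_def transversals_def by blast

lemma swap_in_swap_in: "\<pi> v = \<pi> w \<Longrightarrow> swap_in v (swap_in w a) = swap_in v a"
  unfolding swap_in_def by auto

section \<open>Removing one element of a fiber: boxes and counts\<close>

context
  fixes A :: "'a set" and v w :: 'a and U :: "'a set set"
  assumes A: "finite A" "\<pi> ` A \<subseteq> I" "hits A" and v: "v \<in> A" and w: "w \<in> A" "w \<noteq> v" "\<pi> w = \<pi> v"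
    and U: "U \<subseteq> transversals A"
begin

private abbreviation "P \<equiv> without v U"
private abbreviation "Q \<equiv> spread v A U"
private abbreviation "V \<equiv> {a \<in> U. v \<in> a}"
private abbreviation "A1 \<equiv> A - {v}"
private abbreviation "A2 \<equiv> pinned v A"
private abbreviation "F \<equiv> (\<lambda>u. u(\<pi> v := Suc (u (\<pi> v)))) ` traces A1 (P \<inter> Q) \<union> traces A2 V"

lemma vI: "\<pi> v \<in> I" using A v by auto

lemma ground_without: "finite A1" "\<pi> ` A1 \<subseteq> I" "hits A1" 
  and ground_pinned: "finite A2" "\<pi> ` A2 \<subseteq> I" "hits A2" "A2 \<subseteq> A" "card A2 < card A" "card A1 < card A"
proof -
  show "finite A1" "\<pi> ` A1 \<subseteq> I" "finite A2" "\<pi> ` A2 \<subseteq> I" "A2 \<subseteq> A" using A v by (auto simp: pinned_def)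
  show "hits A1" using A v w unfolding hits_def by (metis DiffI singletonD)
  show "hits A2" unfolding hits_def
  proof
    fix i assume "i \<in> I"
    then show "\<exists>x\<in>A2. \<pi> x = i"
      using A(3) unfolding hits_def pinned_def by (cases "i = \<pi> v") auto
  qed
  have "A2 \<subset> A" using v w by (auto simp: pinned_def)
  then show "card A2 < card A" using A(1) by (rule psubset_card_mono[rotated])
  show "card A1 < card A" using A(1) v by (rule card_Diff1_less)
qed

lemma P_sub: "P \<subseteq> transversals A1" and Q_sub: "Q \<subseteq> transversals A1" and V_sub: "V \<subseteq> transversals A2"
proof -
  show "P \<subseteq> transversals A1" using U unfolding without_def transversals_def by blast
  show "Q \<subseteq> transversals A1" by (auto simp: spread_def)
  show "V \<subseteq> transversals A2"
  proof
    fix a assume a: "a \<in> V"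
    then have "a \<in> transversals A" "v \<in> a" using U by auto
    then have "a \<subseteq> A2" using vI unfolding transversals_def pinned_def by blast
    then show "a \<in> transversals A2" using \<open>a \<in> transversals A\<close> transversals_restrict by blast
  qed
qed

lemma card_split: "card U = card P + card V"
proof -
  have "U = P \<union> V" "P \<inter> V = {}" by (auto simp: without_def)
  moreover have "finite U" using U A finite_transversals finite_subset by blast
  ultimately show ?thesis by (metis card_Un_disjoint finite_Un)
qed

text \<open>A box with all transversals in \<open>U\<close> either misses \<open>v\<close>, or
  contains \<open>v\<close> next to another point of its fiber, or contains \<open>v\<close> alone
  in that fiber. In the second case dropping \<open>v\<close> leaves a box for
  \<open>P \<inter> Q\<close> that is smaller by one in this fiber, hence the \<open>Suc\<close>;
  the third case is a pinned box.\<close>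

lemma traces_split: "traces A U \<subseteq> traces A1 P \<union> F"
proof
  fix u assume "u \<in> traces A U"
  then obtain B where B: "u = box_size B" "B \<subseteq> A" "hits B" "transversals B \<subseteq> U" by (auto simp: traces_def)
  show "u \<in> traces A1 P \<union> F"
  proof (cases "v \<in> B")
    case False
    then have "B \<subseteq> A1" "transversals B \<subseteq> P" using B transversals_subset[of _ B] unfolding without_def by blast+
    then show ?thesis using B unfolding traces_def by blast
  next
    case vB: True
    show ?thesis
    proof (cases "\<exists>x\<in>B. x \<noteq> v \<and> \<pi> x = \<pi> v")
      case True
      let ?B = "B - {v}"
      have "hits ?B" using B(3) True unfolding hits_def by (metis DiffI singletonD)
      moreover have "transversals ?B \<subseteq> P \<inter> Q"
      proof
        fix a assume a: "a \<in> transversals ?B"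
        have "{x \<in> a. \<pi> x \<noteq> \<pi> v} \<subseteq> B" using transversals_subset[OF a] by auto
        then have "swap_in v a \<in> U" using swap_in_transversal[OF a vB] B(4) by auto
        moreover have "a \<in> transversals A1" using transversals_mono[of ?B A1] a B(2) by auto
        moreover have "a \<in> U" "v \<notin> a"
          using a B(4) transversals_mono[of ?B B] transversals_subset[OF a] by auto
        then have "a \<in> P" by (simp add: without_def)
        ultimately show "a \<in> P \<inter> Q" by (auto simp: spread_def)
      qed
      ultimately have "box_size ?B \<in> traces A1 (P \<inter> Q)" unfolding traces_def using B(2) by blast
      moreover have "u = (box_size ?B)(\<pi> v := Suc (box_size ?B (\<pi> v)))"
      proof
        fix i
        have "finite B" using B(2) A(1) finite_subset by blast
        then have "finite (fiber \<pi> B (\<pi> v))" by (simp add: fiber_def)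
        moreover have "fiber \<pi> ?B i = (if i = \<pi> v then fiber \<pi> B (\<pi> v) - {v} else fiber \<pi> B i)"
          by (auto simp: fiber_def)
        moreover have "v \<in> fiber \<pi> B (\<pi> v)" using vB by (simp add: fiber_def)
        ultimately show "u i = ((box_size ?B)(\<pi> v := Suc (box_size ?B (\<pi> v)))) i"
          using B(1) card.remove[of "fiber \<pi> B (\<pi> v)" v] by (cases "i = \<pi> v") (simp_all add: box_size_def)
      qed
      ultimately show ?thesis by blast
    next
      case False
      then have "B \<subseteq> A2" using B by (auto simp: pinned_def)
      moreover have "transversals B \<subseteq> V"
      proof
        fix a assume a: "a \<in> transversals B"
        obtain x where "x \<in> a" "x \<in> B" "\<pi> x = \<pi> v" using transversal_point[OF a vI] by metis
        then have "v \<in> a" using False by metis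
        then show "a \<in> V" using a B by auto
      qed
      ultimately show ?thesis using B unfolding traces_def by blast
    qed
  qed
qed

text \<open>A transversal through \<open>v\<close> is recovered from any transversal that differs
  from it only in the fiber of \<open>v\<close>. So shrinking the box to \<open>v\<close> in this
  fiber keeps all its transversals in \<open>U\<close>.\<close>

lemma traces_spread_pin:
  assumes u: "u \<in> traces A1 Q" shows "u(\<pi> v := 1) \<in> traces A2 V"
proof -
  obtain B where B: "u = box_size B" "B \<subseteq> A1" "hits B" "transversals B \<subseteq> Q" using u by (auto simp: traces_def)
  let ?B = "insert v {x \<in> B. \<pi> x \<noteq> \<pi> v}"
  obtain y where y: "y \<in> B" "\<pi> y = \<pi> v" using B(3) vI unfolding hits_def by metis
  have "?B \<subseteq> A2" using B by (auto simp: pinned_def)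
  moreover have "hits ?B"
  proof (rule hitsI)
    fix i assume "i \<in> I"
    then obtain x where "x \<in> B" "\<pi> x = i" using B(3) hitsE by metis
    then show "\<exists>x. x \<in> ?B \<and> \<pi> x = i" by (cases "i = \<pi> v") auto
  qed
  moreover have "transversals ?B \<subseteq> V"
  proof
    fix a assume a: "a \<in> transversals ?B"
    obtain x where "x \<in> a" "x \<in> ?B" "\<pi> x = \<pi> v" using transversal_point[OF a vI] by metis
    then have va: "v \<in> a" by auto
    have "swap_in y a \<in> transversals B"
      by (rule swap_in_transversal[OF a y(1)]) (use transversals_subset[OF a] y in auto)
    then have "swap_in v (swap_in y a) \<in> U" using B(4) by (auto simp: spread_def)
    then have "swap_in v a \<in> U" using swap_in_swap_in y by simp
    then show "a \<in> V" using swap_in_id[OF a va vI] va by simp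
  qed
  moreover have "box_size ?B = u(\<pi> v := 1)"
  proof
    fix i
    have "fiber \<pi> ?B i = (if i = \<pi> v then {v} else fiber \<pi> B i)" by (auto simp: fiber_def)
    then show "box_size ?B i = (u(\<pi> v := 1)) i" using B(1) by (simp add: box_size_def)
  qed
  ultimately show ?thesis unfolding traces_def by (auto intro!: image_eqI[of _ _ ?B])
qed

text \<open>Membership in \<open>spread v A U\<close> does not depend on the point in the fiber of
  \<open>v\<close>, so \<open>v\<close> may be replaced by any nonempty part \<open>K\<close> of the
  rest of its fiber.\<close>

lemma traces_spread_vary:
  assumes u: "u \<in> traces A2 V" and k: "1 \<le> k" "k \<le> card (fiber \<pi> A1 (\<pi> v))"
  shows "u(\<pi> v := k) \<in> traces A1 Q"
proof -
  obtain B where B: "u = box_size B" "B \<subseteq> A2" "hits B" "transversals B \<subseteq> V" using u by (auto simp: traces_def)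
  obtain K where K: "K \<subseteq> fiber \<pi> A1 (\<pi> v)" "card K = k" "finite K"
    using obtain_subset_with_card_n[OF k(2)] by metis
  then obtain y where y: "y \<in> K" using k by fastforce
  have vB: "v \<in> B" using B vI unfolding hits_def pinned_def by blast
  let ?B = "K \<union> {x \<in> B. \<pi> x \<noteq> \<pi> v}"
  have "?B \<subseteq> A1" using K B(2) by (auto simp: fiber_def pinned_def)
  moreover have "hits ?B"
  proof (rule hitsI)
    fix i assume "i \<in> I"
    show "\<exists>x. x \<in> ?B \<and> \<pi> x = i"
    proof (cases "i = \<pi> v")
      case True then show ?thesis using y K(1) by (auto simp: fiber_def)
    next
      case False
      obtain x where "x \<in> B" "\<pi> x = i" using B(3) \<open>i \<in> I\<close> hitsE by metis
      then show ?thesis using False by auto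
    qed
  qed
  moreover have "transversals ?B \<subseteq> Q"
  proof
    fix a assume a: "a \<in> transversals ?B"
    have "swap_in v a \<in> transversals B"
      by (rule swap_in_transversal[OF a vB]) (use transversals_subset[OF a] K in \<open>auto simp: fiber_def\<close>)
    then have "swap_in v a \<in> U" using B(4) by auto
    moreover have "a \<in> transversals A1" using a transversals_mono[OF \<open>?B \<subseteq> A1\<close>] by auto
    ultimately show "a \<in> Q" by (simp add: spread_def)
  qed
  moreover have "box_size ?B = u(\<pi> v := k)"
  proof
    fix i
    have "fiber \<pi> ?B i = (if i = \<pi> v then K else fiber \<pi> B i)" using K(1) by (auto simp: fiber_def)
    then show "box_size ?B i = (u(\<pi> v := k)) i" using B(1) K by (simp add: box_size_def)
  qed
  ultimately show ?thesis unfolding traces_def by (auto intro!: image_eqI[of _ _ ?B])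
qed

lemma traces_pinned_one: "u \<in> traces A2 V \<Longrightarrow> u (\<pi> v) = 1"
proof -
  assume "u \<in> traces A2 V"
  then obtain B where B: "u = box_size B" "B \<subseteq> A2" "hits B" by (auto simp: traces_def)
  then have "fiber \<pi> B (\<pi> v) = {v}" using vI unfolding fiber_def hits_def pinned_def by blast
  then show ?thesis using B by (simp add: box_size_def)
qed

text \<open>A trace that is at least 2 at the fiber of \<open>v\<close> is the successor of a
  smaller one. If it is 1 there, it is the trace of a pinned box, since it is also a trace of
  \<open>Q\<close>.\<close>

lemma traces_R_F: "traces A1 (P \<inter> Q) \<subseteq> F"
proof
  fix u assume u: "u \<in> traces A1 (P \<inter> Q)"
  have fin: "finite A1" using A by simp
  show "u \<in> F"
  proof (cases "u (\<pi> v) \<ge> 2")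
    case True
    have "u(\<pi> v := u (\<pi> v) - 1) \<in> traces A1 (P \<inter> Q)" using traces_shrink[OF u fin True] .
    moreover have "u = (u(\<pi> v := u (\<pi> v) - 1))(\<pi> v := Suc ((u(\<pi> v := u (\<pi> v) - 1)) (\<pi> v)))"
      using True by auto
    ultimately show ?thesis by blast
  next
    case False
    then have "u (\<pi> v) = 1" using traces_pos[OF u fin vI] by simp
    then have e: "u(\<pi> v := 1) = u" by auto
    have "u \<in> traces A1 Q" using u traces_mono[of "P \<inter> Q" Q A1 A1] by auto
    then have "u \<in> traces A2 V" using traces_spread_pin[of u] unfolding e by simp
    then show ?thesis by simp
  qed
qed

text \<open>The size in the fiber of \<open>v\<close> tells the two parts apart: it is at least 2 in
  the first and 1 in the second.\<close>

lemma card_F: "card F = card (traces A1 (P \<inter> Q)) + card (traces A2 V)"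
proof -
  have fin: "finite A1" "finite A2" using ground_without ground_pinned by auto
  have inj: "inj_on (\<lambda>u. u(\<pi> v := Suc (u (\<pi> v)))) X" for X :: "('i \<Rightarrow> nat) set"
  proof (rule inj_onI)
    fix x y :: "'i \<Rightarrow> nat" assume eq: "x(\<pi> v := Suc (x (\<pi> v))) = y(\<pi> v := Suc (y (\<pi> v)))"
    show "x = y"
    proof
      fix i show "x i = y i" using fun_cong[OF eq, of i] by (auto split: if_splits)
    qed
  qed
  have "(\<lambda>u. u(\<pi> v := Suc (u (\<pi> v)))) ` traces A1 (P \<inter> Q) \<inter> traces A2 V = {}"
    using traces_pinned_one traces_pos[OF _ fin(1) vI] by fastforce
  then show ?thesis
    using finite_traces[OF fin(1)] finite_traces[OF fin(2)] by (simp add: card_Un_disjoint card_image[OF inj])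
qed

lemma card_F_diff: "card (F - traces A1 (P \<inter> Q)) = card (traces A2 V)"
  using card_F traces_R_F finite_traces[of A1] ground_without(1) by (simp add: card_Diff_subset)

text \<open>The inclusion, with \<open>card_F_diff\<close>, bounds the number of traces not coming
  from \<open>P\<close> by \<open>card (traces A2 V)\<close>. It is stated as an inclusion so that
  the case of equality can be read off.\<close>

lemma traces_bound:
  "card (traces A U) \<le> card (traces A1 P) + card (F - traces A1 P)"
  "F - traces A1 P \<subseteq> F - traces A1 (P \<inter> Q)"
proof -
  have fin: "finite (traces A1 W)" "finite (traces A2 W)" for W
    using finite_traces ground_without(1) ground_pinned(1) by auto
  have "card (traces A U) \<le> card (traces A1 P \<union> F)"
    using traces_split fin by (intro card_mono) auto
  also have "traces A1 P \<union> F = traces A1 P \<union> (F - traces A1 P)" by blast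
  also have "card \<dots> = card (traces A1 P) + card (F - traces A1 P)"
    using fin by (intro card_Un_disjoint) auto
  finally show "card (traces A U) \<le> card (traces A1 P) + card (F - traces A1 P)" .
  show "F - traces A1 P \<subseteq> F - traces A1 (P \<inter> Q)" using traces_mono[of "P \<inter> Q" P A1 A1] by blast
qed

text \<open>The members of \<open>Q\<close> arise from the members of \<open>U\<close> through
  \<open>v\<close> by moving \<open>v\<close> to any other point of its fiber; the inverse records
  that point and moves it back to \<open>v\<close>.\<close>

lemma card_spread: "card Q = card (fiber \<pi> A1 (\<pi> v)) * card V"
proof -
  let ?B = "fiber \<pi> A1 (\<pi> v)"
  define g where "g a = (THE y. y \<in> a \<and> \<pi> y = \<pi> v)" for a
  have t: "g (swap_in y a) = y" if "\<pi> y = \<pi> v" for y a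
    unfolding g_def using that by (intro the_equality) (auto simp: swap_in_def)
  have vt: "swap_in v a = a" if "a \<in> V" for a
    using that swap_in_id[OF _ _ vI] V_sub by blast
  have q: "g a \<in> a" "\<pi> (g a) = \<pi> v" if "a \<in> Q" for a
    using theI'[OF transversal_ex1[OF _ vI]] that Q_sub unfolding g_def by blast+
  have "bij_betw (\<lambda>(y,a). swap_in y a) (?B \<times> V) Q"
  proof (rule bij_betw_byWitness[where f' = "\<lambda>a. (g a, swap_in v a)"])
    show "\<forall>x\<in>?B \<times> V. (g (case x of (y, a) \<Rightarrow> swap_in y a), swap_in v (case x of (y, a) \<Rightarrow> swap_in y a)) = x"
      using t vt by (auto simp: swap_in_swap_in fiber_def)
    show "\<forall>a\<in>Q. (case (g a, swap_in v a) of (y, a) \<Rightarrow> swap_in y a) = a"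
    proof
      fix a assume a: "a \<in> Q"
      have "swap_in (g a) a = a"
        using q[OF a] a Q_sub vI by (intro swap_in_id) auto
      then show "(case (g a, swap_in v a) of (y, a) \<Rightarrow> swap_in y a) = a"
        using q[OF a] by (simp add: swap_in_swap_in)
    qed
    show "(\<lambda>(y, a). swap_in y a) ` (?B \<times> V) \<subseteq> Q"
    proof clarify
      fix y a assume y: "y \<in> ?B" and a: "a \<in> U" "v \<in> a"
      have aA: "a \<in> transversals A" using a U by auto
      have "swap_in y a \<in> transversals A1"
        by (rule swap_in_transversal[OF aA]) (use y transversals_subset[OF aA] in \<open>auto simp: fiber_def\<close>)
      moreover have "swap_in v (swap_in y a) \<in> U" using y a vt by (simp add: swap_in_swap_in fiber_def)
      ultimately show "swap_in y a \<in> Q" by (simp add: spread_def)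
    qed
    show "(\<lambda>a. (g a, swap_in v a)) ` Q \<subseteq> ?B \<times> V"
    proof (rule image_subsetI)
      fix a assume a: "a \<in> Q"
      then have "a \<subseteq> A1" using Q_sub transversals_subset by blast
      then have "g a \<in> ?B" using q[OF a] by (auto simp: fiber_def)
      moreover have "swap_in v a \<in> V" using a by (auto simp: spread_def swap_in_def)
      ultimately show "(g a, swap_in v a) \<in> ?B \<times> V" by auto
    qed
  qed
  from bij_betw_same_card[OF this] show ?thesis
    using card_cartesian_product[of ?B V] by simp
qed

end

text \<open>The members of \<open>U\<close> split into those that avoid \<open>v\<close> and those
  through \<open>v\<close>. The traces not coming from the former number at most the traces of the
  latter, so the two inductive bounds add up. If all fibers are singletons, \<open>A\<close> is the
  only box.\<close>

lemma card_traces_le: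
  assumes "ground A" "U \<subseteq> transversals A" shows "card (traces A U) \<le> card U"
  using assms
proof (induction "card A" arbitrary: A U rule: less_induct)
  case less
  have A: "finite A" "\<pi> ` A \<subseteq> I" "hits A" using less.prems by (auto simp: ground_def)
  show ?case
  proof (cases "\<exists>v\<in>A. \<exists>w\<in>A. w \<noteq> v \<and> \<pi> w = \<pi> v")
    case True
    then obtain v w where vw: "v \<in> A" "w \<in> A" "w \<noteq> v" "\<pi> w = \<pi> v" by blast
    note ctx = A vw less.prems(2)
    let ?P = "without v U" and ?Q = "spread v A U" and ?V = "{a \<in> U. v \<in> a}"
    let ?A1 = "A - {v}" and ?A2 = "pinned v A"
    have g: "ground ?A1" "ground ?A2"
      using ground_without[OF ctx] ground_pinned[OF ctx] by (auto simp: ground_def)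
    have "card (traces A U) \<le> card (traces ?A1 ?P) + card (traces ?A2 ?V)"
      using traces_bound(1)[OF ctx] card_mono[OF _ traces_bound(2)[OF ctx]] card_F_diff[OF ctx]
        finite_traces[OF ground_without(1)[OF ctx]] finite_traces[OF ground_pinned(1)[OF ctx]] by simp
    also have "\<dots> \<le> card ?P + card ?V"
      using less.hyps[OF _ g(1) P_sub[OF ctx]] less.hyps[OF _ g(2) V_sub[OF ctx]]
        ground_pinned(5,6)[OF ctx] by (simp add: add_mono)
    finally show ?thesis using card_split[OF ctx] by simp
  next
    case False
    have B: "B = A" if BA: "B \<subseteq> A" "hits B" for B
    proof
      show "A \<subseteq> B"
      proof
        fix x assume x: "x \<in> A"
        then have "\<pi> x \<in> I" using A(2) by auto
        then obtain y where "y \<in> B" "\<pi> y = \<pi> x" by (rule hitsE[OF BA(2)])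
        then have "y = x" using False x BA(1) by auto
        then show "x \<in> B" using \<open>y \<in> B\<close> by simp
      qed
    qed (use BA in simp)
    have "traces A U \<subseteq> {box_size A}" using B unfolding traces_def by blast
    then have 1: "card (traces A U) \<le> 1" using card_mono[of "{box_size A}" "traces A U"] by simp
    have finU: "finite U" using less.prems(2) finite_transversals[OF A(1)] finite_subset by blast
    show ?thesis
    proof (cases "traces A U = {}")
      case False
      then have "U \<noteq> {}" using traces_nonempty_iff[OF A(2) less.prems(2)] by simp
      then have "card U \<ge> 1" using finU by (simp add: Suc_le_eq card_gt_0_iff)
      then show ?thesis using 1 by simp
    qed simp
  qed
qed

section \<open>The case of equality\<close>

context
  fixes A :: "'a set" and v w :: 'a and U :: "'a set set"
  assumes g: "ground A" and v: "v \<in> A" and w: "w \<in> A" "w \<noteq> v" "\<pi> w = \<pi> v"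
    and ext: "extremal A U"
begin

private lemma ctx: "finite A" "\<pi> ` A \<subseteq> I" "hits A" "v \<in> A" "w \<in> A" "w \<noteq> v" "\<pi> w = \<pi> v" "U \<subseteq> transversals A"
  using g v w ext by (auto simp: ground_def extremal_def)

private abbreviation "UP \<equiv> without v U"
private abbreviation "UQ \<equiv> spread v A U"
private abbreviation "UV \<equiv> {a \<in> U. v \<in> a}"
private abbreviation "AA \<equiv> A - {v}"
private abbreviation "AV \<equiv> pinned v A"
private abbreviation "FF \<equiv> (\<lambda>u. u(\<pi> v := Suc (u (\<pi> v)))) ` traces AA (UP \<inter> UQ) \<union> traces AV UV"

lemma ground_removed: "ground AA" "ground AV"
  using ground_without[OF ctx] ground_pinned[OF ctx] by (auto simp: ground_def)

private lemma finiteF: "finite (traces AA W)" "finite (traces AV W)" "finite FF"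
  using finite_traces[of AA] finite_traces[of AV] ground_without(1)[OF ctx] ground_pinned(1)[OF ctx] by auto

text \<open>Extremality forces equality at every stage of the estimate. The last identity is the
  essential gain: a member of \<open>FF\<close> that is a trace of \<open>UP\<close> is already a
  trace of \<open>UP \<inter> UQ\<close>.\<close>

private lemma equalities:
  shows "card (traces AA UP) = card UP" "card (traces AV UV) = card UV" "FF - traces AA UP = FF - traces AA (UP \<inter> UQ)"
proof -
  have le: "card (FF - traces AA UP) \<le> card (FF - traces AA (UP \<inter> UQ))"
    using traces_bound(2)[OF ctx] finiteF(3) by (intro card_mono) auto
  have 1: "card (traces AA UP) \<le> card UP" "card (traces AV UV) \<le> card UV"
    using card_traces_le[OF ground_removed(1) P_sub[OF ctx]] card_traces_le[OF ground_removed(2) V_sub[OF ctx]] by auto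
  have "card U = card (traces A U)" using ext by (simp add: extremal_def)
  then have 2: "card UP + card UV \<le> card (traces AA UP) + card (FF - traces AA UP)"
    using traces_bound(1)[OF ctx] card_split[OF ctx] by simp
  show "card (traces AA UP) = card UP" "card (traces AV UV) = card UV"
    using 1 2 le card_F_diff[OF ctx] by auto
  have "card (FF - traces AA UP) = card (FF - traces AA (UP \<inter> UQ))"
    using 1 2 le card_F_diff[OF ctx] by auto
  then show "FF - traces AA UP = FF - traces AA (UP \<inter> UQ)"
    using traces_bound(2)[OF ctx] finiteF(3) by (intro card_subset_eq) auto
qed

lemma extremal_without: "extremal AA UP"
  using equalities P_sub[OF ctx] by (simp add: extremal_def)

text \<open>Descent on the size in the fiber of \<open>v\<close>. At size 1 a common trace is the
  trace of a pinned box; at a larger size its predecessor is a trace of the intersection. Either way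
  it lies in \<open>FF\<close>, and \<open>equalities\<close> applies.\<close>

lemma traces_meet: "traces AA UP \<inter> traces AA UQ = traces AA (UP \<inter> UQ)"
proof
  show "traces AA (UP \<inter> UQ) \<subseteq> traces AA UP \<inter> traces AA UQ"
    using traces_mono[of "UP \<inter> UQ" UP AA AA] traces_mono[of "UP \<inter> UQ" UQ AA AA] by blast
  have FF: "u \<in> traces AA (UP \<inter> UQ)" if "u \<in> FF" "u \<in> traces AA UP" for u
    using equalities(3) that by blast
  have "u \<in> traces AA (UP \<inter> UQ)" if "u (\<pi> v) = Suc n" "u \<in> traces AA UP" "u \<in> traces AA UQ" for u n
    using that
  proof (induction n arbitrary: u)
    case 0
    then have e: "u(\<pi> v := 1) = u" by auto
    have "u \<in> traces AV UV" using traces_spread_pin[OF ctx 0(3)] unfolding e .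
    then show ?case using FF 0 by blast
  next
    case (Suc n)
    let ?u = "u(\<pi> v := u (\<pi> v) - 1)"
    have "?u \<in> traces AA UP" "?u \<in> traces AA UQ"
      using traces_shrink[OF Suc.prems(2) ground_without(1)[OF ctx], of "\<pi> v"]
        traces_shrink[OF Suc.prems(3) ground_without(1)[OF ctx], of "\<pi> v"] Suc.prems(1) by simp_all
    then have "?u \<in> traces AA (UP \<inter> UQ)"
      using Suc.IH[of ?u] Suc.prems(1) by (simp only: fun_upd_same diff_Suc_1)
    moreover have "u = ?u(\<pi> v := Suc (?u (\<pi> v)))" using Suc.prems by auto
    ultimately have "u \<in> FF" by blast
    then show ?case using FF Suc.prems by blast
  qed
  moreover have "u (\<pi> v) \<ge> 1" if "u \<in> traces AA UP" for u
    using traces_pos[OF that ground_without(1)[OF ctx] vI[OF ctx]] .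
  ultimately show "traces AA UP \<inter> traces AA UQ \<subseteq> traces AA (UP \<inter> UQ)"
    by (metis IntD1 IntD2 Suc_le_D One_nat_def subsetI)
qed

text \<open>Traces of pinned boxes may be given any size from 1 to \<open>?k\<close> in the fiber of
  \<open>v\<close>. This multiplies their number by the same factor by which \<open>UQ\<close> is
  larger than \<open>UV\<close>.\<close>

private lemma card_traces_spread: "card UQ \<le> card (traces AA UQ)"
proof -
  let ?k = "card (fiber \<pi> AA (\<pi> v))"
  have "inj_on (\<lambda>(k,u). u(\<pi> v := k)) ({1..?k} \<times> traces AV UV)"
  proof (rule inj_onI, clarify)
    fix k u k' u' assume u: "u \<in> traces AV UV" "u' \<in> traces AV UV" and eq: "u(\<pi> v := k) = u'(\<pi> v := k')"
    have "k = k'" using fun_cong[OF eq, of "\<pi> v"] by simp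
    moreover have "u i = u' i" for i
      using fun_cong[OF eq, of i] traces_pinned_one[OF ctx u(1)] traces_pinned_one[OF ctx u(2)]
      by (cases "i = \<pi> v") auto
    ultimately show "k = k' \<and> u = u'" by auto
  qed
  moreover have "(\<lambda>(k,u). u(\<pi> v := k)) ` ({1..?k} \<times> traces AV UV) \<subseteq> traces AA UQ"
    using traces_spread_vary[OF ctx] by auto
  ultimately have "card ({1..?k} \<times> traces AV UV) \<le> card (traces AA UQ)"
    using finiteF(1) by (meson card_inj_on_le)
  then show ?thesis
    using equalities(2) card_spread[OF ctx] card_cartesian_product[of "{1..?k}" "traces AV UV"] by simp
qed

lemma extremal_spread: "extremal AA UQ"
  using card_traces_spread card_traces_le[OF ground_removed(1) Q_sub[OF ctx]] Q_sub[OF ctx]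
  by (simp add: extremal_def)

private lemma finitePQ: "finite UP" "finite UQ"
  using P_sub[OF ctx] Q_sub[OF ctx] finite_transversals[OF ground_without(1)[OF ctx]] finite_subset by blast+

text \<open>By \<open>traces_meet\<close>, inclusion-exclusion turns the equalities for
  \<open>UP\<close> and \<open>UQ\<close> into an equality for the sum over union and intersection.
  Each summand is bounded separately, so both bounds are attained.\<close>

lemma extremal_Int: "extremal AA (UP \<inter> UQ)"
  and extremal_Un: "extremal AA (UP \<union> UQ)"
  and traces_join: "traces AA (UP \<union> UQ) = traces AA UP \<union> traces AA UQ"
proof -
  have sub: "UP \<inter> UQ \<subseteq> transversals AA" "UP \<union> UQ \<subseteq> transversals AA"
    using P_sub[OF ctx] Q_sub[OF ctx] by auto
  have le: "card (traces AA (UP \<inter> UQ)) \<le> card (UP \<inter> UQ)" "card (traces AA (UP \<union> UQ)) \<le> card (UP \<union> UQ)"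
    using card_traces_le[OF ground_removed(1)] sub by auto
  have m: "traces AA UP \<union> traces AA UQ \<subseteq> traces AA (UP \<union> UQ)"
    using traces_mono[of UP "UP \<union> UQ" AA AA] traces_mono[of UQ "UP \<union> UQ" AA AA] by blast
  then have m': "card (traces AA UP \<union> traces AA UQ) \<le> card (traces AA (UP \<union> UQ))"
    using finiteF by (intro card_mono) auto
  have "card (traces AA UP \<union> traces AA UQ) + card (traces AA (UP \<inter> UQ)) = card UP + card UQ"
    using card_Un_Int[of "traces AA UP" "traces AA UQ"] finiteF traces_meet extremal_without extremal_spread
    by (simp add: extremal_def)
  also have "\<dots> = card (UP \<union> UQ) + card (UP \<inter> UQ)" using card_Un_Int[OF finitePQ] .
  finally have e: "card (traces AA UP \<union> traces AA UQ) + card (traces AA (UP \<inter> UQ)) = card (UP \<union> UQ) + card (UP \<inter> UQ)" .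
  show "extremal AA (UP \<inter> UQ)" "extremal AA (UP \<union> UQ)"
    using e le m' sub by (auto simp: extremal_def)
  have "card (traces AA UP \<union> traces AA UQ) = card (traces AA (UP \<union> UQ))" using e le m' by auto
  then show "traces AA (UP \<union> UQ) = traces AA UP \<union> traces AA UQ"
    using card_subset_eq[OF finiteF(1) m] by simp
qed

text \<open>All single transversals have the same trace \<open>ones\<close>, which is therefore
  common to both sets and hence a trace of the intersection.\<close>

lemma without_spread_nonempty: "UP \<noteq> {} \<Longrightarrow> UQ \<noteq> {} \<Longrightarrow> UP \<inter> UQ \<noteq> {}"
proof -
  assume "UP \<noteq> {}" "UQ \<noteq> {}"
  moreover have AA: "\<pi> ` AA \<subseteq> I" using ground_without[OF ctx] by simp
  ultimately have "ones \<in> traces AA UP \<inter> traces AA UQ"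
    using ones_in_traces[OF AA] P_sub[OF ctx] Q_sub[OF ctx] by blast
  then have "traces AA (UP \<inter> UQ) \<noteq> {}" using traces_meet by auto
  then show ?thesis using traces_nonempty_iff[OF AA, of "UP \<inter> UQ"] P_sub[OF ctx] by blast
qed

text \<open>Dually, \<open>A - {v}\<close> is the only box of its size, so whichever set has this
  size as a trace contains all transversals.\<close>

lemma without_spread_cover:
  assumes "transversals AA \<subseteq> UP \<union> UQ" shows "transversals AA \<subseteq> UP \<or> transversals AA \<subseteq> UQ"
proof -
  have AA: "finite AA" "\<pi> ` AA \<subseteq> I" "hits AA" using ground_without[OF ctx] by auto
  have "box_size AA \<in> traces AA (UP \<union> UQ)" using tracesI[of AA AA "UP \<union> UQ"] assms AA by blast
  then have "box_size AA \<in> traces AA UP \<or> box_size AA \<in> traces AA UQ" using traces_join by blast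
  moreover have "transversals AA \<subseteq> W" if W: "box_size AA \<in> traces AA W" for W
  proof -
    obtain B where B: "box_size AA = box_size B" "B \<subseteq> AA" "transversals B \<subseteq> W" using W by (rule tracesE)
    have "AA \<subseteq> B"
    proof
      fix x assume x: "x \<in> AA"
      have "fiber \<pi> B (\<pi> x) \<subseteq> fiber \<pi> AA (\<pi> x)" using B(2) by (auto simp: fiber_def)
      moreover have "card (fiber \<pi> B (\<pi> x)) = card (fiber \<pi> AA (\<pi> x))"
        using fun_cong[OF B(1), of "\<pi> x"] by (simp add: box_size_def)
      moreover have "finite (fiber \<pi> AA (\<pi> x))" using AA by (simp add: fiber_def)
      ultimately have "fiber \<pi> B (\<pi> x) = fiber \<pi> AA (\<pi> x)" by (metis card_subset_eq)
      then show "x \<in> B" using x by (auto simp: fiber_def)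
    qed
    then show ?thesis using B by (metis subset_antisym)
  qed
  ultimately show ?thesis by blast
qed

end

text \<open>The elements outside \<open>B\<close> are removed one at a time by
  \<open>extremal_without\<close>. As \<open>B\<close> meets every fiber, the element removed is
  never alone in its fiber.\<close>

lemma extremal_restrict:
  assumes "ground A" "extremal A U" "B \<subseteq> A" "hits B"
  shows "extremal B (U \<inter> transversals B)"
  using assms
proof (induction "card (A - B)" arbitrary: A U)
  case 0
  then have "finite A" by (simp add: ground_def)
  then have "A = B" using 0 by auto
  then show ?case using 0 by (simp add: extremal_def Int_absorb2)
next
  case (Suc n)
  then obtain v where v: "v \<in> A" "v \<notin> B" by (metis Diff_iff card.empty ex_in_conv nat.distinct(1))
  have A: "finite A" "\<pi> ` A \<subseteq> I" using Suc.prems by (auto simp: ground_def)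
  then have "\<pi> v \<in> I" using v by auto
  then obtain w where w: "w \<in> B" "\<pi> w = \<pi> v" by (rule hitsE[OF Suc.prems(4)])
  have ctx: "ground A" "v \<in> A" "w \<in> A" "w \<noteq> v" "\<pi> w = \<pi> v" "extremal A U" using Suc.prems v w by auto
  have "n = card (A - {v} - B)"
  proof -
    have "A - {v} - B = (A - B) - {v}" by auto
    then show ?thesis using Suc(2) v A by simp
  qed
  then have "extremal B (without v U \<inter> transversals B)"
    using Suc.hyps(1)[OF _ ground_removed(1)[OF ctx] extremal_without[OF ctx]] Suc.prems v by auto
  moreover have "without v U \<inter> transversals B = U \<inter> transversals B"
    using v transversals_subset by (auto simp: without_def)
  ultimately show ?case by simp
qed

text \<open>These are \<open>without_spread_nonempty\<close> and \<open>without_spread_cover\<close>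
  for the ground set \<open>insert v C\<close>, to which extremality restricts. In the geometry,
  \<open>C\<close> is the zero set of a point.\<close>

lemma box_meets:
  assumes "ground A" "v \<in> A" "w \<in> A" "w \<noteq> v" "\<pi> w = \<pi> v" "extremal A U"
    and C: "C \<subseteq> A - {v}" "hits C"
  shows "transversals C \<inter> without v U \<noteq> {} \<Longrightarrow> transversals C \<inter> spread v A U \<noteq> {} \<Longrightarrow>
      transversals C \<inter> (without v U \<inter> spread v A U) \<noteq> {}"
    and "transversals C \<subseteq> without v U \<union> spread v A U \<Longrightarrow>
      transversals C \<subseteq> without v U \<or> transversals C \<subseteq> spread v A U"
proof -
  let ?A = "insert v C" and ?U = "U \<inter> transversals (insert v C)"
  have A: "finite A" "\<pi> ` A \<subseteq> I" using assms(1) by (auto simp: ground_def)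
  have h: "hits ?A" using C(2) unfolding hits_def by blast
  have sub: "?A \<subseteq> A" "v \<notin> C" using C assms(2) by auto
  have "\<pi> v \<in> I" using A assms(2) by auto
  then obtain y where y: "y \<in> C" "\<pi> y = \<pi> v" by (rule hitsE[OF C(2)])
  have ctx: "ground ?A" "v \<in> ?A" "y \<in> ?A" "y \<noteq> v" "\<pi> y = \<pi> v" "extremal ?A ?U"
    using A sub h y extremal_restrict[OF assms(1,6) sub(1) h] by (auto simp: ground_def intro: finite_subset)
  have D: "?A - {v} = C" using sub by auto
  have P: "without v ?U = transversals C \<inter> without v U"
  proof (rule Set.set_eqI)
    fix a
    have "a \<in> transversals ?A \<and> v \<notin> a \<longleftrightarrow> a \<in> transversals C"
      using sub(2) unfolding transversals_def by auto
    then show "a \<in> without v ?U \<longleftrightarrow> a \<in> transversals C \<inter> without v U"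
      by (auto simp: without_def)
  qed
  have Q: "spread v ?A ?U = transversals C \<inter> spread v A U"
  proof (rule Set.set_eqI)
    fix a
    have "swap_in v a \<in> transversals ?A" if a: "a \<in> transversals C"
      by (rule swap_in_transversal[OF a]) (use transversals_subset[OF a] in auto)
    moreover have "a \<in> transversals (A - {v})" if "a \<in> transversals C" using that transversals_mono[OF C(1)] by auto
    ultimately show "a \<in> spread v ?A ?U \<longleftrightarrow> a \<in> transversals C \<inter> spread v A U"
      unfolding spread_def D by blast
  qed
  show "transversals C \<inter> (without v U \<inter> spread v A U) \<noteq> {}"
    if "transversals C \<inter> without v U \<noteq> {}" "transversals C \<inter> spread v A U \<noteq> {}"
    using without_spread_nonempty[OF ctx] that unfolding P Q by blast
  show "transversals C \<subseteq> without v U \<or> transversals C \<subseteq> spread v A U"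
    if "transversals C \<subseteq> without v U \<union> spread v A U"
    using without_spread_cover[OF ctx] that unfolding D P Q by blast
qed

end

section \<open>Realizations of sets of transversals\<close>

text \<open>
  The points of the geometric realization of the complex whose facets are the complements of the
  transversals in \<open>W\<close>.
\<close>

definition body :: "'a set \<Rightarrow> 'a set set \<Rightarrow> ('a \<Rightarrow> real) set"
  where "body A W = {t. (\<forall>x. 0 \<le> t x) \<and> (\<forall>x. x \<notin> A \<longrightarrow> t x = 0) \<and> sum t A = 1 \<and> (\<exists>a\<in>W. \<forall>x\<in>a. t x = 0)}"

text \<open>Emptiness is decided by \<open>W\<close>, not by \<open>Y\<close>: if the transversals
  in \<open>W\<close> have empty complements, the body is empty although \<open>W\<close> is not,
  and the cone is the apex alone.\<close>

definition apex_join :: "'a set set \<Rightarrow> ('a \<Rightarrow> real) \<Rightarrow> ('a \<Rightarrow> real) set \<Rightarrow> ('a \<Rightarrow> real) set"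
  where "apex_join W c Y = (if W = {} then {} else cone_over c Y)"

lemma body_Un: "body A (U \<union> W) = body A U \<union> body A W"
  unfolding body_def by blast

lemma body_empty [simp]: "body A {} = {}"
  by (simp add: body_def)

lemma body_mono: "U \<subseteq> W \<Longrightarrow> body A U \<subseteq> body A W"
  unfolding body_def by blast

section \<open>The two halves of a suspension\<close>

context
  fixes e1 :: nat and T :: "'a set set" and b :: "'a set set \<Rightarrow> ('a \<Rightarrow> real) set" and P Q :: "'a set set"
  assumes b: "\<And>U W. b (U \<union> W) = b U \<union> b W" "b {} = {}" "sphere_like e1 (b T)"
    and T: "P \<subseteq> T" "Q \<subseteq> T" "T \<noteq> {}"
begin

private definition st where
  "st W \<longleftrightarrow> W = {} \<or> W = T \<or> (\<exists>e. e1 = Suc e \<and> hemispheres e (b W) (b (T - W)))"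

text \<open>If \<open>P\<close> or \<open>Q\<close> is empty, one half is a single cone, and the
  other half contains the full cone from the opposite apex, which meets it in its base. For
  \<open>W \<noteq> T\<close> the rest of the other half adds the cone over the boundary of this
  base.\<close>

lemma half_single:
  assumes c: "coneable c1 (b T)" "coneable c2 (b T)" and Int: "cone_over c1 (b T) \<inter> cone_over c2 (b T) = b T"
    and W: "W \<subseteq> T" "W \<noteq> {}" and Qst: "W = T \<or> (\<exists>e. e1 = Suc e \<and> hemispheres e (b W) (b (T - W)))"
  shows "disc e1 (cone_over c2 (b W)) (cone_over c2 (b W) \<inter> (cone_over c1 (b T) \<union> apex_join (T - W) c2 (b (T - W))))"
proof -
  have sub: "b W \<subseteq> b T" "b (T - W) \<subseteq> b T" using b(1)[of W "T - W"] W by (auto simp: Un_absorb1)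
  have I: "cone_over c2 (b W) \<inter> cone_over c1 (b T) = b W"
  proof (intro equalityI subsetI)
    fix x assume x: "x \<in> cone_over c2 (b W) \<inter> cone_over c1 (b T)"
    then have "x \<in> b T" using Int cone_mono[OF sub(1)] by blast
    then show "x \<in> b W" using x cone_Int_base[OF c(2) sub(1) subset_refl] sub by blast
  next
    fix x assume "x \<in> b W"
    then show "x \<in> cone_over c2 (b W) \<inter> cone_over c1 (b T)" using subset_cone sub by blast
  qed
  show ?thesis
  proof (cases "W = T")
    case True
    then show ?thesis using cone_sphere_disc[OF b(3) c(2)] I by (simp add: apex_join_def)
  next
    case False
    then obtain e where e: "e1 = Suc e" "hemispheres e (b W) (b (T - W))" using Qst by blast
    have "T - W \<noteq> {}" using False W by blast
    then have "cone_over c2 (b W) \<inter> (cone_over c1 (b T) \<union> apex_join (T - W) c2 (b (T - W)))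
        = b W \<union> cone_over c2 (b W \<inter> b (T - W))"
      using I cone_Int_cone[OF c(2) sub] by (simp add: apex_join_def Int_Un_distrib)
    moreover have "disc (Suc e) (cone_over c2 (b W)) (b W \<union> cone_over c2 (b W \<inter> b (T - W)))"
      using e(2) cone_disc coneable_subset[OF c(2) sub(1)] by (auto simp: hemispheres_def)
    ultimately show ?thesis using e by simp
  qed
qed

text \<open>Parts of the two halves with different apexes meet only inside the common sphere, parts
  with the same apex in the cone over the common boundary of their bases. Together this is exactly
  the boundary that \<open>two_cones_disc\<close> provides.\<close>

lemma half_double:
  assumes c: "coneable c1 (b T)" "coneable c2 (b T)" and Int: "cone_over c1 (b T) \<inter> cone_over c2 (b T) = b T"
    and ne: "P \<inter> Q \<noteq> {}" "P \<noteq> T \<or> Q \<noteq> T"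
    and Pst: "P = T \<or> (\<exists>e. e1 = Suc e \<and> hemispheres e (b P) (b (T - P)))"
    and Qst: "Q = T \<or> (\<exists>e. e1 = Suc e \<and> hemispheres e (b Q) (b (T - Q)))"
    and Kst: "P \<inter> Q = T \<or> (\<exists>e. e1 = Suc e \<and> hemispheres e (b (P \<inter> Q)) (b (T - P \<inter> Q)))"
    and K: "b P \<inter> b Q = b (P \<inter> Q)"
  shows "disc e1 (cone_over c1 (b P) \<union> cone_over c2 (b Q))
    ((cone_over c1 (b P) \<union> cone_over c2 (b Q)) \<inter> (apex_join (T - P) c1 (b (T - P)) \<union> apex_join (T - Q) c2 (b (T - Q))))"
proof -
  have un: "b P \<union> b (T - P) = b T" "b Q \<union> b (T - Q) = b T"
    using b(1)[of Q "T - Q"] b(1)[of P "T - P"] T by (auto simp: Un_absorb1)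
  have sub: "b P \<subseteq> b T" "b Q \<subseteq> b T" "b (T - P) \<subseteq> b T" "b (T - Q) \<subseteq> b T" using un by auto
  have I: "cone_over c1 X \<inter> cone_over c2 Y = X \<inter> Y" if "X \<subseteq> b T" "Y \<subseteq> b T" for X Y
  proof (intro equalityI subsetI)
    fix x assume x: "x \<in> cone_over c1 X \<inter> cone_over c2 Y"
    then have "x \<in> b T" using Int cone_mono[OF that(1)] cone_mono[OF that(2)] by blast
    then show "x \<in> X \<inter> Y"
      using x cone_Int_base[OF c(1) that(1) subset_refl] cone_Int_base[OF c(2) that(2) subset_refl] by blast
  next
    fix x assume "x \<in> X \<inter> Y"
    then show "x \<in> cone_over c1 X \<inter> cone_over c2 Y" using subset_cone by blast
  qed
  have "P \<inter> Q \<noteq> T" using ne(2) T by blast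
  then obtain e where e: "e1 = Suc e" "hemispheres e (b (P \<inter> Q)) (b (T - P \<inter> Q))" using Kst by blast
  define E1 where "E1 = (if P = T then {} else cone_over c1 (b P \<inter> b (T - P)))"
  define E2 where "E2 = (if Q = T then {} else cone_over c2 (b Q \<inter> b (T - Q)))"
  have "T - P \<inter> Q = (T - P) \<union> (T - Q)" by blast
  then have hK: "hemispheres e (b P \<inter> b Q) (b (T - P) \<union> b (T - Q))" using e K b(1) by metis
  have hP: "b (T - P) = {} \<and> E1 = {} \<or> hemispheres e (b P) (b (T - P)) \<and> E1 = cone_over c1 (b P \<inter> b (T - P))"
    using Pst e(1) b(2) unfolding E1_def by auto
  have hQ: "b (T - Q) = {} \<and> E2 = {} \<or> hemispheres e (b Q) (b (T - Q)) \<and> E2 = cone_over c2 (b Q \<inter> b (T - Q))"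
    using Qst e(1) b(2) unfolding E2_def by auto
  have D: "disc (Suc e) (cone_over c1 (b P) \<union> cone_over c2 (b Q)) (E1 \<union> E2 \<union> ((b P \<union> b Q) \<inter> (b (T - P) \<union> b (T - Q))))"
    using two_cones_disc[OF b(3)[unfolded e(1)] c Int un hP hQ hK] .
  have bz: "W = {} \<Longrightarrow> b W = {}" for W using b(2) by simp
  have 1: "cone_over c1 (b P) \<inter> apex_join (T - P) c1 (b (T - P)) = E1"
    using T cone_Int_cone[OF c(1) sub(1,3)] unfolding apex_join_def E1_def by auto
  have 2: "cone_over c2 (b Q) \<inter> apex_join (T - Q) c2 (b (T - Q)) = E2"
    using T cone_Int_cone[OF c(2) sub(2,4)] unfolding apex_join_def E2_def by auto
  have 3: "cone_over c1 (b P) \<inter> apex_join (T - Q) c2 (b (T - Q)) = b P \<inter> b (T - Q)"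
    using I[OF sub(1,4)] bz[of "T - Q"] unfolding apex_join_def by auto
  have 4: "cone_over c2 (b Q) \<inter> apex_join (T - P) c1 (b (T - P)) = b Q \<inter> b (T - P)"
    using I[OF sub(3,2)] bz[of "T - P"] unfolding apex_join_def by auto
  have 5: "b P \<inter> b (T - P) \<subseteq> E1" "b Q \<inter> b (T - Q) \<subseteq> E2"
    using bz[of "T - P"] bz[of "T - Q"] subset_cone[of "b P \<inter> b (T - P)" c1]
      subset_cone[of "b Q \<inter> b (T - Q)" c2] unfolding E1_def E2_def by (simp_all add: b(2) split: if_split)
  have "(cone_over c1 (b P) \<union> cone_over c2 (b Q)) \<inter> (apex_join (T - P) c1 (b (T - P)) \<union> apex_join (T - Q) c2 (b (T - Q)))
      = E1 \<union> (b P \<inter> b (T - Q)) \<union> (b Q \<inter> b (T - P)) \<union> E2"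
    unfolding Int_Un_distrib Int_Un_distrib2 1 2 3 4 by blast
  also have "\<dots> = E1 \<union> E2 \<union> ((b P \<union> b Q) \<inter> (b (T - P) \<union> b (T - Q)))" using 5 by blast
  finally show ?thesis using D e(1) by simp
qed

text \<open>The hypotheses can be met by \<open>T - P\<close> and \<open>T - Q\<close> as well, so
  that the complementary half is another instance of the same statement.\<close>

lemma half_disc:
  assumes c: "coneable c1 (b T)" "coneable c2 (b T)" and Int: "cone_over c1 (b T) \<inter> cone_over c2 (b T) = b T"
    and st: "\<And>W. W = P \<or> W = Q \<or> W = P \<inter> Q \<Longrightarrow>
      W = {} \<or> W = T \<or> (\<exists>e. e1 = Suc e \<and> hemispheres e (b W) (b (T - W)))"
    and ne: "P \<noteq> {} \<Longrightarrow> Q \<noteq> {} \<Longrightarrow> P \<inter> Q \<noteq> {}" "P \<noteq> {} \<or> Q \<noteq> {}" "P \<noteq> T \<or> Q \<noteq> T"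
    and K: "b P \<inter> b Q = b (P \<inter> Q)"
  defines "X \<equiv> apex_join P c1 (b P) \<union> apex_join Q c2 (b Q)"
    and "X' \<equiv> apex_join (T - P) c1 (b (T - P)) \<union> apex_join (T - Q) c2 (b (T - Q))"
  shows "disc e1 X (X \<inter> X')"
proof -
  consider "P = {}" "Q \<noteq> {}" | "P \<noteq> {}" "Q = {}" | "P \<noteq> {}" "Q \<noteq> {}" using ne by blast
  then show ?thesis
  proof cases
    case 3
    then show ?thesis
      using half_double[OF c Int ne(1)[OF 3] ne(3) _ _ _ K] st[of P] st[of Q] st[of "P \<inter> Q"] ne(1)[OF 3]
      unfolding X_def X'_def by (simp add: apex_join_def)
  next
    case 1
    then show ?thesis
      using half_single[OF c Int T(2) 1(2)] st[of Q] T(3) unfolding X_def X'_def by (simp add: apex_join_def)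
  next
    case 2
    have Int': "cone_over c2 (b T) \<inter> cone_over c1 (b T) = b T" using Int by blast
    show ?thesis
      using half_single[OF c(2,1) Int' T(1) 2(1)] st[of P] 2 T(3) unfolding X_def X'_def
      by (simp add: apex_join_def Un_commute)
  qed
qed

end

section \<open>Coordinates for the two apexes\<close>

definition vertex :: "'a \<Rightarrow> 'a \<Rightarrow> real"
  where "vertex v = (\<lambda>x. if x = v then 1 else 0)"

definition barycenter :: "'a set \<Rightarrow> 'a \<Rightarrow> real"
  where "barycenter B = (\<lambda>x. if x \<in> B then 1 / card B else 0)"

lemma coneable_vertex: "v \<notin> A \<Longrightarrow> coneable (vertex v) (body A W)"
  unfolding coneable_def body_def by (rule exI[of _ "\<lambda>x. x v"]) (auto simp: cp_def vertex_def)

text \<open>Every point of the base vanishes somewhere on \<open>B\<close>. Along a ray the minimum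
  over \<open>B\<close> is therefore the share of the barycenter alone, and multiplied by
  \<open>card B\<close> it is the height.\<close>

lemma coneable_barycenter:
  assumes B: "finite B" "B \<noteq> {}" and W: "\<And>a. a \<in> W \<Longrightarrow> a \<inter> B \<noteq> {}"
  shows "coneable (barycenter B) (body A W)"
  unfolding coneable_def
proof (rule exI[of _ "\<lambda>x. real (card B) * Min (x ` B)"], intro ballI)
  fix s :: real and y assume s: "s \<in> {0..1}" and y: "y \<in> body A W"
  obtain z where z: "z \<in> B" "y z = 0" using y W unfolding body_def by blast
  have "Min (cp (barycenter B) s y ` B) = (1 - s) / card B"
  proof (rule Min_eqI)
    show "(1 - s) / card B \<in> cp (barycenter B) s y ` B"
      using z by (intro image_eqI[of _ _ z]) (auto simp: cp_def barycenter_def)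
    fix r assume "r \<in> cp (barycenter B) s y ` B"
    then show "(1 - s) / card B \<le> r" using s y by (auto simp: cp_def barycenter_def body_def)
  qed (use B in simp)
  then show "real (card B) * Min (cp (barycenter B) s y ` B) = 1 - s" using B by simp
qed

context
  fixes \<pi> :: "'a \<Rightarrow> 'i" and I :: "'i set" and A :: "'a set" and v w :: 'a and U :: "'a set set"
  assumes g: "ground \<pi> I A" and v: "v \<in> A" and w: "w \<in> A" "w \<noteq> v" "\<pi> w = \<pi> v"
    and U: "U \<subseteq> transversals \<pi> I A"
begin

private abbreviation "B \<equiv> fiber \<pi> (A - {v}) (\<pi> v)"

private lemma A: "finite A" "\<pi> ` A \<subseteq> I" "\<pi> v \<in> I"
  using g v by (auto simp: ground_def)

private lemma B: "finite B" "B \<noteq> {}" "w \<in> B" "B \<subseteq> A - {v}"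
  using A w by (auto simp: fiber_def)

lemma transversal_meets_fiber: "a \<in> transversals \<pi> I (A - {v}) \<Longrightarrow> a \<inter> B \<noteq> {}"
proof -
  assume a: "a \<in> transversals \<pi> I (A - {v})"
  obtain x where "x \<in> a" "x \<in> A - {v}" "\<pi> x = \<pi> v" using transversal_point[OF a A(3)] .
  then show ?thesis by (auto simp: fiber_def)
qed

lemma coneable_apexes:
  "coneable (vertex v) (body (A - {v}) (transversals \<pi> I (A - {v})))"
  "coneable (barycenter B) (body (A - {v}) (transversals \<pi> I (A - {v})))"
  using coneable_vertex[of v "A - {v}"] coneable_barycenter[OF B(1,2) transversal_meets_fiber] by auto

text \<open>The coordinate at \<open>v\<close> tells the cones apart: it vanishes on the second one
  and is \<open>1 - s\<close> on the first.\<close>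

lemma cones_Int:
  fixes S defines "S \<equiv> body (A - {v}) (transversals \<pi> I (A - {v}))"
  shows "cone_over (vertex v) S \<inter> cone_over (barycenter B) S = S"
proof (intro equalityI subsetI)
  fix x assume x: "x \<in> cone_over (vertex v) S \<inter> cone_over (barycenter B) S"
  have Sv: "y v = 0" if "y \<in> S" for y using that by (auto simp: S_def body_def)
  have "barycenter B v = 0" using B(4) by (auto simp: barycenter_def)
  moreover have "x \<in> cone_over (barycenter B) S" using x by blast
  ultimately have "x v = 0" using Sv by (auto simp: cone_iff cp_def)
  then obtain s y where sy: "0 \<le> s" "s \<le> 1" "y \<in> S" "x = cp (vertex v) s y"
    using x by (auto simp: cone_iff vertex_def)
  then have "s = 1" using \<open>x v = 0\<close> Sv[of y] by (simp add: cp_def vertex_def)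
  then show "x \<in> S" using sy by simp
qed (use subset_cone in blast)

text \<open>
  A point with \<open>t v > 0\<close> lies on a ray from the vertex \<open>v\<close>; a point with \<open>t v = 0\<close> that only
  avoids transversals through \<open>v\<close> lies on a ray from the barycenter of the rest of the fiber.
\<close>

lemma body_split:
  "body A U = apex_join (without v U) (vertex v) (body (A - {v}) (without v U)) \<union>
     apex_join (spread \<pi> I v A U) (barycenter B) (body (A - {v}) (spread \<pi> I v A U))" (is "_ = ?X \<union> ?Y")
proof (intro equalityI subsetI)
  fix t assume t: "t \<in> body A U"
  then obtain a where a: "a \<in> U" "\<forall>x\<in>a. t x = 0" and t0: "\<And>x. 0 \<le> t x" "\<And>x. x \<notin> A \<Longrightarrow> t x = 0" "sum t A = 1"
    by (auto simp: body_def)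
  have aA: "a \<in> transversals \<pi> I A" using a U by auto
  have sum: "sum t A = t v + sum t (A - {v})" using A v by (simp add: sum.remove)
  have tv: "t v \<le> 1"
    using sum t0 sum_nonneg[of "A - {v}" t] by simp
  show "t \<in> ?X \<union> ?Y"
  proof (cases "v \<in> a")
    case False
    then have aP: "a \<in> without v U" using a by (simp add: without_def)
    have "t \<in> cone_over (vertex v) (body (A - {v}) (without v U))"
    proof (cases "t v = 1")
      case True
      then have "sum t (A - {v}) = 0" using sum t0 by simp
      then have "\<forall>x\<in>A - {v}. t x = 0" using A t0 by (subst (asm) sum_nonneg_eq_0_iff) auto
      then have "t = vertex v" using True t0(2) by (auto simp: vertex_def fun_eq_iff)
      then show ?thesis by (simp add: cone_iff)
    next
      case False
      define s where "s = 1 - t v"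
      have s: "0 < s" "s \<le> 1" using False tv t0(1)[of v] by (auto simp: s_def)
      define y where "y x = (if x = v then 0 else t x / s)" for x
      have "t = cp (vertex v) s y" using s by (auto simp: cp_def vertex_def y_def s_def fun_eq_iff)
      moreover have "sum y (A - {v}) = sum t (A - {v}) / s"
        unfolding sum_divide_distrib by (rule sum.cong) (auto simp: y_def)
      then have "sum y (A - {v}) = 1" using sum t0(3) s by (simp add: s_def)
      then have "y \<in> body (A - {v}) (without v U)"
        using aP a t0 s by (auto simp: body_def y_def)
      ultimately show ?thesis using s unfolding cone_iff by (intro disjI2 exI[of _ s] exI[of _ y]) auto
    qed
    then show ?thesis using aP by (auto simp: apex_join_def)
  next
    case True
    then have tv0: "t v = 0" using a by simp
    \<comment> \<open>The largest constant on \<open>B\<close> that can be subtracted from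
      \<open>t\<close>; the mass \<open>c\<close> removed in this way is the weight of the
      barycenter. The remainder vanishes at some \<open>z\<close> in \<open>B\<close>, and moving
      \<open>v\<close> to \<open>z\<close> yields a transversal on which it is zero.\<close>
    define \<mu> where "\<mu> = Min (t ` B)"
    have \<mu>: "\<And>x. x \<in> B \<Longrightarrow> \<mu> \<le> t x" using B by (auto simp: \<mu>_def)
    have "\<mu> \<in> t ` B" unfolding \<mu>_def using B by (intro Min_in) auto
    then obtain z where z: "z \<in> B" "t z = \<mu>" by auto
    have \<mu>0: "0 \<le> \<mu>" using z t0 by metis
    define c where "c = \<mu> * card B"
    have cB: "real (card B) > 0" using B by (simp add: card_gt_0_iff)
    have a': "swap_in \<pi> z a \<in> spread \<pi> I v A U"
    proof -
      have "swap_in \<pi> z a \<in> transversals \<pi> I (A - {v})"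
        by (rule swap_in_transversal[OF aA]) (use z transversals_subset[OF aA] in \<open>auto simp: fiber_def\<close>)
      moreover have "swap_in \<pi> v (swap_in \<pi> z a) = a"
        using swap_in_id[OF aA True A(3)] z by (simp add: swap_in_swap_in fiber_def)
      ultimately show ?thesis using a by (simp add: spread_def)
    qed
    have sumB: "sum (\<lambda>x. t x - (if x \<in> B then \<mu> else 0)) (A - {v}) = 1 - c"
    proof -
      have "sum (\<lambda>x. if x \<in> B then \<mu> else 0) (A - {v}) = sum (\<lambda>x. \<mu>) B"
        using A B by (subst sum.inter_restrict[symmetric]) (auto simp: Int_absorb1)
      then show ?thesis using sum t0(3) tv0 by (simp add: sum_subtractf c_def)
    qed
    have nonneg: "0 \<le> t x - (if x \<in> B then \<mu> else 0)" for x using t0 \<mu> by auto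
    have "0 \<le> 1 - c" unfolding sumB[symmetric] using nonneg by (rule sum_nonneg)
    have "t \<in> cone_over (barycenter B) (body (A - {v}) (spread \<pi> I v A U))"
    proof (cases "c = 1")
      case True
      then have "\<forall>x\<in>A - {v}. t x - (if x \<in> B then \<mu> else 0) = 0"
        using sumB A nonneg
          sum_nonneg_eq_0_iff[of "A - {v}" "\<lambda>x. t x - (if x \<in> B then \<mu> else 0)"] by auto
      moreover have "\<mu> = 1 / card B" using True cB by (simp add: c_def field_simps)
      ultimately have "t x = barycenter B x" for x
        using tv0 t0(2)[of x] B(4) unfolding barycenter_def by (cases "x \<in> A - {v}") auto
      then have "t = barycenter B" by blast
      then show ?thesis by (simp add: cone_iff)
    next
      case False
      define s where "s = 1 - c"
      have s: "0 < s" "s \<le> 1" using False \<open>0 \<le> 1 - c\<close> \<mu>0 cB by (auto simp: s_def c_def)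
      define y where "y x = (t x - (if x \<in> B then \<mu> else 0)) / s" for x
      have "t x = cp (barycenter B) s y x" for x
        using s cB by (auto simp: cp_def barycenter_def y_def s_def c_def)
      then have "t = cp (barycenter B) s y" by blast
      moreover have "sum y (A - {v}) = 1" unfolding y_def sum_divide_distrib[symmetric] sumB
        using s by (simp add: s_def)
      moreover have "\<forall>x\<in>swap_in \<pi> z a. y x = 0"
        using a z by (auto simp: swap_in_def y_def fiber_def)
      moreover have "\<forall>x. 0 \<le> y x" using nonneg s by (simp add: y_def)
      moreover have "y x = 0" if "x \<notin> A - {v}" for x
      proof -
        have "x \<notin> B" "t x = 0" using that B(4) t0(2)[of x] tv0 by blast+
        then show ?thesis by (simp add: y_def)
      qed
      ultimately have "y \<in> body (A - {v}) (spread \<pi> I v A U)"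
        using a' unfolding body_def by blast
      then show ?thesis using s \<open>t = cp (barycenter B) s y\<close> unfolding cone_iff
        by (intro disjI2 exI[of _ s] exI[of _ y]) simp
    qed
    then show ?thesis using a' by (auto simp: apex_join_def)
  qed
next
  fix t assume "t \<in> ?X \<union> ?Y"
  then consider "without v U \<noteq> {}" "t \<in> cone_over (vertex v) (body (A - {v}) (without v U))"
    | "spread \<pi> I v A U \<noteq> {}" "t \<in> cone_over (barycenter B) (body (A - {v}) (spread \<pi> I v A U))"
    by (auto simp: apex_join_def split: if_splits)
  then show "t \<in> body A U"
  proof cases
    case 1
    have V: "vertex v \<in> body A U"
    proof -
      obtain a where "a \<in> U" "v \<notin> a" using 1 by (auto simp: without_def)
      moreover have "sum (vertex v) A = 1" using A v by (simp add: vertex_def)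
      ultimately show ?thesis using v by (auto simp: body_def vertex_def)
    qed
    show ?thesis
    proof (cases "t = vertex v")
      case False
      then obtain s y where sy: "0 \<le> s" "s \<le> 1" "y \<in> body (A - {v}) (without v U)" "t = cp (vertex v) s y"
        using 1 by (auto simp: cone_iff)
      then obtain a where a: "a \<in> U" "v \<notin> a" "\<forall>x\<in>a. y x = 0"
        and y: "\<And>x. 0 \<le> y x" "\<And>x. x \<notin> A - {v} \<Longrightarrow> y x = 0" "sum y (A - {v}) = 1"
        by (auto simp: body_def without_def)
      have "sum y A = 1" using y A v by (simp add: sum.remove)
      then have "sum t A = 1"
        using A v sy by (simp add: cp_def vertex_def sum.distrib sum_distrib_left[symmetric])
      moreover have "\<forall>x\<in>a. t x = 0" using a sy by (auto simp: cp_def vertex_def)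
      ultimately show ?thesis using a sy y v by (auto simp: body_def cp_def vertex_def)
    qed (use V in simp)
  next
    case 2
    have sumb: "sum (barycenter B) A = 1"
    proof -
      have "A \<inter> B = B" using B(4) by blast
      then have "sum (barycenter B) A = sum (\<lambda>x. 1 / card B) B"
        unfolding barycenter_def using A B(4) by (subst sum.inter_restrict[symmetric]) simp_all
      then show ?thesis using B by simp
    qed
    \<comment> \<open>The conditions on \<open>y\<close> carry the factor \<open>s\<close>, so that
      the apex itself is the case \<open>s = 0\<close> with \<open>y = 0\<close>.\<close>
    have key: "cp (barycenter B) s y \<in> body A U"
      if s: "0 \<le> s" "s \<le> 1" and y: "\<And>x. 0 \<le> y x" "\<And>x. x \<notin> A - {v} \<Longrightarrow> y x = 0" "s * sum y (A - {v}) = s"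
        and a: "a \<in> spread \<pi> I v A U" "\<forall>x\<in>a. s * y x = 0" for s y a
    proof -
      have "s * sum y A = s" using y A v by (simp add: sum.remove)
      then have "sum (cp (barycenter B) s y) A = 1"
        using sumb by (simp add: cp_def sum.distrib sum_distrib_left[symmetric])
      moreover have "swap_in \<pi> v a \<in> U" using a by (simp add: spread_def)
      moreover have "\<forall>x\<in>swap_in \<pi> v a. cp (barycenter B) s y x = 0"
      proof
        fix x assume x: "x \<in> swap_in \<pi> v a"
        have "x \<notin> B" using x B(4) by (auto simp: swap_in_def fiber_def)
        moreover have "s * y x = 0" using x a(2) y(2)[of v] by (auto simp: swap_in_def)
        ultimately show "cp (barycenter B) s y x = 0" by (simp add: cp_def barycenter_def)
      qed
      moreover have "\<forall>x. 0 \<le> cp (barycenter B) s y x"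
        using s y(1) by (auto simp: cp_def barycenter_def)
      moreover have "cp (barycenter B) s y x = 0" if "x \<notin> A" for x
      proof -
        have "x \<notin> B" "y x = 0" using that B(4) y(2)[of x] by blast+
        then show ?thesis by (simp add: cp_def barycenter_def)
      qed
      ultimately show ?thesis unfolding body_def by blast
    qed
    show ?thesis
    proof (cases "t = barycenter B")
      case True
      obtain a where "a \<in> spread \<pi> I v A U" using 2 by blast
      then show ?thesis using key[of 0 "\<lambda>_. 0" a] True by simp
    next
      case False
      then obtain s y where sy: "0 \<le> s" "s \<le> 1" "y \<in> body (A - {v}) (spread \<pi> I v A U)" "t = cp (barycenter B) s y"
        using 2 by (auto simp: cone_iff)
      then show ?thesis using key[of s y] by (auto simp: body_def)
    qed
  qed
qed

end

text \<open>The zero set of a point in both bodies contains a transversal from \<open>P\<close> and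
  one from \<open>Q\<close>, so \<open>meets\<close> applies to it; a transversal from
  \<open>P \<inter> Q\<close> inside it puts the point into the body of the intersection.\<close>

lemma body_Int:
  assumes W: "P \<subseteq> transversals \<pi> I A" "Q \<subseteq> transversals \<pi> I A"
    and meets: "\<And>C. C \<subseteq> A \<Longrightarrow> hits \<pi> I C \<Longrightarrow> transversals \<pi> I C \<inter> P \<noteq> {} \<Longrightarrow> transversals \<pi> I C \<inter> Q \<noteq> {} \<Longrightarrow>
        transversals \<pi> I C \<inter> (P \<inter> Q) \<noteq> {}"
  shows "body A P \<inter> body A Q = body A (P \<inter> Q)"
proof
  show "body A P \<inter> body A Q \<subseteq> body A (P \<inter> Q)"
  proof
    fix t assume t: "t \<in> body A P \<inter> body A Q"
    then obtain a a' where a: "a \<in> P" "\<forall>x\<in>a. t x = 0" "a' \<in> Q" "\<forall>x\<in>a'. t x = 0"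
      by (auto simp: body_def)
    let ?C = "{x \<in> A. t x = 0}"
    have ta: "a \<in> transversals \<pi> I A" "a' \<in> transversals \<pi> I A" using a W by auto
    then have "a \<subseteq> ?C" "a' \<subseteq> ?C" using a transversals_subset[OF ta(1)] transversals_subset[OF ta(2)] by auto
    then have tC: "a \<in> transversals \<pi> I ?C" "a' \<in> transversals \<pi> I ?C" using ta transversals_restrict by metis+
    have "hits \<pi> I ?C"
    proof (rule hitsI)
      fix i assume i: "i \<in> I"
      obtain x where "x \<in> a" "x \<in> ?C" "\<pi> x = i" using transversal_point[OF tC(1) i] .
      then show "\<exists>x. x \<in> ?C \<and> \<pi> x = i" by blast
    qed
    moreover have "transversals \<pi> I ?C \<inter> P \<noteq> {}" "transversals \<pi> I ?C \<inter> Q \<noteq> {}" using tC a by auto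
    ultimately obtain c where c: "c \<in> transversals \<pi> I ?C" "c \<in> P \<inter> Q" using meets[of ?C] by auto
    then have "\<forall>x\<in>c. t x = 0" using transversals_subset[OF c(1)] by auto
    then show "t \<in> body A (P \<inter> Q)" using c t by (auto simp: body_def)
  qed
qed (use body_mono[of "P \<inter> Q"] in blast)

lemma hits_image: "hits \<pi> I B \<Longrightarrow> I \<subseteq> \<pi> ` B"
  by (rule subsetI, erule hitsE) auto

lemma without_Diff: "without v (transversals \<pi> I A - U) = transversals \<pi> I (A - {v}) - without v U"
  unfolding without_def transversals_def by blast

lemma without_transversals: "without v (transversals \<pi> I A) = transversals \<pi> I (A - {v})"
  unfolding without_def transversals_def by blast

lemma swap_in_transversals:
  assumes "v \<in> A" "a \<in> transversals \<pi> I (A - {v})" shows "swap_in \<pi> v a \<in> transversals \<pi> I A"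
  by (rule swap_in_transversal[OF assms(2,1)]) (use transversals_subset[OF assms(2)] in auto)

lemma spread_Diff:
  "v \<in> A \<Longrightarrow> spread \<pi> I v A (transversals \<pi> I A - U) = transversals \<pi> I (A - {v}) - spread \<pi> I v A U"
  unfolding spread_def using swap_in_transversals[of v A _ \<pi> I] by blast

lemma spread_transversals:
  "v \<in> A \<Longrightarrow> spread \<pi> I v A (transversals \<pi> I A) = transversals \<pi> I (A - {v})"
  unfolding spread_def using swap_in_transversals[of v A _ \<pi> I] by blast

lemma without_spread_inject:
  assumes "v \<in> A" "\<pi> v \<in> I" "\<exists>w\<in>A. w \<noteq> v \<and> \<pi> w = \<pi> v" "U \<subseteq> transversals \<pi> I A"
    and "without v U = {}" "spread \<pi> I v A U = {}"
  shows "U = {}"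
proof (rule ccontr)
  assume "U \<noteq> {}"
  then obtain a where a: "a \<in> U" by blast
  then have v: "v \<in> a" and aA: "a \<in> transversals \<pi> I A" using assms(4,5) by (auto simp: without_def)
  obtain w where w: "w \<in> A" "w \<noteq> v" "\<pi> w = \<pi> v" using assms(3) by blast
  have "swap_in \<pi> w a \<in> transversals \<pi> I (A - {v})"
    by (rule swap_in_transversal[OF aA]) (use w transversals_subset[OF aA] in auto)
  moreover have "swap_in \<pi> v (swap_in \<pi> w a) = a"
    using swap_in_id[OF aA v assms(2)] w by (simp add: swap_in_swap_in)
  ultimately have "swap_in \<pi> w a \<in> spread \<pi> I v A U" using a by (simp add: spread_def)
  then show False using assms(6) by blast
qed

text \<open>
  The index \<open>card A - card I\<close> is one more than the dimension of the sphere \<open>body A (transversals \<pi> I A)\<close>.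
\<close>

theorem extremal_hemispheres:
  fixes \<pi> :: "'a \<Rightarrow> 'i"
  assumes "ground \<pi> I A"
  shows "sphere_like (card A - card I) (body A (transversals \<pi> I A)) \<and>
    (\<forall>U. extremal \<pi> I A U \<longrightarrow> U = {} \<or> U = transversals \<pi> I A \<or>
      (\<exists>e. card A - card I = Suc e \<and> hemispheres e (body A U) (body A (transversals \<pi> I A - U))))"
  using assms
proof (induction "card A" arbitrary: A rule: less_induct)
  case less
  have A: "finite A" "\<pi> ` A \<subseteq> I" "hits \<pi> I A" using less.prems by (auto simp: ground_def)
  let ?T = "transversals \<pi> I A"
  show ?case
  proof (cases "\<exists>v\<in>A. \<exists>w\<in>A. w \<noteq> v \<and> \<pi> w = \<pi> v")
    case False
    have "\<pi> ` A = I" using A(2) hits_image[OF A(3)] by blast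
    moreover have "inj_on \<pi> A" using False by (auto simp: inj_on_def)
    ultimately have c: "card A - card I = 0" using card_image by fastforce
    have aA: "a = A" if "a \<in> ?T" for a
    proof -
      have "x \<in> a" if x: "x \<in> A" for x
      proof -
        have "\<pi> x \<in> I" using x A by auto
        then obtain y where "y \<in> a" "y \<in> A" "\<pi> y = \<pi> x" using transversal_point[OF \<open>a \<in> ?T\<close>] by metis
        then have "y = x" using False x by auto
        then show ?thesis using \<open>y \<in> a\<close> by simp
      qed
      then show ?thesis using transversals_subset[OF that] by blast
    qed
    \<comment> \<open>The only transversal is \<open>A\<close> itself, with the empty face as
      complement: this is the sphere of dimension -1.\<close>
    then have "body A ?T = {}" by (fastforce simp: body_def)
    then have "sphere_like 0 (body A ?T)" by (simp add: sphere_like_def SS_0 homeo_def)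
    moreover have "U = {} \<or> U = ?T" if "extremal \<pi> I A U" for U
    proof -
      have "U \<subseteq> ?T" using that by (simp add: extremal_def)
      moreover have "?T \<subseteq> {A}" using aA by blast
      ultimately show ?thesis by blast
    qed
    ultimately show ?thesis using c by auto
  next
    case True
    then obtain v w where vw: "v \<in> A" "w \<in> A" "w \<noteq> v" "\<pi> w = \<pi> v" by blast
    let ?A = "A - {v}" and ?S = "transversals \<pi> I (A - {v})"
    let ?b = "body (A - {v})"
    have vI: "\<pi> v \<in> I" using A vw by auto
    have g: "ground \<pi> I ?A" using ground_without[OF A vw subset_refl] by (auto simp: ground_def)
    have "card I \<le> card ?A"
    proof -
      have "I \<subseteq> \<pi> ` ?A" using g hits_image[of \<pi> I ?A] unfolding ground_def by blast
      then show ?thesis using A(1) by (meson finite_Diff surj_card_le)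
    qed
    then have k: "card A - card I = Suc (card ?A - card I)"
      using A(1) vw(1) card_Suc_Diff1[OF A(1) vw(1)] by simp
    have IH: "sphere_like (card ?A - card I) (?b ?S)"
      "\<And>W. extremal \<pi> I ?A W \<Longrightarrow> W = {} \<or> W = ?S \<or>
        (\<exists>e. card ?A - card I = Suc e \<and> hemispheres e (?b W) (?b (?S - W)))"
      using less.hyps[OF _ g] card_Diff1_less[OF A(1) vw(1)] by blast+
    obtain c1 c2 where c1: "c1 = vertex v" and c2: "c2 = barycenter (fiber \<pi> ?A (\<pi> v))" by simp
    have cone: "coneable c1 (?b ?S)" "coneable c2 (?b ?S)"
      using coneable_apexes[OF less.prems vw subset_refl] unfolding c1 c2 by auto
    have cInt: "cone_over c1 (?b ?S) \<inter> cone_over c2 (?b ?S) = ?b ?S"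
      using cones_Int[OF less.prems vw subset_refl] unfolding c1 c2 .
    have hS: "hits \<pi> I ?A" using g by (simp add: ground_def)
    obtain a0 where "a0 \<in> ?S" using exists_transversal[OF hS] .
    then have Sne: "?S \<noteq> {}" by blast
    have split: "body A U = apex_join (without v U) c1 (?b (without v U)) \<union>
        apex_join (spread \<pi> I v A U) c2 (?b (spread \<pi> I v A U))" if "U \<subseteq> ?T" for U
      using body_split[OF less.prems vw that] unfolding c1 c2 .
    have sph: "sphere_like (Suc (card ?A - card I)) (body A ?T)"
      unfolding split[OF subset_refl] without_transversals spread_transversals[OF vw(1)]
      using susp_sphere[OF IH(1) cone cInt] Sne by (simp add: apex_join_def)
    moreover have "U = {} \<or> U = ?T \<or> hemispheres (card ?A - card I) (body A U) (body A (?T - U))"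
      if ext: "extremal \<pi> I A U" for U
    proof -
      have U: "U \<subseteq> ?T" using ext by (simp add: extremal_def)
      define P Q where "P = without v U" and "Q = spread \<pi> I v A U"
      note ctx = less.prems vw ext
      have PQ: "P \<subseteq> ?S" "Q \<subseteq> ?S"
        using P_sub[OF A vw U] Q_sub[OF A vw U] unfolding P_def Q_def by auto
      have st: "W = {} \<or> W = ?S \<or> (\<exists>e. card ?A - card I = Suc e \<and> hemispheres e (?b W) (?b (?S - W)))"
        if "W = P \<or> W = Q \<or> W = P \<inter> Q \<or> W = P \<union> Q" for W
        using that IH(2) extremal_without[OF ctx] extremal_spread[OF ctx] extremal_Int[OF ctx] extremal_Un[OF ctx]
        unfolding P_def Q_def by metis
      \<comment> \<open>The intersection of the complements is the complement of
        \<open>P \<union> Q\<close>; here the extremality of the union enters.\<close>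
      have st': "W = {} \<or> W = ?S \<or> (\<exists>e. card ?A - card I = Suc e \<and> hemispheres e (?b W) (?b (?S - W)))"
        if W: "W = ?S - P \<or> W = ?S - Q \<or> W = (?S - P) \<inter> (?S - Q)" for W
      proof -
        have "(?S - P) \<inter> (?S - Q) = ?S - (P \<union> Q)" by blast
        then obtain W' where W': "W' = P \<or> W' = Q \<or> W' = P \<inter> Q \<or> W' = P \<union> Q" "W = ?S - W'"
          using W by metis
        then have W'': "?S - W = W'" using PQ by (metis Diff_Diff_Int Int_absorb1 Un_least le_infI1)
        show ?thesis using st[OF W'(1)]
        proof (elim disjE exE conjE)
          fix e assume "card ?A - card I = Suc e" "hemispheres e (?b W') (?b (?S - W'))"
          then show ?thesis using hemispheres_sym[of e "?b W'"] W'' W'(2) by metis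
        qed (use W'(2) in auto)
      qed
      have ne: "P \<inter> Q \<noteq> {}" if "P \<noteq> {}" "Q \<noteq> {}"
        using that without_spread_nonempty[OF ctx] unfolding P_def Q_def by blast
      have ne': "(?S - P) \<inter> (?S - Q) \<noteq> {}" if "?S - P \<noteq> {}" "?S - Q \<noteq> {}"
        using that without_spread_cover[OF ctx] unfolding P_def Q_def by blast
      have K: "?b P \<inter> ?b Q = ?b (P \<inter> Q)"
      proof (rule body_Int[OF PQ])
        fix C assume "C \<subseteq> ?A" "hits \<pi> I C" "transversals \<pi> I C \<inter> P \<noteq> {}" "transversals \<pi> I C \<inter> Q \<noteq> {}"
        then show "transversals \<pi> I C \<inter> (P \<inter> Q) \<noteq> {}"
          using box_meets(1)[OF ctx] unfolding P_def Q_def by blast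
      qed
      \<comment> \<open>If the complements of \<open>P\<close> and \<open>Q\<close> had no common
        transversal in \<open>C\<close>, then \<open>P\<close> and \<open>Q\<close> would cover all
        transversals of \<open>C\<close>, and by the second part of \<open>box_meets\<close> one of
        them would do so alone.\<close>
      have K': "?b (?S - P) \<inter> ?b (?S - Q) = ?b ((?S - P) \<inter> (?S - Q))"
      proof (rule body_Int[OF Diff_subset Diff_subset])
        fix C assume C: "C \<subseteq> ?A" "hits \<pi> I C" "transversals \<pi> I C \<inter> (?S - P) \<noteq> {}" "transversals \<pi> I C \<inter> (?S - Q) \<noteq> {}"
        show "transversals \<pi> I C \<inter> ((?S - P) \<inter> (?S - Q)) \<noteq> {}"
        proof
          assume "transversals \<pi> I C \<inter> ((?S - P) \<inter> (?S - Q)) = {}"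
          then have "transversals \<pi> I C \<subseteq> P \<union> Q" using transversals_mono[OF C(1)] by blast
          then show False using box_meets(2)[OF ctx C(1,2)] C(3,4) unfolding P_def Q_def by blast
        qed
      qed
      have bU: "body A U = apex_join P c1 (?b P) \<union> apex_join Q c2 (?b Q)"
        using split[OF U] unfolding P_def Q_def .
      have bU': "body A (?T - U) = apex_join (?S - P) c1 (?b (?S - P)) \<union> apex_join (?S - Q) c2 (?b (?S - Q))"
        using split[OF Diff_subset] unfolding without_Diff spread_Diff[OF vw(1)] P_def Q_def .
      have dd: "?S - (?S - P) = P" "?S - (?S - Q) = Q" using PQ by auto
      show ?thesis
      proof (cases "U = {} \<or> U = ?T")
        case False
        have ex: "\<exists>w\<in>A. w \<noteq> v \<and> \<pi> w = \<pi> v" using vw by blast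
        have 1: "P \<noteq> {} \<or> Q \<noteq> {}"
          using without_spread_inject[OF vw(1) vI ex U] False unfolding P_def Q_def by blast
        have "\<not> (?S - P = {} \<and> ?S - Q = {})"
          using without_spread_inject[OF vw(1) vI ex Diff_subset, of U] False U
          unfolding without_Diff spread_Diff[OF vw(1)] P_def Q_def by blast
        then have 2: "P \<noteq> ?S \<or> Q \<noteq> ?S" "?S - P \<noteq> {} \<or> ?S - Q \<noteq> {}" by blast+
        have 3: "?S - P \<noteq> ?S \<or> ?S - Q \<noteq> ?S" using 1 PQ by blast
        have "disc (card ?A - card I) (body A U) (body A U \<inter> body A (?T - U))"
          unfolding bU bU'
        proof (rule half_disc[OF body_Un body_empty IH(1) PQ Sne cone cInt _ ne 1 2(1) K])
          show "W = {} \<or> W = ?S \<or> (\<exists>e. card ?A - card I = Suc e \<and> hemispheres e (?b W) (?b (?S - W)))"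
            if "W = P \<or> W = Q \<or> W = P \<inter> Q" for W using that st by blast
        qed
        moreover have "disc (card ?A - card I) (body A (?T - U)) (body A (?T - U) \<inter> body A U)"
          unfolding bU bU'
        \<comment> \<open>Writing \<open>P\<close> and \<open>Q\<close> as complements of
          complements gives the goal the form of \<open>half_disc\<close> with the halves
          exchanged.\<close>
        proof (subst (3 4) dd(1)[symmetric], subst (3 4) dd(2)[symmetric],
            rule half_disc[OF body_Un body_empty IH(1) Diff_subset Diff_subset Sne cone cInt _ ne' 2(2) 3 K'])
          show "W = {} \<or> W = ?S \<or> (\<exists>e. card ?A - card I = Suc e \<and> hemispheres e (?b W) (?b (?S - W)))"
            if "W = ?S - P \<or> W = ?S - Q \<or> W = (?S - P) \<inter> (?S - Q)" for W using that st' by blast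
        qed
        ultimately show ?thesis by (simp add: hemispheres_def Int_commute)
      qed blast
    qed
    ultimately show ?thesis unfolding k by blast
  qed
qed

section \<open>Separations of sets of exponent vectors\<close>

definition on :: "'v set \<Rightarrow> ('v \<Rightarrow> nat) set"
  where "on V = {g. \<forall>v. v \<notin> V \<longrightarrow> g v = 0}"

definition push :: "('v \<Rightarrow> 'w) \<Rightarrow> 'v set \<Rightarrow> ('v \<Rightarrow> nat) \<Rightarrow> 'w \<Rightarrow> nat"
  where "push p V g = (\<lambda>z. \<Sum>v | v \<in> V \<and> p v = z. g v)"

definition upset :: "'v set \<Rightarrow> ('v \<Rightarrow> nat) set \<Rightarrow> bool"
  where "upset V N \<longleftrightarrow> N \<subseteq> on V \<and> (\<forall>g\<in>N. \<forall>h\<in>on V. (\<forall>v. g v \<le> h v) \<longrightarrow> h \<in> N)"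

lemma upsetD: "upset V N \<Longrightarrow> g \<in> N \<Longrightarrow> h \<in> on V \<Longrightarrow> (\<And>v. g v \<le> h v) \<Longrightarrow> h \<in> N"
  unfolding upset_def by blast

text \<open>The monomial with exponents \<open>g\<close> survives localization at the variables outside \<open>a\<close>.\<close>

definition free_on :: "'v set \<Rightarrow> ('v \<Rightarrow> nat) set \<Rightarrow> 'v set \<Rightarrow> ('v \<Rightarrow> nat) \<Rightarrow> bool"
  where "free_on V N a g \<longleftrightarrow> (\<forall>h\<in>on V. (\<forall>v\<in>a. h v = g v) \<longrightarrow> h \<notin> N)"

text \<open>For fixed \<open>a\<close> these are the nonzero monomials in the variables of
  \<open>a\<close> after all others are inverted; their number is the length of that localization.
  In the pure case all survivors together measure the degree of the quotient ring.\<close>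

definition survivors :: "('v \<Rightarrow> 'i) \<Rightarrow> 'i set \<Rightarrow> 'v set \<Rightarrow> ('v \<Rightarrow> nat) set \<Rightarrow> ('v set \<times> ('v \<Rightarrow> nat)) set"
  where "survivors \<pi> I V N = {(a, g). a \<in> transversals \<pi> I V \<and> g \<in> on a \<and> free_on V N a g}"

text \<open>Unmixedness in combinatorial form: a monomial that lies in the localized ideal for every
  transversal lies in the ideal.\<close>

definition pure :: "('v \<Rightarrow> 'i) \<Rightarrow> 'i set \<Rightarrow> 'v set \<Rightarrow> ('v \<Rightarrow> nat) set \<Rightarrow> bool"
  where "pure \<pi> I V N \<longleftrightarrow> (\<forall>g\<in>on V - N. \<exists>a\<in>transversals \<pi> I V. free_on V N a g)"

text \<open>The combinatorial content of a simple separation. The last clause comes from the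
  non-zero-divisor condition: an upward closed set of exponent pairs of \<open>x\<close> and
  \<open>y\<close> that is closed under minima is empty or a quadrant.\<close>

definition quadrant_step ::
    "'w set \<Rightarrow> ('w \<Rightarrow> nat) set \<Rightarrow> 'v set \<Rightarrow> ('v \<Rightarrow> 'w) \<Rightarrow> ('v \<Rightarrow> nat) set \<Rightarrow> 'v \<Rightarrow> 'v \<Rightarrow> bool"
  where "quadrant_step V N V' p N' x y \<longleftrightarrow>
    finite V' \<and> p ` V' = V \<and> N = push p V' ` N' \<and> upset V' N' \<and>
    x \<in> V' \<and> y \<in> V' \<and> x \<noteq> y \<and> p x = p y \<and> inj_on p (V' - {y}) \<and>
    (\<forall>g\<in>N'. \<forall>h\<in>N'. (\<forall>v. v \<noteq> x \<longrightarrow> v \<noteq> y \<longrightarrow> g v = h v) \<longrightarrow> (\<lambda>v. min (g v) (h v)) \<in> N')"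

lemma push_on: "g \<in> on V' \<Longrightarrow> push p V' g \<in> on (p ` V')"
  by (auto simp: on_def push_def intro!: sum.neutral)

lemma push_single:
  assumes "{v \<in> V'. p v = z} = {u}" shows "push p V' g z = g u"
  using assms by (simp add: push_def)

lemma quadrant_corner:
  fixes L :: "(nat \<times> nat) set"
  assumes min: "\<And>s t s' t'. (s,t) \<in> L \<Longrightarrow> (s',t') \<in> L \<Longrightarrow> (min s s', min t t') \<in> L"
    and ne: "L \<noteq> {}"
  obtains r q where "(r,q) \<in> L" "\<And>s t. (s,t) \<in> L \<Longrightarrow> r \<le> s \<and> q \<le> t"
proof -
  define r where "r = (LEAST s. \<exists>t. (s,t) \<in> L)"
  define q where "q = (LEAST t. \<exists>s. (s,t) \<in> L)"
  have ex: "\<exists>s t. (s,t) \<in> L" using ne by auto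
  then have "\<exists>t. (r,t) \<in> L" unfolding r_def by (rule LeastI_ex)
  then obtain t where t: "(r,t) \<in> L" by blast
  have "\<exists>t s. (s,t) \<in> L" using ex by blast
  then have "\<exists>s. (s,q) \<in> L" unfolding q_def by (rule LeastI_ex)
  then obtain s where s: "(s,q) \<in> L" by blast
  have le: "r \<le> s" "q \<le> t" if "(s,t) \<in> L" for s t
    using that unfolding r_def q_def by (auto intro: Least_le)
  have "(min r s, min t q) \<in> L" using min[OF t s] .
  then have "(r,q) \<in> L" using le(1)[OF s] le(2)[OF t] by (simp add: min_absorb1 min_absorb2)
  then show thesis using that le by blast
qed

section \<open>Purity and survivors under one separation\<close>

context
  fixes V N V' and p :: "'v \<Rightarrow> 'w" and N' x y and \<pi> :: "'w \<Rightarrow> 'i" and I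
  assumes step: "quadrant_step V N V' p N' x y" and \<pi>: "\<pi> ` V \<subseteq> I"
begin

private lemma facts: "finite V'" "p ` V' = V" "N = push p V' ` N'" "x \<in> V'" "y \<in> V'" "x \<noteq> y" "p x = p y"
    "inj_on p (V' - {y})" "N' \<subseteq> on V'"
  using step by (auto simp: quadrant_step_def upset_def)

private lemma up: "g \<in> N' \<Longrightarrow> h \<in> on V' \<Longrightarrow> (\<And>v. g v \<le> h v) \<Longrightarrow> h \<in> N'"
  using step by (auto simp: quadrant_step_def upset_def)

private lemma minN: "g \<in> N' \<Longrightarrow> h \<in> N' \<Longrightarrow> (\<And>v. v \<noteq> x \<Longrightarrow> v \<noteq> y \<Longrightarrow> g v = h v) \<Longrightarrow> (\<lambda>v. min (g v) (h v)) \<in> N'"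
  using step unfolding quadrant_step_def by blast

private lemma fib_z: "{v \<in> V'. p v = p x} = {x, y}"
proof
  show "{v \<in> V'. p v = p x} \<subseteq> {x, y}"
    using facts(4,6,8) by (auto dest: inj_onD)
qed (use facts in auto)

private lemma fib_other: "v \<in> V' \<Longrightarrow> v \<noteq> x \<Longrightarrow> v \<noteq> y \<Longrightarrow> {u \<in> V'. p u = p v} = {v}"
proof -
  assume v: "v \<in> V'" "v \<noteq> x" "v \<noteq> y"
  have "u = v" if u: "u \<in> V'" "p u = p v" for u
  proof (cases "u = y")
    case True
    then have "p x = p v" using u facts by simp
    then show ?thesis using v facts(4,6,8) by (auto dest: inj_onD)
  next
    case False
    then show ?thesis using u v facts(8) by (auto dest: inj_onD)
  qed
  then show ?thesis using v by auto
qed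

private lemma push_z: "push p V' g (p x) = g x + g y"
  using fib_z facts(6) by (simp add: push_def)

private lemma push_other: "v \<in> V' \<Longrightarrow> v \<noteq> x \<Longrightarrow> v \<noteq> y \<Longrightarrow> push p V' g (p v) = g v"
  using push_single[OF fib_other] .

private lemma p_other: "v \<in> V' \<Longrightarrow> v \<noteq> x \<Longrightarrow> v \<noteq> y \<Longrightarrow> p v \<noteq> p x"
  using fib_z by blast

definition lift_set :: "'w set \<Rightarrow> 'v set"
  where "lift_set a = {v \<in> V'. v \<noteq> x \<and> v \<noteq> y \<and> p v \<in> a}"

text \<open>The exponents of \<open>x\<close> and \<open>y\<close> that occur in the ideal when the
  exponents on \<open>lift_set a\<close> are fixed and all other variables are inverted.\<close>

definition shadow :: "'w set \<Rightarrow> ('v \<Rightarrow> nat) \<Rightarrow> (nat \<times> nat) set"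
  where "shadow a g = {(h x, h y) | h. h \<in> N' \<and> (\<forall>v\<in>lift_set a. h v = g v)}"

lemma shadow_up:
  assumes "(s,t) \<in> shadow a g" "s \<le> s'" "t \<le> t'" shows "(s',t') \<in> shadow a g"
proof -
  obtain h where h: "s = h x" "t = h y" "h \<in> N'" "\<forall>v\<in>lift_set a. h v = g v"
    using assms(1) by (auto simp: shadow_def)
  let ?h = "h(x := s', y := t')"
  have "?h \<in> on V'" using h facts by (auto simp: on_def)
  then have "?h \<in> N'" using up[OF h(3)] h(1,2) assms by auto
  moreover have "\<forall>v\<in>lift_set a. ?h v = g v" using h by (auto simp: lift_set_def)
  ultimately show ?thesis using facts(6) unfolding shadow_def by (auto intro!: exI[of _ ?h])
qed

text \<open>Two witnesses may differ in the inverted variables. Raising both to their common maximum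
  away from \<open>x\<close> and \<open>y\<close> removes the difference without leaving the ideal,
  and the quadrant condition applies.\<close>

lemma shadow_min:
  assumes "(s,t) \<in> shadow a g" "(s',t') \<in> shadow a g" shows "(min s s', min t t') \<in> shadow a g"
proof -
  obtain h where h: "s = h x" "t = h y" "h \<in> N'" "\<forall>v\<in>lift_set a. h v = g v"
    using assms(1) by (auto simp: shadow_def)
  obtain k where k: "s' = k x" "t' = k y" "k \<in> N'" "\<forall>v\<in>lift_set a. k v = g v"
    using assms(2) by (auto simp: shadow_def)
  define m where "m v = max (h v) (k v)" for v
  have hk: "h \<in> on V'" "k \<in> on V'" using h k facts by auto
  have m1: "m(x := s, y := t) \<in> N'"
    by (rule up[OF h(3)]) (use hk facts h in \<open>auto simp: on_def m_def\<close>)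
  have m2: "m(x := s', y := t') \<in> N'"
    by (rule up[OF k(3)]) (use hk facts k in \<open>auto simp: on_def m_def\<close>)
  have "(\<lambda>v. min ((m(x := s, y := t)) v) ((m(x := s', y := t')) v)) \<in> N'"
    by (rule minN[OF m1 m2]) auto
  moreover have "min ((m(x := s, y := t)) v) ((m(x := s', y := t')) v) = g v" if "v \<in> lift_set a" for v
    using that h(4) k(4) by (auto simp: lift_set_def m_def)
  ultimately show ?thesis unfolding shadow_def mem_Collect_eq
    by (intro exI[of _ "\<lambda>v. min ((m(x := s, y := t)) v) ((m(x := s', y := t')) v)"]) (use facts(6) in auto)
qed

text \<open>If \<open>g (p x)\<close> were at least \<open>r + q\<close>, some point of the quadrant
  would have coordinate sum \<open>g (p x)\<close>, and its monomial would map to one in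
  \<open>N\<close> that agrees with \<open>g\<close> on \<open>a\<close>.\<close>

lemma shadow_corner:
  assumes a: "p x \<in> a" "a \<subseteq> V" and free: "free_on V N a g" and g': "\<forall>v\<in>lift_set a. g' v = g (p v)"
  obtains r q where "\<And>s t. (s,t) \<in> shadow a g' \<Longrightarrow> r \<le> s \<and> q \<le> t" "g (p x) < r + q"
    "shadow a g' \<noteq> {} \<Longrightarrow> (r,q) \<in> shadow a g'"
proof (cases "shadow a g' = {}")
  case True
  \<comment> \<open>An empty quadrant makes every pair a lower bound; this one is chosen to satisfy
    the strict inequality.\<close>
  then show thesis using that[of "Suc (g (p x))" 0] by auto
next
  case False
  then obtain r q where rq: "(r,q) \<in> shadow a g'" "\<And>s t. (s,t) \<in> shadow a g' \<Longrightarrow> r \<le> s \<and> q \<le> t"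
    using quadrant_corner[OF shadow_min] by metis
  have "g (p x) < r + q"
  proof (rule ccontr)
    assume "\<not> g (p x) < r + q"
    then have "(r, g (p x) - r) \<in> shadow a g'" using shadow_up[OF rq(1)] by simp
    then obtain h where h: "h x = r" "h y = g (p x) - r" "h \<in> N'" "\<forall>v\<in>lift_set a. h v = g' v"
      by (auto simp: shadow_def)
    have "push p V' h u = g u" if u: "u \<in> a" for u
    proof (cases "u = p x")
      case True then show ?thesis using h push_z[of h] \<open>\<not> g (p x) < r + q\<close> by simp
    next
      case False
      obtain v where v: "v \<in> V'" "p v = u" using u a facts(2) by auto
      then have "v \<noteq> x" "v \<noteq> y" using False facts(7) by auto
      then show ?thesis using push_other[of v h] v h(4) g' u by (auto simp: lift_set_def)
    qed
    moreover have "push p V' h \<in> on V" using push_on h(3) facts by blast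
    moreover have "push p V' h \<in> N" using h(3) facts(3) by blast
    ultimately show False using free unfolding free_on_def by blast
  qed
  then show thesis using that rq by blast
qed

lemma lift_image: "a \<subseteq> V \<Longrightarrow> p ` lift_set a = a - {p x}"
proof
  assume a: "a \<subseteq> V"
  show "a - {p x} \<subseteq> p ` lift_set a"
  proof
    fix u assume u: "u \<in> a - {p x}"
    then obtain v where "v \<in> V'" "p v = u" using a facts(2) by auto
    then show "u \<in> p ` lift_set a" using u facts(7) by (auto simp: lift_set_def)
  qed
qed (auto simp: lift_set_def dest: p_other)

lemma lift_transversal:
  assumes a: "a \<in> transversals \<pi> I V"
  shows "p x \<notin> a \<Longrightarrow> lift_set a \<in> transversals (\<pi> \<circ> p) I V'"
    "p x \<in> a \<Longrightarrow> w = x \<or> w = y \<Longrightarrow> insert w (lift_set a) \<in> transversals (\<pi> \<circ> p) I V'"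
proof -
  have aV: "a \<subseteq> V" using transversals_subset[OF a] .
  have *: "b \<in> transversals (\<pi> \<circ> p) I V'" if b: "b \<subseteq> V'" "inj_on p b" "p ` b = a" for b
    unfolding transversals_def
  proof (intro CollectI conjI ballI)
    fix i assume i: "i \<in> I"
    obtain u where u: "u \<in> a" "\<pi> u = i" using transversal_point[OF a i] by metis
    then obtain v where v: "v \<in> b" "p v = u" using b by auto
    show "\<exists>!v. v \<in> b \<and> (\<pi> \<circ> p) v = i"
    proof (rule ex1I[of _ v])
      fix w assume w: "w \<in> b \<and> (\<pi> \<circ> p) w = i"
      then have "p w \<in> a" using b by auto
      then have "p w = p v" using transversal_unique[OF a, of "p w" u] w u v i by simp
      then show "w = v" using b(2) w v by (auto dest: inj_onD)
    qed (use u v in simp)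
  qed (use b in simp)
  have inj: "inj_on p (lift_set a)" using facts(8) by (rule inj_on_subset) (auto simp: lift_set_def)
  note img = lift_image[OF aV]
  have sub: "lift_set a \<subseteq> V'" by (auto simp: lift_set_def)
  show "lift_set a \<in> transversals (\<pi> \<circ> p) I V'" if "p x \<notin> a"
    using *[OF sub inj] img that by simp
  show "insert w (lift_set a) \<in> transversals (\<pi> \<circ> p) I V'" if w: "p x \<in> a" "w = x \<or> w = y"
  proof (rule *)
    show "insert w (lift_set a) \<subseteq> V'" using sub w facts by auto
    have pw: "p w = p x" using w facts by auto
    then show "p ` insert w (lift_set a) = a" using img w by auto
    show "inj_on p (insert w (lift_set a))" using inj img pw by auto
  qed
qed

text \<open>Over \<open>insert x (lift_set a)\<close> the exponent of \<open>y\<close> is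
  unrestricted, so freeness means that the vertical line at \<open>g' x\<close> misses the shadow;
  likewise with \<open>x\<close> and \<open>y\<close> exchanged.\<close>

lemma free_lift:
  assumes a: "a \<in> transversals \<pi> I V" and free: "free_on V N a g" and g': "\<forall>v\<in>lift_set a. g' v = g (p v)"
  shows "p x \<notin> a \<Longrightarrow> free_on V' N' (lift_set a) g'"
    "(\<And>t. (g' x, t) \<notin> shadow a g') \<Longrightarrow> free_on V' N' (insert x (lift_set a)) g'"
    "(\<And>s. (s, g' y) \<notin> shadow a g') \<Longrightarrow> free_on V' N' (insert y (lift_set a)) g'"
proof -
  show "free_on V' N' (insert x (lift_set a)) g'" if "\<And>t. (g' x, t) \<notin> shadow a g'"
    using that unfolding free_on_def shadow_def by (auto, metis)
  show "free_on V' N' (insert y (lift_set a)) g'" if "\<And>s. (s, g' y) \<notin> shadow a g'"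
    using that unfolding free_on_def shadow_def by (auto, metis)
  assume z: "p x \<notin> a"
  show "free_on V' N' (lift_set a) g'" unfolding free_on_def
  proof (intro ballI impI)
    fix h assume h: "h \<in> on V'" "\<forall>v\<in>lift_set a. h v = g' v"
    have "push p V' h u = g u" if u: "u \<in> a" for u
    proof -
      obtain v where v: "v \<in> V'" "p v = u" using u transversals_subset[OF a] facts(2) by auto
      then have "v \<noteq> x" "v \<noteq> y" using u z facts(7) by auto
      then show ?thesis using push_other[of v h] v h(2) g' u by (auto simp: lift_set_def)
    qed
    moreover have "push p V' h \<in> on V" using push_on h facts by blast
    ultimately have "push p V' h \<notin> N" using free unfolding free_on_def by blast
    then show "h \<notin> N'" using facts(3) by blast
  qed
qed

text \<open>Let \<open>(r0, q0)\<close> be the corner of the quadrant over \<open>g'\<close>. The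
  merged variable gets the exponent \<open>r0 + q0 - 1\<close>, the largest one outside
  \<open>N\<close>. Survival at \<open>a\<close> forces the larger shadow to have the same corner,
  so \<open>g'\<close>, which misses the quadrant, misses the shadow on a whole vertical or
  horizontal line.\<close>

lemma pure_step:
  assumes pur: "pure \<pi> I V N" shows "pure (\<pi> \<circ> p) I V' N'"
  unfolding pure_def
proof
  fix g' assume g': "g' \<in> on V' - N'"
  define M0 where "M0 = {(s,t). g'(x := s, y := t) \<in> N'}"
  have M0: "(min s s', min t t') \<in> M0" if st: "(s,t) \<in> M0" "(s',t') \<in> M0" for s t s' t'
  proof -
    have "g'(x := s, y := t) \<in> N'" "g'(x := s', y := t') \<in> N'" using st by (auto simp: M0_def)
    then have "(\<lambda>v. min ((g'(x := s, y := t)) v) ((g'(x := s', y := t')) v)) \<in> N'"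
      by (rule minN) auto
    moreover have "(\<lambda>v. min ((g'(x := s, y := t)) v) ((g'(x := s', y := t')) v)) = g'(x := min s s', y := min t t')"
      by auto
    ultimately show ?thesis by (simp add: M0_def)
  qed
  have M0up: "(s',t') \<in> M0" if st: "(s,t) \<in> M0" "s \<le> s'" "t \<le> t'" for s t s' t'
  proof -
    have "g'(x := s', y := t') \<in> N'"
      by (rule up[of "g'(x := s, y := t)"]) (use st g' facts in \<open>auto simp: M0_def on_def\<close>)
    then show ?thesis by (simp add: M0_def)
  qed
  have g'M0: "(g' x, g' y) \<notin> M0" using g' by (simp add: M0_def)
  obtain K where K: "\<And>s t. (s,t) \<in> M0 \<Longrightarrow> s + t \<noteq> K"
    and K2: "\<And>r q. (\<And>s t. (s,t) \<in> M0 \<Longrightarrow> r \<le> s \<and> q \<le> t) \<Longrightarrow> K < r + q \<Longrightarrow> g' x < r \<or> g' y < q"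
  proof (cases "M0 = {}")
    case True
    \<comment> \<open>Without a corner, the actual coordinate sum of \<open>g'\<close>
      serves.\<close>
    show thesis by (rule that[of "g' x + g' y"]) (use True in auto)
  next
    case False
    then obtain r0 q0 where rq: "(r0,q0) \<in> M0" "\<And>s t. (s,t) \<in> M0 \<Longrightarrow> r0 \<le> s \<and> q0 \<le> t"
      using quadrant_corner[OF M0] by metis
    have lt: "g' x < r0 \<or> g' y < q0" using M0up[OF rq(1)] g'M0 by (meson not_le)
    show thesis
    proof (rule that[of "r0 + q0 - 1"])
      show "s + t \<noteq> r0 + q0 - 1" if "(s,t) \<in> M0" for s t using rq(2)[OF that] lt by auto
      fix r q assume "\<And>s t. (s,t) \<in> M0 \<Longrightarrow> r \<le> s \<and> q \<le> t" "r0 + q0 - 1 < r + q"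
      then have "r \<le> r0" "q \<le> q0" "r0 + q0 - 1 < r + q" using rq(1) by auto
      then show "g' x < r \<or> g' y < q" using lt by arith
    qed
  qed
  define g where "g u = (if u = p x then K else push p V' g' u)" for u
  have gV: "g \<in> on V" using push_on[of g' V' p] g' facts by (auto simp: g_def on_def)
  have gv: "g (p v) = g' v" if "v \<in> V'" "v \<noteq> x" "v \<noteq> y" for v
    using push_other[OF that] p_other[OF that] by (simp add: g_def)
  have "g \<notin> N"
  proof
    assume "g \<in> N"
    then obtain h where h: "h \<in> N'" "g = push p V' h" using facts(3) by auto
    have "h v = (g'(x := h x, y := h y)) v" for v
    proof (cases "v \<in> V'")
      case True
      then show ?thesis using gv[of v] push_other[of v h] h(2) by auto
    next
      case False
      then show ?thesis using h(1) g' facts by (auto simp: on_def)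
    qed
    then have "h = g'(x := h x, y := h y)" by blast
    then have "(h x, h y) \<in> M0" using h(1) by (simp add: M0_def)
    moreover have "h x + h y = K" using push_z[of h] fun_cong[OF h(2), of "p x"] by (simp add: g_def)
    ultimately show False using K by blast
  qed
  then obtain a where a: "a \<in> transversals \<pi> I V" "free_on V N a g" using pur gV unfolding pure_def by blast
  have gl: "\<forall>v\<in>lift_set a. g' v = g (p v)" using gv by (auto simp: lift_set_def)
  show "\<exists>a\<in>transversals (\<pi> \<circ> p) I V'. free_on V' N' a g'"
  proof (cases "p x \<in> a")
    case False
    then show ?thesis using lift_transversal(1)[OF a(1)] free_lift(1)[OF a gl] by blast
  next
    case True
    obtain r q where rq: "\<And>s t. (s,t) \<in> shadow a g' \<Longrightarrow> r \<le> s \<and> q \<le> t" "g (p x) < r + q"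
      using shadow_corner[OF True transversals_subset[OF a(1)] a(2) gl] by metis
    have "M0 \<subseteq> shadow a g'"
    proof clarify
      fix s t assume "(s,t) \<in> M0"
      then have "g'(x := s, y := t) \<in> N'" by (simp add: M0_def)
      moreover have "\<forall>v\<in>lift_set a. (g'(x := s, y := t)) v = g' v" by (auto simp: lift_set_def)
      ultimately show "(s,t) \<in> shadow a g'"
        using facts(6) unfolding shadow_def by (auto intro!: exI[of _ "g'(x := s, y := t)"])
    qed
    then have "g' x < r \<or> g' y < q" using K2[of r q] rq by (auto simp: g_def)
    then show ?thesis
    proof
      assume "g' x < r"
      then have "(g' x, t) \<notin> shadow a g'" for t using rq(1) by (meson not_le)
      then show ?thesis using lift_transversal(2)[OF a(1) True] free_lift(2)[OF a gl] by blast
    next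
      assume "g' y < q"
      then have "(s, g' y) \<notin> shadow a g'" for s using rq(1) by (meson not_le)
      then show ?thesis using lift_transversal(2)[OF a(1) True] free_lift(3)[OF a gl] by blast
    qed
  qed
qed

definition lift_expo :: "'w set \<Rightarrow> ('w \<Rightarrow> nat) \<Rightarrow> 'v \<Rightarrow> nat"
  where "lift_expo a g = (\<lambda>v. if v \<in> lift_set a then g (p v) else 0)"

definition corner_x :: "(nat \<times> nat) set \<Rightarrow> nat"
  where "corner_x L = (LEAST s. \<exists>t. (s,t) \<in> L)"

text \<open>
  If \<open>p x \<in> a\<close>, the monomials over \<open>(a, g)\<close> outside \<open>N'\<close> are, in the exponents of \<open>x\<close> and \<open>y\<close>, the
  complement of a quadrant. A survivor \<open>g (p x)\<close> is lifted to its vertical strip while it fits there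
  and to the horizontal one afterwards; the subtraction does not truncate.
\<close>

definition lift_survivor :: "'w set \<times> ('w \<Rightarrow> nat) \<Rightarrow> 'v set \<times> ('v \<Rightarrow> nat)"
  where "lift_survivor = (\<lambda>(a, g).
    if p x \<notin> a then (lift_set a, lift_expo a g)
    else if \<forall>t. (g (p x), t) \<notin> shadow a (lift_expo a g)
      then (insert x (lift_set a), (lift_expo a g)(x := g (p x)))
      else (insert y (lift_set a), (lift_expo a g)(y := g (p x) - corner_x (shadow a (lift_expo a g)))))"

private lemma xy_lift: "x \<notin> lift_set a" "y \<notin> lift_set a"
  by (auto simp: lift_set_def)

private lemma shadow_cong: "(\<And>v. v \<in> lift_set a \<Longrightarrow> g v = h v) \<Longrightarrow> shadow a g = shadow a h"
  by (auto simp: shadow_def)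

private lemma corner_le: "(s,t) \<in> L \<Longrightarrow> corner_x L \<le> s"
  unfolding corner_x_def by (auto intro: Least_le)

text \<open>The complement of the quadrant with corner \<open>(r, q)\<close> consists of
  \<open>r\<close> vertical and \<open>q\<close> horizontal lines. As
  \<open>g (p x) < r + q\<close>, an exponent that is at least \<open>r\<close> indexes a horizontal
  line after \<open>r\<close> is subtracted. With an empty shadow the vertical case always
  applies.\<close>

lemma lift_survivor_in:
  assumes "(a, g) \<in> survivors \<pi> I V N" shows "lift_survivor (a, g) \<in> survivors (\<pi> \<circ> p) I V' N'"
proof -
  let ?l = "lift_expo a g" and ?L = "shadow a (lift_expo a g)"
  have a: "a \<in> transversals \<pi> I V" "g \<in> on a" "free_on V N a g" using assms by (auto simp: survivors_def)
  have l: "\<forall>v\<in>lift_set a. ?l v = g (p v)" by (simp add: lift_expo_def)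
  have on: "?l \<in> on (lift_set a)" by (simp add: on_def lift_expo_def)
  consider "p x \<notin> a" | "p x \<in> a" "\<forall>t. (g (p x), t) \<notin> ?L" | t where "p x \<in> a" "(g (p x), t) \<in> ?L" by blast
  then show ?thesis
  proof cases
    case 1
    then show ?thesis using lift_transversal(1)[OF a(1)] free_lift(1)[OF a(1,3) l] on
      by (simp add: lift_survivor_def survivors_def)
  next
    case 2
    let ?g = "?l(x := g (p x))"
    have sh: "shadow a ?g = ?L" by (rule shadow_cong) (use xy_lift in auto)
    have l': "\<forall>v\<in>lift_set a. ?g v = g (p v)" using l xy_lift by auto
    have "free_on V' N' (insert x (lift_set a)) ?g"
    proof (rule free_lift(2)[OF a(1,3) l'])
      fix t show "(?g x, t) \<notin> shadow a ?g" unfolding sh using 2 by simp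
    qed
    moreover have "?g \<in> on (insert x (lift_set a))" using on by (auto simp: on_def)
    ultimately show ?thesis using lift_transversal(2)[OF a(1) 2(1)] 2
      by (simp add: lift_survivor_def survivors_def)
  next
    case 3
    obtain r q where rq: "\<And>s t. (s,t) \<in> ?L \<Longrightarrow> r \<le> s \<and> q \<le> t" "g (p x) < r + q" "?L \<noteq> {} \<Longrightarrow> (r,q) \<in> ?L"
      using shadow_corner[OF 3(1) transversals_subset[OF a(1)] a(3) l] by metis
    have "(r,q) \<in> ?L" using rq(3) 3(2) by blast
    then have r: "corner_x ?L = r" unfolding corner_x_def using rq(1) by (intro Least_equality) auto
    let ?g = "?l(y := g (p x) - r)"
    have sh: "shadow a ?g = ?L" by (rule shadow_cong) (use xy_lift in auto)
    have l': "\<forall>v\<in>lift_set a. ?g v = g (p v)" using l xy_lift by auto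
    have "r \<le> g (p x)" using rq(1)[OF 3(2)] by simp
    then have lt: "?g y < q" using rq(2) by simp
    have "free_on V' N' (insert y (lift_set a)) ?g"
    proof (rule free_lift(3)[OF a(1,3) l'])
      fix s show "(s, ?g y) \<notin> shadow a ?g" unfolding sh using rq(1) lt by (meson not_le)
    qed
    moreover have "?g \<in> on (insert y (lift_set a))" using on by (auto simp: on_def)
    ultimately show ?thesis using lift_transversal(2)[OF a(1) 3(1)] 3 r
      by (auto simp: lift_survivor_def survivors_def)
  qed
qed

text \<open>The transversal comes back as the image under \<open>p\<close>, and the exponents away
  from \<open>p x\<close> by restriction. Whether \<open>x\<close> or \<open>y\<close> was inserted
  tells which kind of strip was used, and so how to recover the exponent at
  \<open>p x\<close>.\<close>

lemma lift_survivor_inj: "inj_on lift_survivor (survivors \<pi> I V N)"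
proof (rule inj_onI, clarify)
  fix a g b h
  assume ag: "(a, g) \<in> survivors \<pi> I V N" and bh: "(b, h) \<in> survivors \<pi> I V N"
    and eq: "lift_survivor (a, g) = lift_survivor (b, h)"
  have img: "p ` fst (lift_survivor (c, k)) = c" if "(c, k) \<in> survivors \<pi> I V N" for c k
  proof -
    have "c \<in> transversals \<pi> I V" using that by (simp add: survivors_def)
    then have "c \<subseteq> V" by (rule transversals_subset)
    from lift_image[OF this] show ?thesis
      using facts(7) by (auto simp: lift_survivor_def)
  qed
  have ab: "a = b" using img[OF ag] img[OF bh] eq by metis
  have "a \<in> transversals \<pi> I V" using ag by (simp add: survivors_def)
  then have aV: "a \<subseteq> V" by (rule transversals_subset)
  have restrict: "v \<in> lift_set c \<Longrightarrow> snd (lift_survivor (c, k)) v = k (p v)" for c k v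
    using xy_lift[of c] by (auto simp: lift_survivor_def lift_expo_def)
  have gh: "g u = h u" if u: "u \<in> a" "u \<noteq> p x" for u
  proof -
    obtain v where "v \<in> lift_set a" "p v = u" using lift_image[OF aV] u by (metis DiffI empty_iff image_iff insert_iff)
    then show ?thesis using restrict[of v a g] restrict[of v a h] eq ab by metis
  qed
  have l: "lift_expo a g = lift_expo a h"
    using gh p_other by (auto simp: lift_expo_def lift_set_def fun_eq_iff)
  have "g (p x) = h (p x)" if z: "p x \<in> a"
  proof -
    let ?L = "shadow a (lift_expo a h)"
    have eq': "lift_survivor (a, g) = lift_survivor (a, h)" using eq ab by simp
    have ne: "insert x (lift_set a) \<noteq> insert y (lift_set a)" using xy_lift facts(6) by blast
    show ?thesis
    proof (cases "\<forall>t. (g (p x), t) \<notin> ?L")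
      case True
      then have F: "\<forall>t. (h (p x), t) \<notin> ?L" using eq' z ne l by (auto simp: lift_survivor_def split: if_splits)
      show ?thesis using eq' z True F l by (auto simp: lift_survivor_def dest: fun_cong[of _ _ x])
    next
      case False
      then have F: "\<not> (\<forall>t. (h (p x), t) \<notin> ?L)" using eq' z ne l by (auto simp: lift_survivor_def split: if_splits)
      have "g (p x) - corner_x ?L = h (p x) - corner_x ?L"
        using eq' z False F l by (auto simp: lift_survivor_def dest: fun_cong[of _ _ y])
      moreover have "corner_x ?L \<le> g (p x)" "corner_x ?L \<le> h (p x)" using False F corner_le by blast+
      ultimately show ?thesis by simp
    qed
  qed
  then have "g u = h u" for u
    using gh[of u] ag bh ab by (cases "u \<in> a"; cases "u = p x") (auto simp: survivors_def on_def)
  then show "a = b \<and> g = h" using ab by blast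
qed

end

text \<open>The extended ideal puts no condition on the new variables, so a transversal inside
  \<open>V\<close> keeps its survivors.\<close>

lemma survivors_extend:
  assumes "V \<subseteq> A" "upset V N"
  defines "N' \<equiv> {h \<in> on A. (\<lambda>v. if v \<in> V then h v else 0) \<in> N}"
  shows "survivors \<pi> I V N \<subseteq> survivors \<pi> I A N'" and "pure \<pi> I V N \<Longrightarrow> pure \<pi> I A N'"
proof -
  have free: "free_on A N' a h" if f: "free_on V N a g" and eq: "\<forall>v\<in>a. g v = h v" and aV: "a \<subseteq> V" for a g h
    unfolding free_on_def
  proof (intro ballI impI)
    fix k assume k: "k \<in> on A" "\<forall>v\<in>a. k v = h v"
    have "(\<lambda>v. if v \<in> V then k v else 0) \<notin> N"
      using f k eq aV unfolding free_on_def by (auto simp: on_def subset_iff)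
    then show "k \<notin> N'" by (simp add: N'_def)
  qed
  have tr: "transversals \<pi> I V \<subseteq> transversals \<pi> I A" using assms(1) by (rule transversals_mono)
  show "survivors \<pi> I V N \<subseteq> survivors \<pi> I A N'"
    using free tr transversals_subset by (fastforce simp: survivors_def)
  show "pure \<pi> I A N'" if pur: "pure \<pi> I V N"
    unfolding pure_def
  proof
    fix h assume h: "h \<in> on A - N'"
    then have "(\<lambda>v. if v \<in> V then h v else 0) \<in> on V - N" by (auto simp: N'_def on_def)
    then obtain a where a: "a \<in> transversals \<pi> I V" "free_on V N a (\<lambda>v. if v \<in> V then h v else 0)"
      using pur unfolding pure_def by blast
    then have "free_on A N' a h" using transversals_subset[OF a(1)] by (intro free[OF a(2)]) auto
    then show "\<exists>a\<in>transversals \<pi> I A. free_on A N' a h" using a(1) tr by blast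
  qed
qed

text \<open>The start of the induction: \<open>V\<close> itself is a transversal, no variable is
  inverted, and every monomial outside the ideal survives.\<close>

lemma survivors_bijection:
  assumes p: "bij_betw p V I" and N: "upset V N"
  shows "pure p I V N" and "\<exists>F. inj_on F (on I - push p V ` N) \<and> F ` (on I - push p V ` N) \<subseteq> survivors p I V N"
proof -
  have VT: "V \<in> transversals p I V"
    unfolding transversals_def using p by (auto simp: bij_betw_def inj_on_def)
  have free: "free_on V N V g" if "g \<in> on V - N" for g
    unfolding free_on_def
  proof (intro ballI impI)
    fix h assume "h \<in> on V" "\<forall>v\<in>V. h v = g v"
    then have "h v = g v" for v using that by (cases "v \<in> V") (auto simp: on_def)
    then have "h = g" by blast
    then show "h \<notin> N" using that by simp
  qed
  show "pure p I V N" unfolding pure_def using VT free by blast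
  define F where "F w = (V, \<lambda>v. if v \<in> V then w (p v) else 0)" for w :: "'b \<Rightarrow> nat"
  have ps: "push p V (\<lambda>v. if v \<in> V then w (p v) else 0) = w" if "w \<in> on I" for w
  proof
    fix i
    show "push p V (\<lambda>v. if v \<in> V then w (p v) else 0) i = w i"
    proof (cases "i \<in> I")
      case True
      then obtain v where v: "v \<in> V" "p v = i" using p by (auto simp: bij_betw_def)
      then have "{u \<in> V. p u = i} = {v}" using p by (auto simp: bij_betw_def inj_on_def)
      then show ?thesis using v by (simp add: push_def)
    next
      case False
      then have "{u \<in> V. p u = i} = {}" using p by (auto simp: bij_betw_def)
      then show ?thesis using False that by (simp add: push_def on_def)
    qed
  qed
  have "inj_on F (on I)" using ps unfolding inj_on_def F_def by (metis prod.inject)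
  then have "inj_on F (on I - push p V ` N)" by (rule inj_on_subset) blast
  moreover have "F w \<in> survivors p I V N" if w: "w \<in> on I - push p V ` N" for w
  proof -
    have "(\<lambda>v. if v \<in> V then w (p v) else 0) \<notin> N"
    proof
      assume "(\<lambda>v. if v \<in> V then w (p v) else 0) \<in> N"
      then have "push p V (\<lambda>v. if v \<in> V then w (p v) else 0) \<in> push p V ` N" by (rule imageI)
      then show False using ps[of w] w by simp
    qed
    then have "(\<lambda>v. if v \<in> V then w (p v) else 0) \<in> on V - N" by (simp add: on_def)
    then show ?thesis using VT free by (simp add: F_def survivors_def)
  qed
  ultimately show "\<exists>F. inj_on F (on I - push p V ` N) \<and> F ` (on I - push p V ` N) \<subseteq> survivors p I V N"
    by blast
qed

section \<open>Extremality from counting monomials\<close>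

definition indicat :: "'v set \<Rightarrow> 'v \<Rightarrow> nat"
  where "indicat F = (\<lambda>v. if v \<in> F then 1 else 0)"

context
  fixes \<pi> :: "'v \<Rightarrow> 'i" and I and A and N
  assumes g: "ground \<pi> I A" and N: "upset A N"
    and rad: "\<And>g. g \<in> N \<Longrightarrow> indicat {v. g v \<noteq> 0} \<in> N"
    and pow: "\<And>i. i \<in> I \<Longrightarrow> (\<lambda>j. if j = i then card (fiber \<pi> A i) else 0) \<in> push \<pi> A ` N"
    and inj: "\<exists>F. inj_on F (on I - push \<pi> A ` N) \<and> F ` (on I - push \<pi> A ` N) \<subseteq> survivors \<pi> I A N"
begin

private lemma ground: "finite A" "\<pi> ` A \<subseteq> I" "hits \<pi> I A"
  using g by (auto simp: ground_def)

private lemma upN: "g \<in> N \<Longrightarrow> h \<in> on A \<Longrightarrow> (\<And>v. g v \<le> h v) \<Longrightarrow> h \<in> N"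
  using N by (auto simp: upset_def)

definition nonfacets :: "'v set set"
  where "nonfacets = {a \<in> transversals \<pi> I A. indicat (A - a) \<in> N}"

text \<open>By \<open>pow\<close> the ideal contains a monomial supported in the fiber, and by
  \<open>rad\<close> its squarefree part, which divides the product of all variables of the fiber.
  Hence no face contains a whole fiber.\<close>

lemma fiber_in: "i \<in> I \<Longrightarrow> indicat (fiber \<pi> A i) \<in> N"
proof -
  assume i: "i \<in> I"
  obtain h where h: "h \<in> N" "(\<lambda>j. if j = i then card (fiber \<pi> A i) else 0) = push \<pi> A h"
    using pow[OF i] by blast
  have "h v = 0" if v: "v \<notin> fiber \<pi> A i" for v
  proof (cases "v \<in> A")
    case True
    then have "push \<pi> A h (\<pi> v) = 0" using v fun_cong[OF h(2), of "\<pi> v"] by (auto simp: fiber_def)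
    then show ?thesis using True ground(1) by (simp add: push_def)
  next
    case False
    then show ?thesis using h(1) N by (auto simp: upset_def on_def)
  qed
  then show ?thesis
    by (intro upN[OF rad[OF h(1)]]) (auto simp: indicat_def on_def fiber_def)
qed

text \<open>\<open>a\<close> has only one element \<open>v\<close> in the fiber of \<open>v\<close>.
  A positive exponent there would, with exponent 1 at all variables outside \<open>a\<close>, make
  the monomial divisible by the product of the fiber. So only the exponent vector 0
  survives.\<close>

lemma survivors_facets: "survivors \<pi> I A N \<subseteq> (\<lambda>a. (a, \<lambda>_. 0)) ` (transversals \<pi> I A - nonfacets)"
proof clarify
  fix a g assume "(a, g) \<in> survivors \<pi> I A N"
  then have a: "a \<in> transversals \<pi> I A" "g \<in> on a" "free_on A N a g" by (auto simp: survivors_def)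
  have aA: "a \<subseteq> A" using transversals_subset[OF a(1)] .
  have "g v = 0" if v: "v \<in> a" for v
  proof (rule ccontr)
    assume gv: "g v \<noteq> 0"
    have vI: "\<pi> v \<in> I" using v aA ground by auto
    define k where "k u = (if u \<in> a then g u else if u \<in> A then 1 else 0)" for u
    have k: "k \<in> on A" using aA by (auto simp: k_def on_def)
    have "indicat (fiber \<pi> A (\<pi> v)) u \<le> k u" for u
    proof (cases "u \<in> fiber \<pi> A (\<pi> v) \<and> u \<in> a")
      case True
      then have "u = v" using transversal_unique[OF a(1), of u v] v vI by (auto simp: fiber_def)
      then show ?thesis using gv v by (simp add: k_def indicat_def)
    qed (auto simp: indicat_def k_def fiber_def)
    then have "k \<in> N" using upN[OF fiber_in[OF vI] k] by blast
    moreover have "\<forall>u\<in>a. k u = g u" by (simp add: k_def)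
    ultimately show False using a(3) k unfolding free_on_def by blast
  qed
  then have g0: "g = (\<lambda>_. 0)" using a(2) by (auto simp: on_def fun_eq_iff)
  have "indicat (A - a) \<notin> N"
    using a(3) g0 unfolding free_on_def by (auto simp: indicat_def on_def)
  then have "a \<in> transversals \<pi> I A - nonfacets" using a by (simp add: nonfacets_def)
  then show "(a, g) \<in> (\<lambda>a. (a, \<lambda>_. 0)) ` (transversals \<pi> I A - nonfacets)" using g0 by blast
qed

private lemma finite_tr: "finite (transversals \<pi> I A)"
  using finite_transversals[OF ground(1)] .

lemma card_standard_le:
  "finite (on I - push \<pi> A ` N)" "card (on I - push \<pi> A ` N) \<le> card (transversals \<pi> I A - nonfacets)"
proof -
  obtain F where F: "inj_on F (on I - push \<pi> A ` N)" "F ` (on I - push \<pi> A ` N) \<subseteq> survivors \<pi> I A N"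
    using inj by blast
  let ?X = "(\<lambda>a. (a, \<lambda>_. 0)) ` (transversals \<pi> I A - nonfacets) :: ('v set \<times> ('v \<Rightarrow> nat)) set"
  have fin: "finite ?X" using finite_tr by simp
  have sub: "F ` (on I - push \<pi> A ` N) \<subseteq> ?X" using F(2) survivors_facets by blast
  show "finite (on I - push \<pi> A ` N)" using inj_on_finite[OF F(1) sub fin] .
  have "card (on I - push \<pi> A ` N) \<le> card ?X" using card_inj_on_le[OF F(1) sub fin] .
  also have "\<dots> \<le> card (transversals \<pi> I A - nonfacets)" using finite_tr by (intro card_image_le) simp
  finally show "card (on I - push \<pi> A ` N) \<le> card (transversals \<pi> I A - nonfacets)" .
qed

private definition sizes :: "('i \<Rightarrow> nat) set"
  where "sizes = {u \<in> on I. \<forall>i\<in>I. 1 \<le> u i \<and> u i \<le> card (fiber \<pi> A i)}"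

private lemma traces_sizes: "traces \<pi> I A nonfacets \<subseteq> sizes"
proof
  fix u assume u: "u \<in> traces \<pi> I A nonfacets"
  then obtain B where B: "u = box_size \<pi> B" "B \<subseteq> A" by (rule tracesE)
  have "u i \<le> card (fiber \<pi> A i)" for i
    unfolding B(1) box_size_def using ground(1) B(2) by (intro card_mono) (auto simp: fiber_def)
  moreover have "1 \<le> u i" if "i \<in> I" for i using traces_pos[OF u ground(1) that] .
  moreover have "u \<in> on I" using traces_outside[OF u ground(2)] by (simp add: on_def)
  ultimately show "u \<in> sizes" by (simp add: sizes_def)
qed

private lemma finite_I: "finite I"
proof -
  have "I \<subseteq> \<pi> ` A" by (rule subsetI, erule hitsE[OF ground(3)]) auto
  then show ?thesis using ground(1) finite_surj by blast
qed

private lemma finite_sizes: "finite sizes"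
proof -
  let ?m = "card A"
  have "sizes \<subseteq> {u. \<forall>i. (i \<in> I \<longrightarrow> u i \<in> {..?m}) \<and> (i \<notin> I \<longrightarrow> u i = 0)}"
  proof
    fix u assume u: "u \<in> sizes"
    have "u i \<le> ?m" if "i \<in> I" for i
    proof -
      have "u i \<le> card (fiber \<pi> A i)" using u that by (simp add: sizes_def)
      also have "\<dots> \<le> ?m" using ground(1) by (intro card_mono) (auto simp: fiber_def)
      finally show ?thesis .
    qed
    then show "u \<in> {u. \<forall>i. (i \<in> I \<longrightarrow> u i \<in> {..?m}) \<and> (i \<notin> I \<longrightarrow> u i = 0)}"
      using u by (auto simp: sizes_def on_def)
  qed
  moreover have "finite {u. \<forall>i. (i \<in> I \<longrightarrow> u i \<in> {..?m}) \<and> (i \<notin> I \<longrightarrow> u i = 0)}"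
    by (rule finite_set_of_finite_funs[OF finite_I]) simp
  ultimately show ?thesis by (rule finite_subset)
qed

text \<open>Numbering every fiber from 1 turns the choice of one point in each fiber into a
  size.\<close>

private lemma card_transversals_le: "card (transversals \<pi> I A) \<le> card sizes"
proof -
  have "\<exists>e. bij_betw e (fiber \<pi> A i) {1..card (fiber \<pi> A i)}" for i
    using ex_bij_betw_finite_nat[of "fiber \<pi> A i"] ground(1)
    by (intro finite_same_card_bij) (auto simp: fiber_def)
  then obtain e where e: "\<And>i. bij_betw (e i) (fiber \<pi> A i) {1..card (fiber \<pi> A i)}" by metis
  define c where "c a i = (THE x. x \<in> a \<and> \<pi> x = i)" for a i
  have c: "c a i \<in> a" "\<pi> (c a i) = i" if "a \<in> transversals \<pi> I A" "i \<in> I" for a i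
    using theI'[OF transversal_ex1[OF that]] unfolding c_def by auto
  have cf: "c a i \<in> fiber \<pi> A i" if "a \<in> transversals \<pi> I A" "i \<in> I" for a i
    using c[OF that] transversals_subset[OF that(1)] by (auto simp: fiber_def)
  define f where "f a = (\<lambda>i. if i \<in> I then e i (c a i) else 0)" for a
  have "inj_on f (transversals \<pi> I A)"
  proof (rule inj_onI)
    fix a b assume a: "a \<in> transversals \<pi> I A" and b: "b \<in> transversals \<pi> I A" and eq: "f a = f b"
    have cc: "c a i = c b i" if "i \<in> I" for i
    proof -
      have "e i (c a i) = e i (c b i)" using fun_cong[OF eq, of i] that by (simp add: f_def)
      then show ?thesis using e[of i] cf[OF a that] cf[OF b that] by (auto simp: bij_betw_def inj_on_def)
    qed
    have sub: "a \<subseteq> b" if a: "a \<in> transversals \<pi> I A" and b: "b \<in> transversals \<pi> I A" and cc: "\<And>i. i \<in> I \<Longrightarrow> c a i = c b i" for a b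
    proof
      fix x assume x: "x \<in> a"
      have i: "\<pi> x \<in> I" using x transversals_subset[OF a] ground(2) by auto
      have "x = c a (\<pi> x)" using transversal_unique[OF a x c(1)[OF a i]] c(2)[OF a i] i by simp
      then show "x \<in> b" using cc[OF i] c(1)[OF b i] by simp
    qed
    show "a = b" using sub[OF a b cc] sub[OF b a cc[symmetric]] by blast
  qed
  moreover have "f ` transversals \<pi> I A \<subseteq> sizes"
  proof clarify
    fix a assume a: "a \<in> transversals \<pi> I A"
    have "e i (c a i) \<in> {1..card (fiber \<pi> A i)}" if "i \<in> I" for i
      using e[of i] cf[OF a that] by (auto simp: bij_betw_def)
    then show "f a \<in> sizes" by (simp add: sizes_def f_def on_def)
  qed
  ultimately show ?thesis using finite_sizes by (rule card_inj_on_le)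
qed

text \<open>A monomial of the ideal whose degree in the fiber of \<open>i\<close> is
  \<open>card (fiber \<pi> A i) - u i\<close> involves at most that many variables there. Enlarging
  its support to exactly this number and taking the complement gives a box of size \<open>u\<close>;
  the transversals of this box avoid the support, so they are nonfacets and \<open>u\<close> is a
  trace.\<close>

private lemma complement_standard:
  assumes u: "u \<in> sizes" "u \<notin> traces \<pi> I A nonfacets"
  shows "(\<lambda>i. card (fiber \<pi> A i) - u i) \<in> on I - push \<pi> A ` N"
proof
  have out: "fiber \<pi> A i = {}" if "i \<notin> I" for i using that ground(2) by (auto simp: fiber_def)
  show "(\<lambda>i. card (fiber \<pi> A i) - u i) \<in> on I" using out by (auto simp: on_def)
  show "(\<lambda>i. card (fiber \<pi> A i) - u i) \<notin> push \<pi> A ` N"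
  proof
    assume "(\<lambda>i. card (fiber \<pi> A i) - u i) \<in> push \<pi> A ` N"
    then obtain h where h: "h \<in> N" "push \<pi> A h = (\<lambda>i. card (fiber \<pi> A i) - u i)" by auto
    define F where "F i = {v \<in> fiber \<pi> A i. h v \<noteq> 0}" for i
    have finf: "finite (fiber \<pi> A i)" for i using ground(1) by (simp add: fiber_def)
    have "card (F i) \<le> card (fiber \<pi> A i) - u i" for i
    proof -
      have "card (F i) = (\<Sum>v\<in>F i. 1)" by simp
      also have "\<dots> \<le> (\<Sum>v\<in>F i. h v)" by (intro sum_mono) (auto simp: F_def)
      also have "\<dots> \<le> (\<Sum>v\<in>fiber \<pi> A i. h v)" using finf by (intro sum_mono2) (auto simp: F_def)
      also have "\<dots> = card (fiber \<pi> A i) - u i" using fun_cong[OF h(2), of i] by (simp add: push_def fiber_def)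
      finally show ?thesis .
    qed
    then have "\<exists>G. F i \<subseteq> G \<and> G \<subseteq> fiber \<pi> A i \<and> card G = card (fiber \<pi> A i) - u i" for i
      using exists_subset_between[of "F i" "card (fiber \<pi> A i) - u i" "fiber \<pi> A i"] finf
      by (auto simp: F_def)
    then obtain G where G: "\<And>i. F i \<subseteq> G i" "\<And>i. G i \<subseteq> fiber \<pi> A i" "\<And>i. card (G i) = card (fiber \<pi> A i) - u i"
      by metis
    define B where "B = {v \<in> A. v \<notin> G (\<pi> v)}"
    have fB: "fiber \<pi> B i = fiber \<pi> A i - G i" for i by (auto simp: fiber_def B_def)
    have size: "box_size \<pi> B i = u i" for i
    proof (cases "i \<in> I")
      case True
      have "card (fiber \<pi> A i - G i) = card (fiber \<pi> A i) - card (G i)"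
        using G(2) finf by (intro card_Diff_subset) (auto intro: finite_subset)
      then show ?thesis using True u(1) G(3) by (simp add: box_size_def fB sizes_def)
    next
      case False
      then show ?thesis using out[OF False] u(1) by (simp add: box_size_def fB sizes_def on_def)
    qed
    have "hits \<pi> I B"
    proof (rule hitsI)
      fix i assume "i \<in> I"
      then have "card (fiber \<pi> B i) \<noteq> 0" using size[of i] u(1) by (auto simp: box_size_def sizes_def)
      then have "fiber \<pi> B i \<noteq> {}" by auto
      then show "\<exists>x. x \<in> B \<and> \<pi> x = i" by (auto simp: fiber_def)
    qed
    moreover have BA: "B \<subseteq> A" by (auto simp: B_def)
    moreover have "transversals \<pi> I B \<subseteq> nonfacets"
    proof
      fix a assume a: "a \<in> transversals \<pi> I B"
      have hA: "h \<in> on A" using h(1) N by (auto simp: upset_def)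
      have "v \<in> A - a" if "h v \<noteq> 0" for v
      proof -
        have "v \<in> A" using that hA by (auto simp: on_def)
        then have "v \<in> G (\<pi> v)" using that G(1)[of "\<pi> v"] by (auto simp: F_def fiber_def)
        then show ?thesis using \<open>v \<in> A\<close> transversals_subset[OF a] by (auto simp: B_def)
      qed
      then have "indicat (A - a) \<in> N"
        by (intro upN[OF rad[OF h(1)]]) (auto simp: indicat_def on_def)
      then show "a \<in> nonfacets" using a transversals_mono[OF BA] by (auto simp: nonfacets_def)
    qed
    ultimately have "box_size \<pi> B \<in> traces \<pi> I A nonfacets" by (intro tracesI)
    moreover have "box_size \<pi> B = u" using size by blast
    ultimately show False using u(2) by simp
  qed
qed

text \<open>The sizes that are not traces inject into the monomials outside the pushed ideal, and
  these into the transversals outside \<open>nonfacets\<close>. As there are at most as many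
  transversals as sizes, \<open>nonfacets\<close> is at most as large as its set of traces;
  \<open>card_traces_le\<close> is the converse.\<close>

theorem extremal_nonfacets: "extremal \<pi> I A nonfacets"
proof -
  let ?t = "traces \<pi> I A nonfacets" and ?T = "transversals \<pi> I A"
  have sub: "nonfacets \<subseteq> ?T" by (auto simp: nonfacets_def)
  have fin: "finite nonfacets" "finite ?t" using sub finite_tr traces_sizes finite_sizes finite_subset by blast+
  have "inj_on (\<lambda>u i. card (fiber \<pi> A i) - u i) (sizes - ?t)"
  proof (rule inj_onI)
    fix u w assume u: "u \<in> sizes - ?t" and w: "w \<in> sizes - ?t"
      and eq: "(\<lambda>i. card (fiber \<pi> A i) - u i) = (\<lambda>i. card (fiber \<pi> A i) - w i)"
    show "u = w"
    proof
      fix i show "u i = w i"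
      proof (cases "i \<in> I")
        case True
        then have "u i \<le> card (fiber \<pi> A i)" "w i \<le> card (fiber \<pi> A i)" using u w by (auto simp: sizes_def)
        then show ?thesis using fun_cong[OF eq, of i] by simp
      next
        case False
        then show ?thesis using u w by (auto simp: sizes_def on_def)
      qed
    qed
  qed
  moreover have "(\<lambda>u i. card (fiber \<pi> A i) - u i) ` (sizes - ?t) \<subseteq> on I - push \<pi> A ` N"
    by (rule image_subsetI, rule complement_standard) auto
  ultimately have "card (sizes - ?t) \<le> card (on I - push \<pi> A ` N)"
    using card_standard_le(1) by (rule card_inj_on_le)
  also have "\<dots> \<le> card (?T - nonfacets)" by (rule card_standard_le)
  finally have "card sizes - card ?t \<le> card ?T - card nonfacets"
    using sub traces_sizes fin by (simp add: card_Diff_subset)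
  moreover have "card nonfacets \<le> card ?T" using sub finite_tr by (rule card_mono[rotated])
  moreover have "card ?t \<le> card sizes" using traces_sizes finite_sizes by (rule card_mono[rotated])
  ultimately have "card nonfacets \<le> card ?t" using card_transversals_le by linarith
  then show ?thesis using card_traces_le[OF g sub] sub by (simp add: extremal_def)
qed

end

section \<open>Monomial ideals and exponent vectors\<close>

abbreviation (input) "keys \<equiv> Poly_Mapping.keys"
abbreviation (input) "lookup \<equiv> Poly_Mapping.lookup"
abbreviation (input) "single \<equiv> Poly_Mapping.single"

definition ideal_of :: "'v expo set \<Rightarrow> ('v, 'k::field) mpoly set"
  where "ideal_of M = {f. keys f \<subseteq> M}"

definition mono_set :: "'v set \<Rightarrow> 'v expo set \<Rightarrow> bool"
  where "mono_set V M \<longleftrightarrow> M \<subseteq> {m. keys m \<subseteq> V} \<and>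
    (\<forall>m\<in>M. \<forall>t. keys t \<subseteq> V \<longrightarrow> m + t \<in> M)"

definition multiples :: "'v set \<Rightarrow> 'v expo set \<Rightarrow> 'v expo set"
  where "multiples V S = {s + t | s t. s \<in> S \<and> keys (s + t) \<subseteq> V}"

lemma multiplesI: "s \<in> S \<Longrightarrow> s + t = m \<Longrightarrow> keys m \<subseteq> V \<Longrightarrow> m \<in> multiples V S"
  unfolding multiples_def by blast

lemma keys_add_nat: "keys (a + b) = keys a \<union> keys (b :: 'v expo)"
  by (auto simp: in_keys_iff lookup_add)

lemma mono_set_multiples: "mono_set V (multiples V S)"
proof -
  have "s + (t + r) \<in> multiples V S" if "s \<in> S" "keys (s + (t + r)) \<subseteq> V" for s t r :: "'a expo"
    using that unfolding multiples_def by blast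
  then show ?thesis unfolding mono_set_def by (auto simp: multiples_def keys_add_nat add.assoc)
qed

lemma subset_multiples: "S \<subseteq> {m. keys m \<subseteq> V} \<Longrightarrow> S \<subseteq> multiples V S"
proof
  fix s assume "S \<subseteq> {m. keys m \<subseteq> V}" "s \<in> S"
  then have "s + 0 \<in> multiples V S" unfolding multiples_def by fastforce
  then show "s \<in> multiples V S" by simp
qed

lemma multiples_mono_set: "mono_set V M \<Longrightarrow> multiples V M = M"
  using subset_multiples[of M V] unfolding mono_set_def multiples_def by (auto simp: keys_add_nat)

lemma keys_mon [simp]: "keys (mon m :: ('v, 'k::field) mpoly) = {m}"
  by (simp add: mon_def)

lemma mon_in_ideal_of [simp]: "(mon m :: ('v, 'k::field) mpoly) \<in> ideal_of M \<longleftrightarrow> m \<in> M"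
  by (simp add: ideal_of_def)

lemma mon_add: "mon (a + b) = mon a * (mon b :: ('v, 'k::field) mpoly)"
  by (simp add: mon_def mult_single)

lemma mon_0: "mon 0 = (1 :: ('v, 'k::field) mpoly)"
  by (simp add: mon_def)

lemma var_power: "(var v :: ('v, 'k::field) mpoly) ^ e = mon (single v e)"
  by (induction e) (simp_all add: var_def mon_0 mon_add[symmetric] single_add[symmetric])

lemma poly_sum_monomials:
  fixes f :: "('v, 'k::field) mpoly"
  shows "f = (\<Sum>m\<in>keys f. single m (lookup f m))"
proof (rule poly_mapping_eqI)
  fix k
  show "lookup f k = lookup (\<Sum>m\<in>keys f. single m (lookup f m)) k"
    by (simp add: lookup_sum lookup_single when_def in_keys_iff)
qed

lemma vars_ideal_of: "mono_set V M \<Longrightarrow> ideal_of M \<subseteq> carrier (poly_ring V)"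
  unfolding mono_set_def ideal_of_def poly_ring_def vars_def by auto

lemma mem_poly_ring: "f \<in> carrier (poly_ring V) \<longleftrightarrow> (\<forall>m\<in>keys f. keys m \<subseteq> V)"
  unfolding poly_ring_def vars_def by auto

lemma ring_poly_ring: "ring (poly_ring V :: ('v, 'k::field) mpoly ring)"
  using cring_poly_ring by (rule cring.axioms(1))

lemma poly_ring_simps [simp]:
  "f \<otimes>\<^bsub>poly_ring V\<^esub> g = f * g" "f \<oplus>\<^bsub>poly_ring V\<^esub> g = f + g"
  "\<zero>\<^bsub>poly_ring V\<^esub> = 0" "\<one>\<^bsub>poly_ring V\<^esub> = 1"
  by (simp_all add: poly_ring_def)

lemma ideal_ideal_of:
  assumes M: "mono_set V M" shows "ideal (ideal_of M :: ('v, 'k::field) mpoly set) (poly_ring V)"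
proof -
  interpret R: ring "poly_ring V :: ('v, 'k::field) mpoly ring" by (rule ring_poly_ring)
  have mult: "x * a \<in> ideal_of M" if a: "a \<in> ideal_of M" and x: "x \<in> carrier (poly_ring V)" for a x :: "('v, 'k) mpoly"
    unfolding ideal_of_def
  proof clarify
    fix m assume "m \<in> keys (x * a)"
    then obtain s t where "m = s + t" "s \<in> keys x" "t \<in> keys a" using keys_mult[of x a] by blast
    then have "m = t + s" "t \<in> M" "keys s \<subseteq> V" using a x by (auto simp: ideal_of_def mem_poly_ring add.commute)
    then show "m \<in> M" using M by (auto simp: mono_set_def)
  qed
  show ?thesis
  proof (rule idealI[OF ring_poly_ring])
    show "subgroup (ideal_of M) (add_monoid (poly_ring V :: ('v, 'k) mpoly ring))"
    proof (rule R.add.subgroupI)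
      show "ideal_of M \<subseteq> carrier (poly_ring V :: ('v, 'k) mpoly ring)" by (rule vars_ideal_of[OF M])
      show "(ideal_of M :: ('v, 'k) mpoly set) \<noteq> {}" by (auto simp: ideal_of_def intro!: exI[of _ 0])
      fix a b :: "('v, 'k) mpoly" assume a: "a \<in> ideal_of M" and b: "b \<in> ideal_of M"
      show "a \<oplus>\<^bsub>poly_ring V\<^esub> b \<in> ideal_of M"
        using a b keys_add[of a b] by (auto simp: ideal_of_def)
      have "a \<in> carrier (poly_ring V)" using a vars_ideal_of[OF M] by blast
      then have "\<ominus>\<^bsub>poly_ring V\<^esub> a = - a"
        by (intro R.minus_equality) (auto simp: mem_poly_ring)
      then show "\<ominus>\<^bsub>poly_ring V\<^esub> a \<in> ideal_of M" using a by (simp add: ideal_of_def)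
    qed
  qed (use mult in \<open>simp_all add: mult.commute\<close>)
qed

text \<open>\<open>J\<close> only has to lie between the generating monomials and the ideal, so the
  statement covers ideals generated by monomials as well as extensions of an ideal to more
  variables.\<close>

lemma gen_ideal_eq:
  assumes S: "S \<subseteq> {m. keys m \<subseteq> V}"
    and J: "(mon ` S :: ('v, 'k::field) mpoly set) \<subseteq> J" "J \<subseteq> ideal_of (multiples V S)"
  shows "gen_ideal V J = ideal_of (multiples V S)"
proof
  interpret R: ring "poly_ring V :: ('v, 'k::field) mpoly ring" by (rule ring_poly_ring)
  have id: "ideal (ideal_of (multiples V S) :: ('v, 'k) mpoly set) (poly_ring V)"
    by (rule ideal_ideal_of[OF mono_set_multiples])
  show "gen_ideal V J \<subseteq> ideal_of (multiples V S)"
    using R.genideal_minimal[OF id J(2)] .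
  have Jc: "J \<subseteq> carrier (poly_ring V)" using J(2) vars_ideal_of[OF mono_set_multiples] by blast
  interpret I: ideal "gen_ideal V J" "poly_ring V :: ('v, 'k) mpoly ring" by (rule R.genideal_ideal[OF Jc])
  show "ideal_of (multiples V S) \<subseteq> gen_ideal V J"
  proof
    fix f :: "('v, 'k) mpoly" assume f: "f \<in> ideal_of (multiples V S)"
    have mono: "single m c \<in> gen_ideal V J" if m: "m \<in> multiples V S" for m and c :: 'k
    proof -
      obtain s t where st: "m = s + t" "s \<in> S" "keys m \<subseteq> V" using m by (auto simp: multiples_def)
      have "mon s \<in> gen_ideal V J" using R.genideal_self[OF Jc] J(1) st(2) by blast
      moreover have "(single t c :: ('v, 'k) mpoly) \<in> carrier (poly_ring V)"
        using st by (auto simp: mem_poly_ring keys_add_nat)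
      ultimately have "single t c * mon s \<in> gen_ideal V J" using I.I_l_closed by simp
      moreover have "single t c * mon s = single m c" using st(1) by (simp add: mon_def mult_single add.commute)
      ultimately show ?thesis by simp
    qed
    have "(\<Sum>m\<in>X. single m (lookup f m)) \<in> gen_ideal V J" if "finite X" "X \<subseteq> keys f" for X
      using that
    proof (induction X rule: finite_induct)
      case empty
      then show ?case using I.zero_closed by simp
    next
      case (insert m X)
      have "single m (lookup f m) \<in> gen_ideal V J" using insert.prems f mono by (auto simp: ideal_of_def)
      then show ?case using insert I.a_closed by simp
    qed
    then show "f \<in> gen_ideal V J" using poly_sum_monomials[of f] by (metis finite_keys order_refl)
  qed
qed

lemma gen_ideal_monomials:
  "S \<subseteq> {m. keys m \<subseteq> V} \<Longrightarrow>
    gen_ideal V (mon ` S) = (ideal_of (multiples V S) :: ('v, 'k::field) mpoly set)"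
  by (rule gen_ideal_eq) (use subset_multiples[of S V] in \<open>auto simp: ideal_of_def\<close>)

lemma monomial_ideal_iff:
  "monomial_ideal V (J :: ('v, 'k::field) mpoly set) \<longleftrightarrow> (\<exists>M. mono_set V M \<and> J = ideal_of M)"
proof
  assume "monomial_ideal V J"
  then obtain S where S: "S \<subseteq> {m. keys m \<subseteq> V}" "J = gen_ideal V (mon ` S)" by (auto simp: monomial_ideal_def)
  then have "J = ideal_of (multiples V S)" using gen_ideal_monomials by blast
  then show "\<exists>M. mono_set V M \<and> J = ideal_of M" using mono_set_multiples by blast
next
  assume "\<exists>M. mono_set V M \<and> J = ideal_of M"
  then obtain M where M: "mono_set V M" "J = ideal_of M" by blast
  then have "M \<subseteq> {m. keys m \<subseteq> V}" by (simp add: mono_set_def)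
  moreover from this have "J = gen_ideal V (mon ` M)"
    using gen_ideal_monomials[of M V, where 'k = 'k] multiples_mono_set[OF M(1)] M(2) by simp
  ultimately show "monomial_ideal V J" unfolding monomial_ideal_def by blast
qed

lemma ideal_of_subset: "(ideal_of M :: ('v, 'k::field) mpoly set) \<subseteq> ideal_of M' \<longleftrightarrow> M \<subseteq> M'"
proof
  assume s: "(ideal_of M :: ('v, 'k) mpoly set) \<subseteq> ideal_of M'"
  show "M \<subseteq> M'"
  proof
    fix m assume "m \<in> M"
    then have "(mon m :: ('v, 'k) mpoly) \<in> ideal_of M" by simp
    then have "(mon m :: ('v, 'k) mpoly) \<in> ideal_of M'" using s by (rule rev_subsetD)
    then show "m \<in> M'" by simp
  qed
qed (auto simp: ideal_of_def)

text \<open>The monomials of an ideal as plain functions, the language of the combinatorial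
  part.\<close>

definition expos :: "('v, 'k::field) mpoly set \<Rightarrow> ('v \<Rightarrow> nat) set"
  where "expos J = {lookup m | m. mon m \<in> J}"

lemma expos_ideal_of: "expos (ideal_of M :: ('v, 'k::field) mpoly set) = lookup ` M"
  by (auto simp: expos_def)

lemma lookup_inj: "lookup m = lookup m' \<longleftrightarrow> m = m'"
  by (rule lookup_inject)

lemma mem_expos: "lookup m \<in> expos J \<longleftrightarrow> mon m \<in> (J :: ('v, 'k::field) mpoly set)"
  by (auto simp: expos_def lookup_inj)

lemma on_lookup:
  assumes "finite V" "g \<in> on V" obtains m where "g = lookup m" "keys m \<subseteq> V"
proof -
  have "{v. g v \<noteq> 0} \<subseteq> V" using assms(2) by (auto simp: on_def)
  then have "finite {v. g v \<noteq> 0}" using assms(1) finite_subset by blast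
  then have e: "lookup (Abs_poly_mapping g) = g" by simp
  show thesis
    by (rule that[of "Abs_poly_mapping g"]) (use e \<open>{v. g v \<noteq> 0} \<subseteq> V\<close> in \<open>auto simp: in_keys_iff\<close>)
qed

lemma lookup_on: "lookup m \<in> on V \<longleftrightarrow> keys m \<subseteq> V"
  by (auto simp: on_def in_keys_iff)

lemma expo_diff: "(\<And>v. lookup a v \<le> lookup b v) \<Longrightarrow> a + (b - a) = (b :: 'v expo)"
  by (rule poly_mapping_eqI) (simp add: lookup_add lookup_minus)

lemma upset_expos:
  assumes V: "finite V" and J: "monomial_ideal V (J :: ('v, 'k::field) mpoly set)"
  shows "upset V (expos J)"
proof -
  obtain M where M: "mono_set V M" "J = ideal_of M" using J by (auto simp: monomial_ideal_iff)
  have sub: "expos J \<subseteq> on V" using M by (auto simp: expos_ideal_of mono_set_def lookup_on)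
  moreover have "h \<in> expos J" if g: "g \<in> expos J" "h \<in> on V" "\<forall>v. g v \<le> h v" for g h
  proof -
    obtain m where m: "g = lookup m" "m \<in> M" using g M by (auto simp: expos_ideal_of)
    obtain m' where m': "h = lookup m'" "keys m' \<subseteq> V" using on_lookup[OF V g(2)] .
    have e: "m + (m' - m) = m'" using g(3) m m' by (intro expo_diff) auto
    then have "keys (m' - m) \<subseteq> V" using m'(2) keys_add_nat by (metis le_sup_iff)
    then have "m' \<in> M" using M(1) m(2) e unfolding mono_set_def by metis
    then show ?thesis using m' M by (auto simp: expos_ideal_of)
  qed
  ultimately show ?thesis unfolding upset_def by blast
qed

lemma lookup_expo_map:
  assumes "finite V" "keys m \<subseteq> V"
  shows "lookup (expo_map p m) = push p V (lookup m)"
proof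
  fix z
  have "lookup (expo_map p m) z = (\<Sum>v\<in>keys m. if p v = z then lookup m v else 0)"
    by (simp add: expo_map_def lookup_sum lookup_single when_def)
  also have "\<dots> = (\<Sum>v\<in>V. if p v = z then lookup m v else 0)"
    using assms by (intro sum.mono_neutral_left) (auto simp: in_keys_iff)
  also have "\<dots> = (\<Sum>v | v \<in> V \<and> p v = z. lookup m v)"
    using assms(1) by (simp add: sum.inter_filter)
  finally show "lookup (expo_map p m) z = push p V (lookup m) z" by (simp add: push_def)
qed

lemma var_map_mon: "var_map p (mon m :: ('v, 'k::field) mpoly) = mon (expo_map p m)"
  by (simp add: var_map_def mon_def)

lemma keys_var_map: "keys (var_map p (f :: ('v, 'k::field) mpoly)) \<subseteq> expo_map p ` keys f"
proof -
  have "keys (var_map p f) \<subseteq> (\<Union>m\<in>keys f. keys (single (expo_map p m) (lookup f m)))"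
    unfolding var_map_def by (rule keys_sum)
  also have "\<dots> \<subseteq> expo_map p ` keys f" by auto
  finally show ?thesis .
qed

text \<open>Identifying variables may cancel terms but creates no exponent vector other than the
  images of old ones. So a monomial in the image comes from a monomial of \<open>J'\<close>.\<close>

lemma expos_var_map:
  fixes p :: "'v \<Rightarrow> 'w"
  assumes V: "finite V'" and J': "monomial_ideal V' (J' :: ('v, 'k::field) mpoly set)"
  shows "expos (var_map p ` J') = push p V' ` expos J'"
proof -
  obtain M where M: "mono_set V' M" "J' = ideal_of M" using J' by (auto simp: monomial_ideal_iff)
  have lk: "lookup (expo_map p m) = push p V' (lookup m)" if "m \<in> M" for m
    using lookup_expo_map[OF V] M(1) that by (auto simp: mono_set_def)
  have "mon m \<in> var_map p ` J' \<longleftrightarrow> m \<in> expo_map p ` M" for m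
  proof
    assume "mon m \<in> var_map p ` J'"
    then obtain f where f: "mon m = var_map p f" "f \<in> J'" by auto
    have "m \<in> keys (mon m :: ('w, 'k) mpoly)" by simp
    then have "m \<in> expo_map p ` keys f" using f(1) keys_var_map[of p f] by auto
    then show "m \<in> expo_map p ` M" using f(2) M by (auto simp: ideal_of_def)
  next
    assume "m \<in> expo_map p ` M"
    then obtain m' where "m = expo_map p m'" "m' \<in> M" by auto
    then show "mon m \<in> var_map p ` J'" using var_map_mon[of p m'] M(2) by (metis imageI mon_in_ideal_of)
  qed
  then have "expos (var_map p ` J') = lookup ` expo_map p ` M" by (auto simp: expos_def)
  also have "\<dots> = push p V' ` expos J'" using lk by (force simp: M(2) expos_ideal_of)
  finally show ?thesis .
qed

section \<open>Non-zero-divisors modulo monomial ideals\<close>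

lemma non_zero_divisor_quot:
  assumes I: "ideal I R" and a: "a \<in> carrier R"
  shows "non_zero_divisor (R Quot I) (I +>\<^bsub>R\<^esub> a) \<longleftrightarrow> (\<forall>f\<in>carrier R. a \<otimes>\<^bsub>R\<^esub> f \<in> I \<longrightarrow> f \<in> I)"
proof -
  interpret ideal I R by fact
  have car: "carrier (R Quot I) = {I +>\<^bsub>R\<^esub> f | f. f \<in> carrier R}" by (auto simp: FactRing_simps)
  have mult: "(I +>\<^bsub>R\<^esub> a) \<otimes>\<^bsub>R Quot I\<^esub> (I +>\<^bsub>R\<^esub> f) = I +>\<^bsub>R\<^esub> (a \<otimes>\<^bsub>R\<^esub> f)" if "f \<in> carrier R" for f
    using rcoset_mult_add[OF a that] by (simp add: FactRing_def)
  have zero: "I +>\<^bsub>R\<^esub> f = \<zero>\<^bsub>R Quot I\<^esub> \<longleftrightarrow> f \<in> I" if "f \<in> carrier R" for f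
    using rcos_const_imp_mem[OF that] a_rcos_const by (auto simp: FactRing_def)
  show ?thesis
  proof
    assume nz: "non_zero_divisor (R Quot I) (I +>\<^bsub>R\<^esub> a)"
    show "\<forall>f\<in>carrier R. a \<otimes>\<^bsub>R\<^esub> f \<in> I \<longrightarrow> f \<in> I"
    proof (intro ballI impI)
      fix f assume f: "f \<in> carrier R" "a \<otimes>\<^bsub>R\<^esub> f \<in> I"
      then have "(I +>\<^bsub>R\<^esub> a) \<otimes>\<^bsub>R Quot I\<^esub> (I +>\<^bsub>R\<^esub> f) = \<zero>\<^bsub>R Quot I\<^esub>"
        using mult[OF f(1)] zero[of "a \<otimes>\<^bsub>R\<^esub> f"] a by simp
      moreover have "I +>\<^bsub>R\<^esub> f \<in> carrier (R Quot I)" using f(1) car by blast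
      ultimately have "I +>\<^bsub>R\<^esub> f = \<zero>\<^bsub>R Quot I\<^esub>" using nz unfolding non_zero_divisor_def by blast
      then show "f \<in> I" using zero[OF f(1)] by simp
    qed
  next
    assume nz: "\<forall>f\<in>carrier R. a \<otimes>\<^bsub>R\<^esub> f \<in> I \<longrightarrow> f \<in> I"
    show "non_zero_divisor (R Quot I) (I +>\<^bsub>R\<^esub> a)" unfolding non_zero_divisor_def
    proof (intro conjI ballI impI)
      show "I +>\<^bsub>R\<^esub> a \<in> carrier (R Quot I)" using a car by blast
      fix b assume b: "b \<in> carrier (R Quot I)" "(I +>\<^bsub>R\<^esub> a) \<otimes>\<^bsub>R Quot I\<^esub> b = \<zero>\<^bsub>R Quot I\<^esub>"
      then obtain f where f: "f \<in> carrier R" "b = I +>\<^bsub>R\<^esub> f" using car by blast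
      then have "a \<otimes>\<^bsub>R\<^esub> f \<in> I" using b(2) mult[OF f(1)] zero[of "a \<otimes>\<^bsub>R\<^esub> f"] a by simp
      then show "b = \<zero>\<^bsub>R Quot I\<^esub>" using nz zero[OF f(1)] f by simp
    qed
  qed
qed

lemma var_diff_in_ring: "v \<in> V \<Longrightarrow> w \<in> V \<Longrightarrow> var v - (var w :: ('v, 'k::field) mpoly) \<in> carrier (poly_ring V)"
  using keys_diff[of "var v :: ('v, 'k) mpoly" "var w"] by (auto simp: mem_poly_ring var_def)

text \<open>
  If \<open>a\<close> were not in the ideal but every product of \<open>a\<close> with a monomial of some degree in \<open>x\<close>, \<open>y\<close>
  is, then for the least such degree \<open>Suc N\<close> the sum of the \<open>a x\<^sup>i y\<^sup>N\<^sup>-\<^sup>i\<close> would be killed by \<open>x - y\<close>.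
\<close>

lemma nonzerodivisor_descent:
  fixes x y :: 'v and M :: "'v expo set"
  assumes M: "mono_set V M" and xy: "x \<in> V" "y \<in> V" "x \<noteq> y" and aV: "keys a \<subseteq> V"
    and nzd: "\<forall>f\<in>carrier (poly_ring V). (var x - var y) * f \<in> (ideal_of M :: ('v, 'k::field) mpoly set) \<longrightarrow> f \<in> ideal_of M"
    and all: "\<forall>i\<le>D. a + single x i + single y (D - i) \<in> M"
  shows "a \<in> M"
  using all
proof (induction D)
  case 0
  then show ?case by simp
next
  case (Suc N)
  define e where "e i = a + single x i + single y (N - i)" for i
  define g where "g i = (mon (a + single x i + single y (Suc N - i)) :: ('v, 'k) mpoly)" for i
  define f where "f = (\<Sum>i\<le>N. mon (e i) :: ('v, 'k) mpoly)"
  have summand: "(var x - var y) * mon (e i) = g (Suc i) - g i" if "i \<le> N" for i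
  proof -
    have "single x 1 + e i = a + single x (Suc i) + single y (N - i)"
      by (rule poly_mapping_eqI) (simp add: e_def lookup_add lookup_single when_def)
    moreover have "single y 1 + e i = a + single x i + single y (Suc N - i)"
      using that by (intro poly_mapping_eqI) (auto simp: e_def lookup_add lookup_single when_def)
    ultimately show ?thesis
      unfolding left_diff_distrib var_def mon_add[symmetric] g_def by simp
  qed
  have "(var x - var y) * f = (\<Sum>i\<le>N. g (Suc i) - g i)"
    unfolding f_def sum_distrib_left using summand by (intro sum.cong) auto
  also have "\<dots> = g (Suc N) - g 0" using sum_lessThan_telescope[of g "Suc N"] by (simp add: lessThan_Suc_atMost)
  finally have eq: "(var x - var y) * f = g (Suc N) - g 0"  .
  have gM: "g i \<in> ideal_of M" if "i \<le> Suc N" for i using Suc.prems that by (simp add: g_def)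
  have "g (Suc N) - g 0 \<in> ideal_of M"
    using gM[of 0] gM[of "Suc N"] keys_diff[of "g (Suc N)" "g 0"] by (auto simp: ideal_of_def)
  moreover have "f \<in> carrier (poly_ring V)"
  proof -
    have "keys f \<subseteq> e ` {..N}" unfolding f_def using keys_sum[of "\<lambda>i. mon (e i) :: ('v, 'k) mpoly" "{..N}"] by auto
    moreover have "keys (e i) \<subseteq> V" for i using aV xy by (auto simp: e_def keys_add_nat)
    ultimately show ?thesis by (auto simp: mem_poly_ring)
  qed
  ultimately have fM: "f \<in> ideal_of M" using nzd eq by metis
  have inj: "e i = e j \<longleftrightarrow> i = j" if "i \<le> N" "j \<le> N" for i j
  proof
    assume "e i = e j"
    then have "lookup (e i) x = lookup (e j) x" by simp
    then show "i = j" using xy(3) by (simp add: e_def lookup_add lookup_single when_def)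
  qed simp
  \<comment> \<open>The monomials summed up in \<open>f\<close> are distinct, so each has
    coefficient 1 in \<open>f\<close> and lies in the monomial ideal with \<open>f\<close>.\<close>
  have "e i \<in> M" if i: "i \<le> N" for i
  proof -
    have "lookup f (e i) = (\<Sum>j\<le>N. if j = i then 1 else 0)"
      unfolding f_def lookup_sum mon_def using inj i by (intro sum.cong) (auto simp: lookup_single when_def)
    then have "lookup f (e i) \<noteq> 0" using i by simp
    then show ?thesis using fM by (auto simp: ideal_of_def in_keys_iff)
  qed
  then show ?case using Suc.IH by (auto simp: e_def)
qed

text \<open>Only the incomparable case needs work. With \<open>a\<close> the minimum and
  \<open>D\<close> the sum of the two gaps, every product of \<open>a\<close> with a monomial of
  degree \<open>D\<close> in \<open>x\<close> and \<open>y\<close> is a multiple of one of the two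
  given monomials, and \<open>nonzerodivisor_descent\<close> brings \<open>a\<close> into the
  ideal.\<close>

lemma min_closed:
  fixes x y :: 'v
  assumes V: "finite V" and M: "mono_set V M" and xy: "x \<in> V" "y \<in> V" "x \<noteq> y"
    and nzd: "\<forall>f\<in>carrier (poly_ring V). (var x - var y) * f \<in> (ideal_of M :: ('v, 'k::field) mpoly set) \<longrightarrow> f \<in> ideal_of M"
    and gh: "g \<in> lookup ` M" "h \<in> lookup ` M" "\<forall>v. v \<noteq> x \<longrightarrow> v \<noteq> y \<longrightarrow> g v = h v"
  shows "(\<lambda>v. min (g v) (h v)) \<in> lookup ` M"
proof -
  have key: "(\<lambda>v. min (g v) (h v)) \<in> lookup ` M"
    if gh: "g \<in> lookup ` M" "h \<in> lookup ` M" "\<forall>v. v \<noteq> x \<longrightarrow> v \<noteq> y \<longrightarrow> g v = h v" and le: "g x \<le> h x" "h y \<le> g y" for g h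
  proof -
    obtain m1 m2 where m: "g = lookup m1" "m1 \<in> M" "h = lookup m2" "m2 \<in> M" using gh by auto
    have mV: "keys m1 \<subseteq> V" "keys m2 \<subseteq> V" using m M by (auto simp: mono_set_def)
    have "(\<lambda>v. min (g v) (h v)) \<in> on V" using m mV(1) lookup_on[of m1 V] by (auto simp: on_def)
    then obtain a where a: "(\<lambda>v. min (g v) (h v)) = lookup a" "keys a \<subseteq> V" using on_lookup[OF V] by metis
    have la: "lookup a v = min (g v) (h v)" for v using fun_cong[OF a(1), of v] by simp
    define D where "D = (h x - g x) + (g y - h y)"
    have "a \<in> M"
    proof (rule nonzerodivisor_descent[OF M xy a(2) nzd])
      show "\<forall>i\<le>D. a + single x i + single y (D - i) \<in> M"
      proof (intro allI impI)
        fix i assume i: "i \<le> D"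
        let ?e = "a + single x i + single y (D - i)"
        have le: "lookup ?e v = lookup a v + (if v = x then i else 0) + (if v = y then D - i else 0)" for v
          by (simp add: lookup_add lookup_single when_def)
        have up: "?e \<in> M" if mm: "mm \<in> M" "\<And>v. lookup mm v \<le> lookup ?e v" for mm
        proof -
          have e: "mm + (?e - mm) = ?e" by (rule expo_diff[OF mm(2)])
          have "keys ?e \<subseteq> V" using a(2) xy by (auto simp: keys_add_nat)
          then have "keys (?e - mm) \<subseteq> V" using e keys_add_nat by (metis le_sup_iff)
          then show ?thesis using M mm(1) e unfolding mono_set_def by metis
        qed
        show "?e \<in> M"
        proof (cases "h x - g x \<le> i")
          case True
          have "lookup m2 v \<le> lookup ?e v" for v
            unfolding le la using True gh(3) \<open>g x \<le> h x\<close> \<open>h y \<le> g y\<close> xy(3) m(3) by (cases "v = x"; cases "v = y") auto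
          then show ?thesis using up[OF m(4)] by blast
        next
          case False
          then have "g y - h y \<le> D - i" by (simp add: D_def)
          then have "lookup m1 v \<le> lookup ?e v" for v
            unfolding le la using gh(3) \<open>g x \<le> h x\<close> \<open>h y \<le> g y\<close> xy(3) m(1) by (cases "v = x"; cases "v = y") auto
          then show ?thesis using up[OF m(2)] by blast
        qed
      qed
    qed
    then show ?thesis using a(1) by auto
  qed
  consider "g x \<le> h x" "h y \<le> g y" | "h x \<le> g x" "g y \<le> h y" | "g x \<le> h x" "g y \<le> h y" | "h x \<le> g x" "h y \<le> g y"
    by linarith
  then show ?thesis
  proof cases
    case 1 then show ?thesis using key gh by blast
  next
    case 2
    have "(\<lambda>v. min (h v) (g v)) \<in> lookup ` M" using key[OF gh(2,1) _ 2] gh(3) by auto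
    then show ?thesis by (simp add: min.commute)
  next
    case 3
    have "min (g v) (h v) = g v" for v using 3 gh(3) by (cases "v = x"; cases "v = y") auto
    then show ?thesis using gh(1) by simp
  next
    case 4
    have "min (g v) (h v) = h v" for v using 4 gh(3) by (cases "v = x"; cases "v = y") auto
    then show ?thesis using gh(2) by simp
  qed
qed

lemma simple_separation_quadrant:
  assumes s: "simple_separation V J V' p (J' :: ('v, 'k::field) mpoly set)"
  obtains x y where "quadrant_step V (expos J) V' p (expos J') x y"
proof -
  have f: "finite V" "finite V'" "p ` V' = V" "card V' = card V + 1" "monomial_ideal V' J'" "J = var_map p ` J'"
    using s by (auto simp: simple_separation_def)
  obtain x y where xy: "x \<in> V'" "y \<in> V'" "x \<noteq> y" "p x = p y"
      "non_zero_divisor (poly_ring V' Quot J') (J' +>\<^bsub>poly_ring V'\<^esub> (var x - var y))"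
    using s by (auto simp: simple_separation_def)
  obtain M where M: "mono_set V' M" "J' = ideal_of M" using f(5) by (auto simp: monomial_ideal_iff)
  have nzd: "\<forall>f\<in>carrier (poly_ring V'). (var x - var y) * f \<in> (ideal_of M :: ('v, 'k) mpoly set) \<longrightarrow> f \<in> ideal_of M"
    using iffD1[OF non_zero_divisor_quot[OF ideal_ideal_of[OF M(1)] var_diff_in_ring[OF xy(1,2)]] xy(5)[unfolded M(2)]]
    unfolding poly_ring_simps .
  have "p y \<in> p ` (V' - {y})" using xy(1,3,4) by (auto intro!: image_eqI[of _ _ x])
  then have "p ` (V' - {y}) = V" using f(3) insert_Diff[OF xy(2)] by (metis image_insert insert_absorb)
  moreover have "card (V' - {y}) = card V" using f(4) xy(2) by simp
  \<comment> \<open>\<open>V' - {y}\<close> still maps onto \<open>V\<close> and has the same number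
    of elements, so \<open>x\<close> and \<open>y\<close> are the only variables identified.\<close>
  ultimately have inj: "inj_on p (V' - {y})" using f(2) by (intro eq_card_imp_inj_on) auto
  have "quadrant_step V (expos J) V' p (expos J') x y"
    unfolding quadrant_step_def
    using f xy inj upset_expos[OF f(2,5)] expos_var_map[OF f(2,5), of p] min_closed[OF f(2) M(1) xy(1-3) nzd]
    by (auto simp: M(2) expos_ideal_of)
  then show thesis using that by blast
qed

lemma transversals_cong: "(\<And>v. v \<in> B \<Longrightarrow> \<pi> v = \<pi>' v) \<Longrightarrow> transversals \<pi> I B = transversals \<pi>' I B"
proof (rule Set.set_eqI)
  fix a assume eq: "\<And>v. v \<in> B \<Longrightarrow> \<pi> v = \<pi>' v"
  show "a \<in> transversals \<pi> I B \<longleftrightarrow> a \<in> transversals \<pi>' I B"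
  proof (cases "a \<subseteq> B")
    case True
    then have "x \<in> a \<and> \<pi> x = i \<longleftrightarrow> x \<in> a \<and> \<pi>' x = i" for x i using eq by auto
    then show ?thesis by (simp add: transversals_def)
  qed (simp add: transversals_def)
qed

lemma push_cong: "(\<And>v. v \<in> V \<Longrightarrow> p v = q v) \<Longrightarrow> push p V g = push q V g"
  unfolding push_def by (rule ext, rule sum.cong) auto

lemma push_push:
  assumes "finite V2" "finite V1" "q ` V2 \<subseteq> V1"
  shows "push p V1 (push q V2 g) = push (p \<circ> q) V2 g"
proof
  fix z
  have "(\<Sum>u | u \<in> V1 \<and> p u = z. \<Sum>v | v \<in> V2 \<and> q v = u. g v)
    = (\<Sum>u\<in>{u \<in> V1. p u = z}. \<Sum>v\<in>{v \<in> {v \<in> V2. p (q v) = z}. q v = u}. g v)"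
    by (intro sum.cong) auto
  also have "\<dots> = (\<Sum>v\<in>{v \<in> V2. p (q v) = z}. g v)"
    using assms by (intro sum.group) auto
  finally show "push p V1 (push q V2 g) z = push (p \<circ> q) V2 g z" by (simp add: push_def)
qed

text \<open>The invariant of a succession of separations. It asserts an injection instead of an
  inequality of cardinalities, so that no finiteness of the set of monomials outside
  \<open>J\<close> has to be carried along.\<close>

lemma separation_chain:
  assumes "proper_separation V J V' p (J' :: ('v, 'k::field) mpoly set)"
  shows "finite V \<and> monomial_ideal V J \<and> finite V' \<and> p ` V' = V \<and> monomial_ideal V' J' \<and>
    expos J = push p V' ` expos J' \<and> pure p V V' (expos J') \<and>
    (\<exists>F. inj_on F (on V - expos J) \<and> F ` (on V - expos J) \<subseteq> survivors p V V' (expos J'))"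
  using assms
proof (induction rule: proper_separation.induct)
  case (rename p V' J')
  have fin: "finite V'" using rename(1,3) bij_betw_finite by blast
  have e: "expos J = push p V' ` expos J'" using expos_var_map[OF fin rename(4), of p] rename(5) by simp
  show ?case
    using rename fin e survivors_bijection[OF rename(3) upset_expos[OF fin rename(4)]]
    by (simp add: bij_betw_def)
next
  case (step V1 p J1 V2 q J2 r)
  note IH = step.IH
  obtain x y where Q: "quadrant_step V1 (expos J1) V2 q (expos J2) x y"
    using simple_separation_quadrant[OF step(2)] .
  have fin: "finite V1" "finite V2" and q: "q ` V2 = V1" and J2: "monomial_ideal V2 J2"
    and e: "expos J1 = push q V2 ` expos J2"
    using step(2) Q by (auto simp: simple_separation_def quadrant_step_def)
  have pV: "p ` V1 \<subseteq> V" using IH by blast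
  have r: "r v = (p \<circ> q) v" if "v \<in> V2" for v using step(3) that by simp
  have tr: "transversals (p \<circ> q) V V2 = transversals r V V2" using r by (intro transversals_cong) simp
  have "push r V2 g = push p V1 (push q V2 g)" for g
    using push_push[OF fin(2,1), of q p g] q push_cong[of V2 r "p \<circ> q" g] r by simp
  then have "push r V2 ` expos J2 = push p V1 ` expos J1" unfolding e by (simp add: image_image)
  then have "expos J = push r V2 ` expos J2" using IH by simp
  moreover have "pure r V V2 (expos J2)"
    using pure_step[OF Q pV] IH unfolding pure_def tr by blast
  moreover obtain F where F: "inj_on F (on V - expos J)" "F ` (on V - expos J) \<subseteq> survivors p V V1 (expos J1)"
    using IH by blast
  let ?L = "lift_survivor V2 q (expos J2) x y"
  have L: "?L ` survivors p V V1 (expos J1) \<subseteq> survivors r V V2 (expos J2)"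
  proof
    fix s assume "s \<in> ?L ` survivors p V V1 (expos J1)"
    then obtain a g where "(a, g) \<in> survivors p V V1 (expos J1)" "s = ?L (a, g)" by auto
    moreover have "survivors (p \<circ> q) V V2 (expos J2) = survivors r V V2 (expos J2)"
      by (simp add: survivors_def tr)
    ultimately show "s \<in> survivors r V V2 (expos J2)"
      using lift_survivor_in[OF Q pV, of a g] by simp
  qed
  have "inj_on (?L \<circ> F) (on V - expos J)"
    using F lift_survivor_inj[OF Q pV] by (intro comp_inj_on) (auto intro: inj_on_subset)
  moreover have "(?L \<circ> F) ` (on V - expos J) \<subseteq> survivors r V V2 (expos J2)"
    using F(2) L by (auto simp: image_comp[symmetric])
  moreover have "r ` V2 = V"
  proof -
    have "r ` V2 = p ` (q ` V2)" using r by (auto simp: image_image)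
    then show ?thesis using q IH by simp
  qed
  ultimately show ?case using IH fin J2 by blast
qed

lemma gen_ideal_extend:
  assumes "monomial_ideal V' (J' :: ('v, 'k::field) mpoly set)" "V' \<subseteq> W" "finite W"
  shows "monomial_ideal W (gen_ideal W J')"
    "expos (gen_ideal W J') = {h \<in> on W. (\<lambda>v. if v \<in> V' then h v else 0) \<in> expos J'}"
proof -
  obtain M where M: "mono_set V' M" "J' = ideal_of M" using assms(1) by (auto simp: monomial_ideal_iff)
  have MW: "M \<subseteq> {m. keys m \<subseteq> W}" using M(1) assms(2) by (auto simp: mono_set_def)
  have g: "gen_ideal W J' = ideal_of (multiples W M)"
  proof (rule gen_ideal_eq[OF MW])
    show "mon ` M \<subseteq> J'" by (auto simp: M(2))
    show "J' \<subseteq> ideal_of (multiples W M)" using subset_multiples[OF MW] unfolding M(2) ideal_of_def by blast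
  qed
  then show "monomial_ideal W (gen_ideal W J')" using mono_set_multiples monomial_ideal_iff by blast
  have fin: "finite V'" using assms finite_subset by blast
  have up: "upset V' (lookup ` M)" using upset_expos[OF fin assms(1)] by (simp add: M(2) expos_ideal_of)
  show "expos (gen_ideal W J') = {h \<in> on W. (\<lambda>v. if v \<in> V' then h v else 0) \<in> expos J'}"
    unfolding g unfolding expos_ideal_of M(2)
  proof (intro equalityI subsetI)
    fix h assume "h \<in> lookup ` multiples W M"
    then obtain s t where st: "h = lookup (s + t)" "s \<in> M" "keys (s + t) \<subseteq> W" by (auto simp: multiples_def)
    have "lookup s \<in> on V'" using st(2) M(1) by (auto simp: lookup_on mono_set_def)
    then have "lookup s v \<le> (if v \<in> V' then h v else 0)" for v
      by (simp add: st(1) lookup_add on_def)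
    moreover have "(\<lambda>v. if v \<in> V' then h v else 0) \<in> on V'" by (simp add: on_def)
    ultimately have "(\<lambda>v. if v \<in> V' then h v else 0) \<in> lookup ` M"
      using upsetD[OF up imageI[OF st(2)]] by blast
    then show "h \<in> {h \<in> on W. (\<lambda>v. if v \<in> V' then h v else 0) \<in> lookup ` M}"
      using st lookup_on by blast
  next
    fix h assume h: "h \<in> {h \<in> on W. (\<lambda>v. if v \<in> V' then h v else 0) \<in> lookup ` M}"
    then obtain m where m: "h = lookup m" "keys m \<subseteq> W" using on_lookup[OF assms(3)] by blast
    obtain s where s: "(\<lambda>v. if v \<in> V' then h v else 0) = lookup s" "s \<in> M" using h by auto
    have "lookup s v \<le> lookup m v" for v using fun_cong[OF s(1), of v] m(1) by (simp split: if_splits)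
    then have "s + (m - s) = m" by (rule expo_diff)
    then have "m \<in> multiples W M" using s(2) m(2) by (intro multiplesI) auto
    then show "h \<in> lookup ` multiples W M" using m(1) by blast
  qed
qed

text \<open>A squarefree generator divides a monomial as soon as its variables lie in the
  support.\<close>

lemma squarefree_radical:
  assumes "squarefree_monomial_ideal A (J :: ('v, 'k::field) mpoly set)" and g: "g \<in> expos J"
  shows "indicat {v. g v \<noteq> 0} \<in> expos J"
proof -
  obtain S where S: "S \<subseteq> {m. keys m \<subseteq> A \<and> squarefree_expo m}" "J = gen_ideal A (mon ` S)"
    using assms by (auto simp: squarefree_monomial_ideal_def)
  then have J: "J = ideal_of (multiples A S)" using gen_ideal_monomials by blast
  then obtain s t where st: "g = lookup (s + t)" "s \<in> S" "keys (s + t) \<subseteq> A"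
    using g by (auto simp: expos_ideal_of multiples_def)
  have "{v. g v \<noteq> 0} = keys (s + t)" by (auto simp: st(1) in_keys_iff)
  then have "indicat {v. g v \<noteq> 0} \<in> on A" using st(3) by (auto simp: on_def indicat_def)
  have "indicat {v. g v \<noteq> 0} \<in> on (keys (s + t))"
    using \<open>{v. g v \<noteq> 0} = keys (s + t)\<close> by (auto simp: on_def indicat_def)
  then obtain m where m: "indicat {v. g v \<noteq> 0} = lookup m" "keys m \<subseteq> keys (s + t)"
    by (rule on_lookup[OF finite_keys])
  have "lookup s v \<le> lookup m v" for v
  proof -
    have "lookup s v \<le> 1" using S(1) st(2) by (auto simp: squarefree_expo_def)
    moreover have "lookup s v \<le> g v" by (simp add: st(1) lookup_add)
    ultimately show ?thesis using fun_cong[OF m(1), of v] by (auto simp: indicat_def split: if_splits)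
  qed
  then have "s + (m - s) = m" by (rule expo_diff)
  then have "m \<in> multiples A S" using st(2,3) m(2) by (intro multiplesI) auto
  then show ?thesis using m(1) J by (auto simp: expos_ideal_of)
qed

lemma polarization_expos:
  assumes pol: "polarization V J A \<pi> (I :: ('v, 'k::field) mpoly set)"
  shows "ground \<pi> V A" "monomial_ideal A I" "upset A (expos I)" "expos J = push \<pi> A ` expos I"
    "pure \<pi> V A (expos I)" "\<And>g. g \<in> expos I \<Longrightarrow> indicat {v. g v \<noteq> 0} \<in> expos I"
    "\<exists>F. inj_on F (on V - push \<pi> A ` expos I) \<and> F ` (on V - push \<pi> A ` expos I) \<subseteq> survivors \<pi> V A (expos I)"
proof -
  have A: "finite A" "\<pi> ` A \<subseteq> V" and sq: "squarefree_monomial_ideal A I"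
    using pol by (auto simp: polarization_def separation_def)
  obtain V' J' where V': "V' \<subseteq> A" "proper_separation V J V' \<pi> J'" "I = gen_ideal A J'"
    using pol by (auto simp: polarization_def separation_def)
  note ch = separation_chain[OF V'(2)]
  have fin: "finite V'" and J': "monomial_ideal V' J'" and img: "\<pi> ` V' = V"
    and eJ: "expos J = push \<pi> V' ` expos J'" and monJ: "monomial_ideal V J" "finite V"
    using ch by blast+
  have eI: "expos I = {h \<in> on A. (\<lambda>v. if v \<in> V' then h v else 0) \<in> expos J'}"
    using gen_ideal_extend(2)[OF J' V'(1) A(1)] V'(3) by simp
  have upJ': "upset V' (expos J')" by (rule upset_expos[OF fin J'])
  show "monomial_ideal A I" using gen_ideal_extend(1)[OF J' V'(1) A(1)] V'(3) by simp
  then show upI: "upset A (expos I)" by (rule upset_expos[OF A(1)])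
  show "ground \<pi> V A" unfolding ground_def
  proof (intro conjI A hitsI)
    fix i assume "i \<in> V"
    then show "\<exists>x. x \<in> A \<and> \<pi> x = i" using img V'(1) by blast
  qed
  have ps: "push \<pi> A g = push \<pi> V' g" if "g \<in> on V'" for g
  proof
    fix z
    have "(\<Sum>v | v \<in> A \<and> \<pi> v = z. g v) = (\<Sum>v | v \<in> V' \<and> \<pi> v = z. g v)"
      using A(1) V'(1) that by (intro sum.mono_neutral_right) (auto simp: on_def)
    then show "push \<pi> A g z = push \<pi> V' g z" by (simp add: push_def)
  qed
  show eq: "expos J = push \<pi> A ` expos I"
  proof
    show "expos J \<subseteq> push \<pi> A ` expos I"
    proof
      fix w assume "w \<in> expos J"
      then obtain g where g: "g \<in> expos J'" "w = push \<pi> V' g" using eJ by auto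
      have gV: "g \<in> on V'" using g(1) upJ' by (auto simp: upset_def)
      have "(\<lambda>v. if v \<in> V' then g v else 0) = g" using gV by (auto simp: on_def)
      then have "g \<in> expos I" using eI g(1) gV V'(1) by (auto simp: on_def)
      then show "w \<in> push \<pi> A ` expos I" using ps[OF gV] g(2) by (metis imageI)
    qed
    show "push \<pi> A ` expos I \<subseteq> expos J"
    proof (rule image_subsetI)
      fix h assume h: "h \<in> expos I"
      let ?g = "\<lambda>v. if v \<in> V' then h v else 0"
      have "?g \<in> expos J'" using h eI by simp
      then have 1: "push \<pi> V' ?g \<in> expos J" using eJ by blast
      \<comment> \<open>Deleting the added variables lowers the pushed exponents, so membership
        follows from the upward closure of \<open>expos J\<close>.\<close>
      have "push \<pi> V' ?g z \<le> push \<pi> A h z" for z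
      proof -
        have "push \<pi> V' ?g z = (\<Sum>v | v \<in> V' \<and> \<pi> v = z. h v)" unfolding push_def by (rule sum.cong) auto
        also have "\<dots> \<le> push \<pi> A h z" unfolding push_def using A(1) V'(1) by (intro sum_mono2) auto
        finally show ?thesis .
      qed
      moreover have "push \<pi> A h \<in> on V"
      proof -
        have "h \<in> on A" using h eI by simp
        then show ?thesis using push_on[of h A \<pi>] A(2) by (auto simp: on_def)
      qed
      ultimately show "push \<pi> A h \<in> expos J"
        using upsetD[OF upset_expos[OF monJ(2,1)] 1] by blast
    qed
  qed
  show "pure \<pi> V A (expos I)" using survivors_extend(2)[OF V'(1) upJ'] ch unfolding eI by blast
  show "indicat {v. g v \<noteq> 0} \<in> expos I" if "g \<in> expos I" for g
    using squarefree_radical[OF sq that] .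
  have "survivors \<pi> V V' (expos J') \<subseteq> survivors \<pi> V A (expos I)"
    using survivors_extend(1)[OF V'(1) upJ'] unfolding eI .
  then show "\<exists>F. inj_on F (on V - push \<pi> A ` expos I) \<and> F ` (on V - push \<pi> A ` expos I) \<subseteq> survivors \<pi> V A (expos I)"
    using ch unfolding eq[symmetric] by blast
qed

section \<open>Complexes of transversals\<close>

definition co_complex :: "'a set \<Rightarrow> 'a set set \<Rightarrow> 'a set set"
  where "co_complex A T = {F. F \<subseteq> A \<and> (\<exists>a\<in>T. F \<inter> a = {})}"

lemma card_transversal:
  assumes "a \<in> transversals \<pi> I A" "\<pi> ` A \<subseteq> I" shows "card a = card I"
proof -
  have sub: "a \<subseteq> A" by (rule transversals_subset[OF assms(1)])
  have "inj_on \<pi> a"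
  proof (rule inj_onI)
    fix x y assume "x \<in> a" "y \<in> a" "\<pi> x = \<pi> y"
    moreover from this have "\<pi> x \<in> I" using sub assms(2) by auto
    ultimately show "x = y" using transversal_unique[OF assms(1)] by metis
  qed
  moreover have "\<pi> ` a = I"
  proof
    show "I \<subseteq> \<pi> ` a" by (rule subsetI, erule transversal_point[OF assms(1)]) auto
  qed (use sub assms(2) in auto)
  ultimately show ?thesis using card_image by fastforce
qed

lemma co_complex_dim:
  assumes g: "ground \<pi> I A" and T: "T \<subseteq> transversals \<pi> I A" "T \<noteq> {}"
  shows "complex_dim (co_complex A T) = int (card A - card I) - 1"
proof -
  have A: "finite A" "\<pi> ` A \<subseteq> I" using g by (auto simp: ground_def)
  have c: "card (A - a) = card A - card I" if "a \<in> T" for a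
  proof -
    have a: "a \<in> transversals \<pi> I A" using that T by auto
    have "a \<subseteq> A" by (rule transversals_subset[OF a])
    then show ?thesis using A(1) card_transversal[OF a A(2)] by (simp add: card_Diff_subset finite_subset)
  qed
  have "Max (card ` co_complex A T) = card A - card I"
  proof (rule Max_eqI)
    have "co_complex A T \<subseteq> Pow A" by (auto simp: co_complex_def)
    then show "finite (card ` co_complex A T)" using A(1) finite_subset by blast
    obtain a where "a \<in> T" using T by auto
    then have "A - a \<in> co_complex A T" by (auto simp: co_complex_def)
    then show "card A - card I \<in> card ` co_complex A T" using c[OF \<open>a \<in> T\<close>] by (metis imageI)
    fix n assume "n \<in> card ` co_complex A T"
    then obtain F a where F: "n = card F" "F \<subseteq> A" "a \<in> T" "F \<inter> a = {}" by (auto simp: co_complex_def)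
    then have "card F \<le> card (A - a)" using A(1) by (intro card_mono) auto
    then show "n \<le> card A - card I" using F c by simp
  qed
  then show ?thesis by (simp add: complex_dim_def)
qed

text \<open>A face of the join omits a point of each fiber, and the omitted points contain a
  transversal disjoint from it.\<close>

lemma join_boundary_simplices:
  assumes g: "ground \<pi> I A"
  shows "join_family I (\<lambda>i. boundary_simplex {a \<in> A. \<pi> a = i}) = co_complex A (transversals \<pi> I A)"
proof (intro equalityI subsetI)
  have A: "finite A" "\<pi> ` A \<subseteq> I" using g by (auto simp: ground_def)
  fix F assume "F \<in> join_family I (\<lambda>i. boundary_simplex {a \<in> A. \<pi> a = i})"
  then obtain G where G: "F = (\<Union>i\<in>I. G i)" "\<forall>i\<in>I. G i \<subset> {a \<in> A. \<pi> a = i}"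
    by (auto simp: join_family_def boundary_simplex_def)
  have "hits \<pi> I (A - F)"
  proof (rule hitsI)
    fix i assume i: "i \<in> I"
    then obtain x where x: "x \<in> A" "\<pi> x = i" "x \<notin> G i" using G(2) by blast
    have "x \<notin> F"
    proof
      assume "x \<in> F"
      then obtain j where "j \<in> I" "x \<in> G j" using G(1) by blast
      then show False using G(2) x by blast
    qed
    then show "\<exists>x. x \<in> A - F \<and> \<pi> x = i" using x by blast
  qed
  then obtain a where a: "a \<in> transversals \<pi> I (A - F)" by (rule exists_transversal)
  have "F \<subseteq> A" using G by blast
  moreover have "F \<inter> a = {}" using transversals_subset[OF a] by blast
  moreover have "a \<in> transversals \<pi> I A" using a transversals_mono[of "A - F" A] by blast
  ultimately show "F \<in> co_complex A (transversals \<pi> I A)" by (auto simp: co_complex_def)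
next
  have A: "finite A" "\<pi> ` A \<subseteq> I" using g by (auto simp: ground_def)
  fix F assume "F \<in> co_complex A (transversals \<pi> I A)"
  then obtain a where a: "F \<subseteq> A" "a \<in> transversals \<pi> I A" "F \<inter> a = {}" by (auto simp: co_complex_def)
  have "F = (\<Union>i\<in>I. {x \<in> F. \<pi> x = i})" using a(1) A(2) by auto
  moreover have "{x \<in> F. \<pi> x = i} \<in> boundary_simplex {a \<in> A. \<pi> a = i}" if i: "i \<in> I" for i
  proof -
    obtain x where "x \<in> a" "x \<in> A" "\<pi> x = i" using transversal_point[OF a(2) i] .
    then show ?thesis using a(1,3) unfolding boundary_simplex_def by blast
  qed
  ultimately show "F \<in> join_family I (\<lambda>i. boundary_simplex {a \<in> A. \<pi> a = i})"
    unfolding join_family_def by blast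
qed

lemma geom_realization_co_complex:
  assumes A: "finite A" and T: "T \<subseteq> transversals \<pi> I A"
  shows "geom_realization (co_complex A T) = subtopology (powertop_real UNIV) (body A T)"
proof -
  have "(\<forall>v. 0 \<le> t v) \<and> {v. t v \<noteq> 0} \<in> co_complex A T \<and> (\<Sum>v | t v \<noteq> 0. t v) = 1 \<longleftrightarrow> t \<in> body A T" for t
  proof (cases "{v. t v \<noteq> 0} \<subseteq> A")
    case True
    have "(\<Sum>v | t v \<noteq> 0. t v) = sum t A" using A True by (intro sum.mono_neutral_left) auto
    moreover have "{v. t v \<noteq> 0} \<inter> a = {} \<longleftrightarrow> (\<forall>x\<in>a. t x = 0)" for a by auto
    moreover have "\<forall>x. x \<notin> A \<longrightarrow> t x = 0" using True by auto
    ultimately show ?thesis using True unfolding body_def co_complex_def mem_Collect_eq by simp blast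
  qed (auto simp: body_def co_complex_def)
  then have "{t. (\<forall>v. 0 \<le> t v) \<and> {v. t v \<noteq> 0} \<in> co_complex A T \<and> (\<Sum>v | t v \<noteq> 0. t v) = 1} = body A T" by blast
  then show ?thesis by (simp add: geom_realization_def)
qed

lemma set_monomial_eq:
  assumes "finite R" "lookup m = indicat R"
  shows "set_monomial R = (mon m :: ('v, 'k::field) mpoly)"
  using assms
proof (induction R arbitrary: m rule: finite_induct)
  case empty
  then have "m = 0" by (intro poly_mapping_eqI) (simp add: indicat_def)
  then show ?case by (simp add: set_monomial_def mon_0)
next
  case (insert v R)
  have "lookup (m - single v 1) = indicat R"
    using insert.hyps insert.prems by (auto simp: fun_eq_iff lookup_minus lookup_single when_def indicat_def)
  then have "set_monomial R = (mon (m - single v 1) :: ('v, 'k) mpoly)" by (rule insert.IH)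
  moreover have "single v 1 + (m - single v 1) = m"
    using insert.prems by (intro expo_diff) (simp add: lookup_single when_def indicat_def)
  ultimately show ?case
    using insert.hyps by (simp add: set_monomial_def var_def mon_add[symmetric])
qed

text \<open>By \<open>rad\<close>, every monomial of the ideal is a multiple of a squarefree one in
  it, the product of its variables.\<close>

lemma stanley_reisner_expos:
  assumes A: "finite A" and J: "monomial_ideal A (J :: ('v, 'k::field) mpoly set)"
    and rad: "\<And>g. g \<in> expos J \<Longrightarrow> indicat {v. g v \<noteq> 0} \<in> expos J"
  shows "stanley_reisner_ideal A {F. F \<subseteq> A \<and> indicat F \<notin> expos J} = J"
proof -
  obtain M where M: "mono_set A M" "J = ideal_of M" using J by (auto simp: monomial_ideal_iff)
  let ?X = "{F. F \<subseteq> A \<and> indicat F \<notin> expos J}"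
  have "\<exists>m. lookup m = indicat R" if R: "R \<subseteq> A" for R
  proof -
    have "indicat R \<in> on A" using R by (auto simp: indicat_def on_def)
    then show ?thesis using on_lookup[OF A] by metis
  qed
  then obtain e where e: "\<And>R. R \<subseteq> A \<Longrightarrow> lookup (e R) = indicat R" by metis
  have sm: "set_monomial R = (mon (e R) :: ('v, 'k) mpoly)" if "R \<subseteq> A" for R
    using set_monomial_eq e[OF that] A that finite_subset by blast
  have "R \<notin> ?X \<longleftrightarrow> e R \<in> M" if R: "R \<subseteq> A" for R
    using R e[OF R, symmetric] by (auto simp: M(2) expos_ideal_of lookup_inj)
  then have "{R. R \<subseteq> A \<and> R \<notin> ?X} = {R. R \<subseteq> A \<and> e R \<in> M}" by blast
  then have gens: "set_monomial ` {R. R \<subseteq> A \<and> R \<notin> ?X} = (mon ` (e ` {R. R \<subseteq> A \<and> e R \<in> M}) :: ('v, 'k) mpoly set)"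
    unfolding image_image using sm by (auto intro!: image_cong)
  let ?S = "e ` {R. R \<subseteq> A \<and> e R \<in> M}"
  have SM: "?S \<subseteq> M" by auto
  then have SA: "?S \<subseteq> {m. keys m \<subseteq> A}" using M(1) by (auto simp: mono_set_def)
  have "multiples A ?S = M"
  proof
    show "multiples A ?S \<subseteq> M" using SM multiples_mono_set[OF M(1)] unfolding multiples_def by blast
    show "M \<subseteq> multiples A ?S"
    proof
      fix m assume m: "m \<in> M"
      let ?R = "keys m"
      have R: "?R \<subseteq> A" using m M(1) by (auto simp: mono_set_def)
      have "indicat {v. lookup m v \<noteq> 0} \<in> expos J" using m by (intro rad) (simp add: M(2) expos_ideal_of)
      moreover have "{v. lookup m v \<noteq> 0} = ?R" by (auto simp: in_keys_iff)
      ultimately have "lookup (e ?R) \<in> lookup ` M" using e[OF R] by (simp add: M(2) expos_ideal_of)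
      then have "e ?R \<in> M" by (auto simp: lookup_inj)
      moreover have "e ?R + (m - e ?R) = m" by (rule expo_diff) (auto simp: e[OF R] indicat_def in_keys_iff)
      ultimately show "m \<in> multiples A ?S"
        using R by (intro multiplesI) auto
    qed
  qed
  then show ?thesis
    unfolding stanley_reisner_ideal_def gens using gen_ideal_monomials[OF SA, where 'k = 'k] M(2) by simp
qed

section \<open>Polarizations are balls\<close>

theorem polarization_ball:
  fixes \<alpha> :: "'w \<Rightarrow> nat" and \<jj> :: "('w, 'k::field) mpoly set" and A :: "'a set" and \<pi> :: "'a \<Rightarrow> 'w"
  assumes artin: "artin_monomial_ideal I \<jj>"
    and c: "gen_ideal I ((\<lambda>i. var i ^ \<alpha> i) ` I) \<subset> \<jj>"
    and fib: "\<forall>i\<in>I. card {a \<in> A. \<pi> a = i} = \<alpha> i"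
    and pol: "polarization I \<jj> A \<pi> J"
  shows "\<exists>X. complex_on A X \<and> X \<subseteq> join_family I (\<lambda>i. boundary_simplex {a \<in> A. \<pi> a = i}) \<and>
    complex_dim X = complex_dim (join_family I (\<lambda>i. boundary_simplex {a \<in> A. \<pi> a = i})) \<and>
    simplicial_ball X \<and> J = stanley_reisner_ideal A X"
proof -
  note P = polarization_expos[OF pol]
  let ?N = "expos J"
  have A: "finite A" "\<pi> ` A \<subseteq> I" "hits \<pi> I A" using P(1) by (auto simp: ground_def)
  obtain M where M: "mono_set I M" "\<jj> = ideal_of M"
    using artin by (auto simp: artin_monomial_ideal_def monomial_ideal_iff)
  have up: "h \<in> ?N" if "g \<in> ?N" "h \<in> on A" "\<And>v. g v \<le> h v" for g h
    using upsetD[OF P(3) that] .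
  let ?S = "(\<lambda>i. single i (\<alpha> i)) ` I"
  have SI: "?S \<subseteq> {m. keys m \<subseteq> I}" by (auto split: if_splits)
  have gens: "(\<lambda>i. var i ^ \<alpha> i :: ('w, 'k) mpoly) ` I = mon ` ?S" by (auto simp: var_power)
  have cM: "multiples I ?S \<subset> M"
  proof -
    have "(ideal_of (multiples I ?S) :: ('w, 'k) mpoly set) \<subset> ideal_of M"
      using c unfolding gens gen_ideal_monomials[OF SI] M(2) .
    then show ?thesis unfolding less_le_not_le ideal_of_subset .
  qed
  have eM: "expos \<jj> = lookup ` M" by (simp add: M(2) expos_ideal_of)
  have pow: "(\<lambda>j. if j = i then card (fiber \<pi> A i) else 0) \<in> push \<pi> A ` ?N" if i: "i \<in> I" for i
  proof -
    have "single i (\<alpha> i) \<in> M" using subset_multiples[OF SI] cM i by blast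
    moreover have "lookup (single i (\<alpha> i)) = (\<lambda>j. if j = i then card (fiber \<pi> A i) else 0)"
      using fib i by (auto simp: lookup_single when_def fiber_def fun_eq_iff)
    ultimately show ?thesis using P(4) eM by (metis imageI)
  qed
  let ?U = "nonfacets \<pi> I A ?N" and ?T = "transversals \<pi> I A"
  have ext: "extremal \<pi> I A ?U" using extremal_nonfacets[OF P(1,3,6) pow P(7)] .
  have sf: "survivors \<pi> I A ?N \<subseteq> (\<lambda>a. (a, \<lambda>_. 0)) ` (?T - ?U)" using survivors_facets[OF P(1,3,6) pow P(7)] .
  have U: "?U = {a \<in> ?T. indicat (A - a) \<in> ?N}" using nonfacets_def[OF P(1,3,6) pow P(7)] .
  let ?F = "?T - ?U"
  \<comment> \<open>Purity yields a transversal at which the squarefree monomial of \<open>F\<close>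
    survives; by \<open>survivors_facets\<close> it is the complement of a facet and the monomial
    has exponent 0 on it, so \<open>F\<close> avoids it.\<close>
  have X: "{F. F \<subseteq> A \<and> indicat F \<notin> ?N} = co_complex A ?F"
  proof (intro equalityI subsetI)
    fix F assume F: "F \<in> {F. F \<subseteq> A \<and> indicat F \<notin> ?N}"
    then have "indicat F \<in> on A - ?N" by (auto simp: indicat_def on_def)
    then obtain a where a: "a \<in> ?T" "free_on A ?N a (indicat F)" using P(5) unfolding pure_def by blast
    have "(a, \<lambda>v. if v \<in> a then indicat F v else 0) \<in> survivors \<pi> I A ?N"
      using a by (auto simp: survivors_def on_def free_on_def)
    then have "(a, \<lambda>v. if v \<in> a then indicat F v else 0) \<in> (\<lambda>a. (a, \<lambda>_. 0)) ` ?F" using sf by blast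
    then have aF: "a \<in> ?F" and z: "(\<lambda>v. if v \<in> a then indicat F v else 0) = (\<lambda>_. 0)" by auto
    have "v \<notin> F" if "v \<in> a" for v using fun_cong[OF z, of v] that by (simp add: indicat_def split: if_splits)
    then have "F \<inter> a = {}" by blast
    then show "F \<in> co_complex A ?F" using aF F by (auto simp: co_complex_def)
  next
    fix F assume "F \<in> co_complex A ?F"
    then obtain a where a: "F \<subseteq> A" "a \<in> ?T" "a \<notin> ?U" "F \<inter> a = {}" by (auto simp: co_complex_def)
    have "indicat F \<notin> ?N"
    proof
      assume "indicat F \<in> ?N"
      then have "indicat (A - a) \<in> ?N"
        by (rule up) (use a in \<open>auto simp: indicat_def on_def\<close>)
      then show False using a U by blast
    qed
    then show "F \<in> {F. F \<subseteq> A \<and> indicat F \<notin> ?N}" using a by blast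
  qed
  have zero: "(\<lambda>_. 0) \<notin> ?N"
  proof
    assume "(\<lambda>_. 0) \<in> ?N"
    then have "push \<pi> A (\<lambda>_. 0) \<in> expos \<jj>" using P(4) by blast
    moreover have "push \<pi> A (\<lambda>_. 0) = lookup 0" by (auto simp: push_def)
    ultimately have "0 \<in> M" by (auto simp: eM lookup_inj)
    then have "m \<in> M" if "keys m \<subseteq> I" for m using M(1) that unfolding mono_set_def by (metis add_0)
    then have "\<jj> = carrier (poly_ring I)"
      using M vars_ideal_of[OF M(1)] by (auto simp: ideal_of_def mem_poly_ring)
    then show False using artin by (simp add: artin_monomial_ideal_def)
  qed
  \<comment> \<open>Properness of the ideal makes the empty set a face, so there is a facet.\<close>
  have Fne: "?F \<noteq> {}"
  proof -
    have "indicat {} \<notin> ?N" using zero by (simp add: indicat_def)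
    then have "{} \<in> co_complex A ?F" using X by blast
    then show ?thesis by (auto simp: co_complex_def)
  qed
  \<comment> \<open>Here the strict inclusion enters: a monomial of \<open>\<jj>\<close> outside the
    ideal of the powers has exponent below \<open>\<alpha> i\<close> at every \<open>i\<close>, so
    the support of its lift leaves a point of each fiber free.\<close>
  have Une: "?U \<noteq> {}"
  proof -
    obtain m where m: "m \<in> M" "m \<notin> multiples I ?S" using cM by blast
    have lt: "lookup m i < \<alpha> i" if i: "i \<in> I" for i
    proof (rule ccontr)
      assume "\<not> lookup m i < \<alpha> i"
      then have "single i (\<alpha> i) + (m - single i (\<alpha> i)) = m" by (intro expo_diff) (auto simp: lookup_single when_def)
      moreover have "keys m \<subseteq> I" using m M(1) by (auto simp: mono_set_def)
      ultimately have "m \<in> multiples I ?S" using i by (intro multiplesI) auto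
      then show False using m by simp
    qed
    obtain h where h: "h \<in> ?N" "lookup m = push \<pi> A h" using m(1) P(4) eM by blast
    let ?R = "{v. h v \<noteq> 0}"
    have hA: "h \<in> on A" using h(1) P(3) by (auto simp: upset_def)
    have "hits \<pi> I (A - ?R)"
    proof (rule hitsI, rule ccontr)
      fix i assume i: "i \<in> I" and no: "\<not> (\<exists>x. x \<in> A - ?R \<and> \<pi> x = i)"
      have "card {a \<in> A. \<pi> a = i} = (\<Sum>v | v \<in> A \<and> \<pi> v = i. 1)" by simp
      also have "\<dots> \<le> (\<Sum>v | v \<in> A \<and> \<pi> v = i. h v)" using no by (intro sum_mono) (auto simp: Suc_le_eq)
      also have "\<dots> = lookup m i" using fun_cong[OF h(2), of i] by (simp add: push_def)
      finally show False using lt[OF i] fib i by simp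
    qed
    then obtain a where a: "a \<in> transversals \<pi> I (A - ?R)" by (rule exists_transversal)
    have "indicat (A - a) \<in> ?N"
    proof (rule up[OF P(6)[OF h(1)]])
      show "indicat (A - a) \<in> on A" by (auto simp: indicat_def on_def)
      show "indicat ?R v \<le> indicat (A - a) v" for v
        using hA transversals_subset[OF a] by (auto simp: indicat_def on_def)
    qed
    moreover have "a \<in> ?T" using a transversals_mono[of "A - ?R" A] by blast
    ultimately show ?thesis using U by blast
  qed
  have UT: "?U \<subseteq> ?T" using U by blast
  have "?U \<noteq> ?T" using Fne UT by blast
  then obtain e where e: "card A - card I = Suc e" "hemispheres e (body A ?U) (body A ?F)"
    using extremal_hemispheres[OF P(1)] ext Une by blast
  have dim: "complex_dim (co_complex A ?F) = int e"
    using co_complex_dim[OF P(1) Diff_subset Fne] e(1) by simp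
  have "disc e (body A ?F) (body A ?U \<inter> body A ?F)" using e(2) by (simp add: hemispheres_def)
  then have ball: "simplicial_ball (co_complex A ?F)"
    unfolding simplicial_ball_def geom_realization_co_complex[OF A(1) Diff_subset]
    using disc_ball dim by blast
  have Tne: "?T \<noteq> {}" using Fne by blast
  show ?thesis
  proof (intro exI[of _ "co_complex A ?F"] conjI)
    show "complex_on A (co_complex A ?F)"
      unfolding complex_on_def using A(1) Fne by (auto simp: co_complex_def)
    show "co_complex A ?F \<subseteq> join_family I (\<lambda>i. boundary_simplex {a \<in> A. \<pi> a = i})"
      unfolding join_boundary_simplices[OF P(1)] by (auto simp: co_complex_def)
    show "complex_dim (co_complex A ?F) = complex_dim (join_family I (\<lambda>i. boundary_simplex {a \<in> A. \<pi> a = i}))"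
      unfolding join_boundary_simplices[OF P(1)]
      using co_complex_dim[OF P(1) Diff_subset Fne] co_complex_dim[OF P(1) subset_refl Tne] by simp
    show "J = stanley_reisner_ideal A (co_complex A ?F)"
      using stanley_reisner_expos[OF A(1) P(2,6)] X by simp
  qed (rule ball)
qed

section \<open>Renaming variables\<close>

lemma expo_map_add: "expo_map p (a + b) = expo_map p a + expo_map p (b :: 'v expo)"
proof (rule poly_mapping_eqI)
  fix z
  let ?V = "keys a \<union> keys b"
  have 1: "finite ?V" "keys a \<subseteq> ?V" "keys b \<subseteq> ?V" "keys (a + b) \<subseteq> ?V" by (auto simp: keys_add_nat)
  show "lookup (expo_map p (a + b)) z = lookup (expo_map p a + expo_map p b) z"
    unfolding lookup_add lookup_expo_map[OF 1(1,2)] lookup_expo_map[OF 1(1,3)] lookup_expo_map[OF 1(1,4)]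
    by (simp add: push_def lookup_add sum.distrib)
qed

lemma var_map_superset:
  assumes "finite X" "keys f \<subseteq> X"
  shows "var_map p (f :: ('v, 'k::field) mpoly) = (\<Sum>m\<in>X. single (expo_map p m) (lookup f m))"
  unfolding var_map_def using assms by (intro sum.mono_neutral_left) (auto simp: in_keys_iff)

lemma var_map_add: "var_map p (f + g) = var_map p f + var_map p (g :: ('v, 'k::field) mpoly)"
proof -
  let ?X = "keys f \<union> keys g"
  have "keys (f + g) \<subseteq> ?X" by (rule keys_add)
  then show ?thesis
    using var_map_superset[of ?X "f + g" p] var_map_superset[of ?X f p] var_map_superset[of ?X g p]
    by (simp add: lookup_add single_add sum.distrib)
qed

lemma var_map_single: "var_map p (single m c :: ('v, 'k::field) mpoly) = single (expo_map p m) c"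
  using var_map_superset[of "{m}" "single m c" p] by simp

lemma var_map_0: "var_map p (0 :: ('v, 'k::field) mpoly) = 0"
  by (simp add: var_map_def)

lemma var_map_sum: "var_map p (\<Sum>i\<in>X. f i :: ('v, 'k::field) mpoly) = (\<Sum>i\<in>X. var_map p (f i))"
  by (induction X rule: infinite_finite_induct) (simp_all add: var_map_0 var_map_add)

lemma var_map_uminus: "var_map p (- f) = - var_map p (f :: ('v, 'k::field) mpoly)"
  using var_map_add[of p f "- f"] by (simp add: var_map_0 eq_neg_iff_add_eq_0 add.commute)

lemma var_map_diff: "var_map p (f - g) = var_map p f - var_map p (g :: ('v, 'k::field) mpoly)"
  using var_map_add[of p f "- g"] by (simp add: var_map_uminus)

lemma var_map_mult: "var_map p (f * g) = var_map p f * var_map p (g :: ('v, 'k::field) mpoly)"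
proof -
  have "f * g = (\<Sum>a\<in>keys f. \<Sum>b\<in>keys g. single (a + b) (lookup f a * lookup g b))"
    by (subst (1) poly_sum_monomials[of f], subst (1) poly_sum_monomials[of g]) (simp add: sum_product mult_single)
  then have "var_map p (f * g) = (\<Sum>a\<in>keys f. \<Sum>b\<in>keys g. single (expo_map p a + expo_map p b) (lookup f a * lookup g b))"
    by (simp add: var_map_sum var_map_single expo_map_add)
  also have "\<dots> = var_map p f * var_map p g"
    unfolding var_map_def by (simp add: sum_product mult_single)
  finally show ?thesis .
qed

lemma expo_map_comp:
  assumes "\<And>v. v \<in> keys m \<Longrightarrow> p (q v) = r v"
  shows "expo_map p (expo_map q m) = expo_map r m"
proof (rule poly_mapping_eqI)
  fix z
  have 1: "keys (expo_map q m) \<subseteq> q ` keys m"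
    using keys_sum[of "\<lambda>v. single (q v) (lookup m v)" "keys m"] by (auto simp: expo_map_def split: if_splits)
  have "lookup (expo_map p (expo_map q m)) = push p (q ` keys m) (push q (keys m) (lookup m))"
    using lookup_expo_map[OF _ 1, of p] lookup_expo_map[of "keys m" m q] by simp
  also have "\<dots> = push (p \<circ> q) (keys m) (lookup m)" by (rule push_push) auto
  also have "\<dots> = push r (keys m) (lookup m)" using assms by (intro push_cong) auto
  also have "\<dots> = lookup (expo_map r m)" using lookup_expo_map[of "keys m" m r] by simp
  finally show "lookup (expo_map p (expo_map q m)) z = lookup (expo_map r m) z" by simp
qed

lemma var_map_comp:
  assumes f: "f \<in> carrier (poly_ring V :: ('v, 'k::field) mpoly ring)" and eq: "\<And>v. v \<in> V \<Longrightarrow> p (q v) = r v"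
  shows "var_map p (var_map q f) = var_map r f"
proof -
  have "expo_map p (expo_map q m) = expo_map r m" if "m \<in> keys f" for m
    using f eq that by (intro expo_map_comp) (auto simp: mem_poly_ring)
  then show ?thesis
    unfolding var_map_def[of q] var_map_def[of r] var_map_sum var_map_single by (intro sum.cong) auto
qed

lemma expo_map_id: "(\<And>v. v \<in> keys m \<Longrightarrow> p v = v) \<Longrightarrow> expo_map p m = m"
proof -
  assume eq: "\<And>v. v \<in> keys m \<Longrightarrow> p v = v"
  have "expo_map p m = (\<Sum>v\<in>keys m. single v (lookup m v))"
    unfolding expo_map_def using eq by (intro sum.cong) auto
  also have "\<dots> = m" by (rule poly_mapping_eqI) (simp add: lookup_sum lookup_single when_def in_keys_iff)
  finally show ?thesis .
qed

lemma var_map_id: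
  assumes f: "f \<in> carrier (poly_ring V :: ('v, 'k::field) mpoly ring)" and eq: "\<And>v. v \<in> V \<Longrightarrow> p v = v"
  shows "var_map p f = f"
proof -
  have "expo_map p m = m" if "m \<in> keys f" for m
    using f eq that by (intro expo_map_id) (auto simp: mem_poly_ring)
  then have "var_map p f = (\<Sum>m\<in>keys f. single m (lookup f m))"
    unfolding var_map_def by (intro sum.cong) auto
  then show ?thesis using poly_sum_monomials[of f] by simp
qed

lemma keys_expo_map: "keys (expo_map p m) = p ` keys (m :: 'v expo)"
proof -
  have l: "lookup (expo_map p m) z = (\<Sum>v | v \<in> keys m \<and> p v = z. lookup m v)" for z
    using fun_cong[OF lookup_expo_map[of "keys m" m p], of z] by (simp add: push_def)
  show ?thesis
  proof (rule Set.set_eqI)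
    fix z
    have "(\<Sum>v | v \<in> keys m \<and> p v = z. lookup m v) = 0 \<longleftrightarrow> (\<forall>v\<in>{v \<in> keys m. p v = z}. lookup m v = 0)" by (rule sum_eq_0_iff) simp
    then show "z \<in> keys (expo_map p m) \<longleftrightarrow> z \<in> p ` keys m" by (auto simp: in_keys_iff l)
  qed
qed

context
  fixes \<phi> :: "'v \<Rightarrow> 'w" and V :: "'v set"
  assumes \<phi>: "inj_on \<phi> V" and V: "finite V"
begin

private abbreviation "\<theta> \<equiv> inv_into V \<phi>"

lemma expo_map_back: "keys m \<subseteq> V \<Longrightarrow> expo_map \<theta> (expo_map \<phi> m) = m"
  using expo_map_comp[of m \<theta> \<phi> id] expo_map_id[of m id] \<phi> by (simp add: subset_iff)

lemma expo_map_forth: "keys m \<subseteq> \<phi> ` V \<Longrightarrow> expo_map \<phi> (expo_map \<theta> m) = m"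
  using expo_map_comp[of m \<phi> \<theta> id] expo_map_id[of m id] by (simp add: f_inv_into_f subset_iff)

lemma var_map_back: "f \<in> carrier (poly_ring V :: ('v, 'k::field) mpoly ring) \<Longrightarrow> var_map \<theta> (var_map \<phi> f) = f"
  using var_map_comp[of f V \<theta> \<phi> id] var_map_id[of f V id] \<phi> by simp

lemma var_map_forth: "f \<in> carrier (poly_ring (\<phi> ` V) :: ('w, 'k::field) mpoly ring) \<Longrightarrow> var_map \<phi> (var_map \<theta> f) = f"
  using var_map_comp[of f "\<phi> ` V" \<phi> \<theta> id] var_map_id[of f "\<phi> ` V" id] by (simp add: f_inv_into_f)

lemma keys_back: "keys m \<subseteq> \<phi> ` V \<Longrightarrow> keys (expo_map \<theta> m) \<subseteq> V"
  unfolding keys_expo_map by (auto intro: inv_into_into)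

lemma mono_set_image: "mono_set V M \<Longrightarrow> mono_set (\<phi> ` V) (expo_map \<phi> ` M)"
proof -
  assume M: "mono_set V M"
  have "expo_map \<phi> m + t \<in> expo_map \<phi> ` M" if m: "m \<in> M" and t: "keys t \<subseteq> \<phi> ` V" for m t
  proof -
    have "m + expo_map \<theta> t \<in> M" using M m keys_back[OF t] by (simp add: mono_set_def)
    then have "expo_map \<phi> (m + expo_map \<theta> t) \<in> expo_map \<phi> ` M" by (rule imageI)
    then show ?thesis by (simp add: expo_map_add expo_map_forth[OF t])
  qed
  moreover have "keys (expo_map \<phi> m) \<subseteq> \<phi> ` V" if "m \<in> M" for m
    using M that unfolding keys_expo_map mono_set_def by blast
  ultimately show ?thesis unfolding mono_set_def by blast
qed

lemma var_map_ideal_of: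
  assumes M: "mono_set V M"
  shows "var_map \<phi> ` (ideal_of M :: ('v, 'k::field) mpoly set) = ideal_of (expo_map \<phi> ` M)"
proof
  show "var_map \<phi> ` (ideal_of M :: ('v, 'k) mpoly set) \<subseteq> ideal_of (expo_map \<phi> ` M)"
  proof (rule image_subsetI)
    fix f :: "('v, 'k) mpoly" assume "f \<in> ideal_of M"
    then have "expo_map \<phi> ` keys f \<subseteq> expo_map \<phi> ` M" by (auto simp: ideal_of_def)
    then show "var_map \<phi> f \<in> ideal_of (expo_map \<phi> ` M)" using keys_var_map[of \<phi> f] by (simp add: ideal_of_def)
  qed
  show "ideal_of (expo_map \<phi> ` M) \<subseteq> var_map \<phi> ` (ideal_of M :: ('v, 'k) mpoly set)"
  proof
    fix f :: "('w, 'k) mpoly" assume f: "f \<in> ideal_of (expo_map \<phi> ` M)"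
    have "f \<in> carrier (poly_ring (\<phi> ` V))" by (rule subsetD[OF vars_ideal_of[OF mono_set_image[OF M]] f])
    then have "f = var_map \<phi> (var_map \<theta> f)" by (rule var_map_forth[symmetric])
    moreover have "keys (var_map \<theta> f) \<subseteq> M"
    proof
      fix m assume "m \<in> keys (var_map \<theta> f)"
      then obtain m' where "m = expo_map \<theta> m'" "m' \<in> keys f" using keys_var_map[of \<theta> f] by auto
      then obtain m'' where "m = expo_map \<theta> (expo_map \<phi> m'')" "m'' \<in> M" using f by (auto simp: ideal_of_def)
      moreover from this have "keys m'' \<subseteq> V" using M by (auto simp: mono_set_def)
      ultimately show "m \<in> M" using expo_map_back by simp
    qed
    ultimately show "f \<in> var_map \<phi> ` ideal_of M" by (auto simp: ideal_of_def)
  qed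
qed

lemma expo_map_multiples:
  assumes S: "S \<subseteq> {m. keys m \<subseteq> V}"
  shows "expo_map \<phi> ` multiples V S = multiples (\<phi> ` V) (expo_map \<phi> ` S)"
proof (intro equalityI subsetI)
  fix m assume "m \<in> expo_map \<phi> ` multiples V S"
  then obtain s t where st: "m = expo_map \<phi> (s + t)" "s \<in> S" "keys (s + t) \<subseteq> V" by (auto simp: multiples_def)
  show "m \<in> multiples (\<phi> ` V) (expo_map \<phi> ` S)"
    by (rule multiplesI[of "expo_map \<phi> s" _ "expo_map \<phi> t"]) (use st in \<open>auto simp: expo_map_add[symmetric] keys_expo_map\<close>)
next
  fix m assume "m \<in> multiples (\<phi> ` V) (expo_map \<phi> ` S)"
  then obtain s t where st: "m = expo_map \<phi> s + t" "s \<in> S" "keys m \<subseteq> \<phi> ` V" by (auto simp: multiples_def)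
  then have t: "keys t \<subseteq> \<phi> ` V" by (simp add: keys_add_nat)
  have "m = expo_map \<phi> (s + expo_map \<theta> t)" using st(1) by (simp add: expo_map_add expo_map_forth[OF t])
  moreover have "keys (s + expo_map \<theta> t) \<subseteq> V" using st(2) S keys_back[OF t] by (auto simp: keys_add_nat)
  then have "s + expo_map \<theta> t \<in> multiples V S" using st(2) by (intro multiplesI) auto
  ultimately show "m \<in> expo_map \<phi> ` multiples V S" by blast
qed

lemma monomial_ideal_image:
  assumes "monomial_ideal V (J :: ('v, 'k::field) mpoly set)" shows "monomial_ideal (\<phi> ` V) (var_map \<phi> ` J)"
proof -
  obtain M where M: "mono_set V M" "J = ideal_of M" using assms by (auto simp: monomial_ideal_iff)
  then show ?thesis using mono_set_image[OF M(1)] var_map_ideal_of[OF M(1)] unfolding monomial_ideal_iff by blast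
qed

lemma expo_map_dvd_iff:
  assumes "keys a \<subseteq> V" "keys b \<subseteq> V" "expo_dvd (expo_map \<phi> a) (expo_map \<phi> b)"
  shows "expo_dvd a b"
proof -
  have "lookup (expo_map \<phi> c) (\<phi> v) = lookup c v" if "keys c \<subseteq> V" "v \<in> V" for c v
  proof -
    have "{u \<in> V. \<phi> u = \<phi> v} = {v}" using \<phi> that(2) by (auto dest: inj_onD)
    then show ?thesis using lookup_expo_map[OF V that(1), of \<phi>] by (simp add: push_single)
  qed
  then have "lookup a v \<le> lookup b v" if "v \<in> V" for v
    using assms that unfolding expo_dvd_def by metis
  moreover have "lookup a v = 0" if "v \<notin> V" for v using assms(1) that by (auto simp: in_keys_iff)
  ultimately show ?thesis unfolding expo_dvd_def by (metis zero_le)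
qed

lemma min_gens_image:
  assumes J: "monomial_ideal V (J :: ('v, 'k::field) mpoly set)" and m: "m \<in> min_gens J"
  shows "expo_map \<phi> m \<in> min_gens (var_map \<phi> ` J)"
proof -
  obtain M where M: "mono_set V M" "J = ideal_of M" using J by (auto simp: monomial_ideal_iff)
  have im: "var_map \<phi> ` J = ideal_of (expo_map \<phi> ` M)" using var_map_ideal_of[OF M(1), where 'k = 'k] M(2) by simp
  have mM: "m \<in> M" and min: "\<And>m'. m' \<in> M \<Longrightarrow> expo_dvd m' m \<Longrightarrow> m' = m" using m M(2) by (auto simp: min_gens_def)
  have "m' = expo_map \<phi> m" if m': "m' \<in> expo_map \<phi> ` M" "expo_dvd m' (expo_map \<phi> m)" for m'
  proof -
    obtain m'' where "m' = expo_map \<phi> m''" "m'' \<in> M" using m'(1) by auto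
    moreover from this have "expo_dvd m'' m"
      using m'(2) mM M(1) by (intro expo_map_dvd_iff) (auto simp: mono_set_def)
    ultimately show ?thesis using min by blast
  qed
  then show ?thesis unfolding im min_gens_def using mM by auto
qed

end

text \<open>The non-zero-divisor condition is transported by pulling a polynomial back along the
  inverse of \<open>\<phi>\<close>; multiplicativity of \<open>var_map\<close> makes this compatible
  with multiplying by the difference of the two variables.\<close>

lemma simple_separation_rename:
  assumes s: "simple_separation V1 J1 V2 q (J2 :: ('v, 'k::field) mpoly set)"
    and \<psi>: "inj_on \<psi> V1" and \<phi>: "inj_on \<phi> V2" and q': "\<And>v. v \<in> V2 \<Longrightarrow> q' (\<phi> v) = \<psi> (q v)"
  shows "simple_separation (\<psi> ` V1) (var_map \<psi> ` J1) (\<phi> ` V2) q' (var_map \<phi> ` J2)"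
proof -
  have f: "finite V1" "finite V2" "q ` V2 = V1" "card V2 = card V1 + 1"
    "monomial_ideal V1 J1" "monomial_ideal V2 J2" "J1 = var_map q ` J2"
    using s by (auto simp: simple_separation_def)
  obtain x y m m' where xy: "x \<in> V2" "y \<in> V2" "x \<noteq> y" "q x = q y"
      "m \<in> min_gens J2" "x \<in> keys m" "m' \<in> min_gens J2" "y \<in> keys m'"
      "non_zero_divisor (poly_ring V2 Quot J2) (J2 +>\<^bsub>poly_ring V2\<^esub> (var x - var y))"
    using s unfolding simple_separation_def by blast
  obtain M where M: "mono_set V2 M" "J2 = ideal_of M" using f(6) by (auto simp: monomial_ideal_iff)
  have J2c: "J2 \<subseteq> carrier (poly_ring V2)" using vars_ideal_of[OF M(1)] M(2) by blast
  have "q' ` \<phi> ` V2 = \<psi> ` V1" using q' f(3) by (auto simp: image_image)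
  moreover have "card (\<phi> ` V2) = card (\<psi> ` V1) + 1" using f(4) card_image[OF \<phi>] card_image[OF \<psi>] by simp
  moreover have "var_map \<psi> ` J1 = var_map q' ` var_map \<phi> ` J2"
  proof -
    have "var_map \<psi> (var_map q f) = var_map q' (var_map \<phi> f)" if "f \<in> J2" for f
    proof -
      have fc: "f \<in> carrier (poly_ring V2)" using that J2c by blast
      have "var_map q' (var_map \<phi> f) = var_map (\<psi> \<circ> q) f" by (rule var_map_comp[OF fc]) (simp add: q')
      moreover have "var_map \<psi> (var_map q f) = var_map (\<psi> \<circ> q) f" by (rule var_map_comp[OF fc]) simp
      ultimately show ?thesis by simp
    qed
    then show ?thesis unfolding f(7) image_image by (intro image_cong) auto
  qed
  moreover have "\<phi> x \<in> \<phi> ` V2" "\<phi> y \<in> \<phi> ` V2" "\<phi> x \<noteq> \<phi> y" "q' (\<phi> x) = q' (\<phi> y)"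
    using xy q' \<phi> by (auto dest: inj_onD)
  moreover have "expo_map \<phi> m \<in> min_gens (var_map \<phi> ` J2)" "\<phi> x \<in> keys (expo_map \<phi> m)"
    "expo_map \<phi> m' \<in> min_gens (var_map \<phi> ` J2)" "\<phi> y \<in> keys (expo_map \<phi> m')"
    using min_gens_image[OF \<phi> f(2,6)] xy by (auto simp: keys_expo_map)
  moreover have "non_zero_divisor (poly_ring (\<phi> ` V2) Quot var_map \<phi> ` J2)
      (var_map \<phi> ` J2 +>\<^bsub>poly_ring (\<phi> ` V2)\<^esub> (var (\<phi> x) - var (\<phi> y)))"
  proof -
    let ?\<theta> = "inv_into V2 \<phi>"
    have nz: "f \<in> J2" if "f \<in> carrier (poly_ring V2)" "(var x - var y) * f \<in> J2" for f
      using iffD1[OF non_zero_divisor_quot[OF ideal_ideal_of[OF M(1)] var_diff_in_ring[OF xy(1,2)]] xy(9)[unfolded M(2)]]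
        that unfolding poly_ring_simps M(2) by blast
    have im: "var_map \<phi> ` J2 = ideal_of (expo_map \<phi> ` M)" using var_map_ideal_of[OF \<phi> f(2) M(1), where 'k = 'k] M(2) by simp
    have ideal: "ideal (var_map \<phi> ` J2) (poly_ring (\<phi> ` V2))"
      unfolding im by (rule ideal_ideal_of[OF mono_set_image[OF \<phi> f(2) M(1)]])
    have "f \<in> var_map \<phi> ` J2"
      if f': "f \<in> carrier (poly_ring (\<phi> ` V2))" "(var (\<phi> x) - var (\<phi> y)) * f \<in> var_map \<phi> ` J2" for f
    proof -
      define f0 where "f0 = var_map ?\<theta> f"
      have ff0: "var_map \<phi> f0 = f" unfolding f0_def by (rule var_map_forth[OF \<phi> f(2) f'(1)])
      have f0c: "f0 \<in> carrier (poly_ring V2)"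
      proof -
        have "keys f0 \<subseteq> expo_map ?\<theta> ` keys f" unfolding f0_def by (rule keys_var_map)
        then show ?thesis using f'(1) keys_back[OF \<phi> f(2)] unfolding mem_poly_ring by blast
      qed
      have "(var (\<phi> x) - var (\<phi> y)) * f = var_map \<phi> ((var x - var y) * f0)"
        unfolding var_map_mult var_map_diff var_map_var ff0 ..
      then obtain h where h: "h \<in> J2" "var_map \<phi> ((var x - var y) * f0) = var_map \<phi> h" using f'(2) by auto
      have "(var x - var y) * f0 \<in> carrier (poly_ring V2)"
      proof -
        interpret R: ring "poly_ring V2 :: ('v, 'k) mpoly ring" by (rule ring_poly_ring)
        show ?thesis using R.m_closed[OF var_diff_in_ring[OF xy(1,2)] f0c] by simp
      qed
      then have "(var x - var y) * f0 = h"
        using var_map_back[OF \<phi> f(2)] h J2c by (metis subsetD)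
      then have "f0 \<in> J2" using nz[OF f0c] h(1) by simp
      then show ?thesis using ff0 by blast
    qed
    then show ?thesis
      unfolding non_zero_divisor_quot[OF ideal var_diff_in_ring[OF imageI[OF xy(1)] imageI[OF xy(2)]]]
      by simp
  qed
  ultimately show ?thesis
    unfolding simple_separation_def
    using f(1,2) monomial_ideal_image[OF \<psi> f(1,5)] monomial_ideal_image[OF \<phi> f(2,6)] by blast
qed

text \<open>The intermediate variable sets are embedded into the new one along sections of the surjections.\<close>

lemma proper_separation_rename:
  fixes J' :: "('v, 'k::field) mpoly set" and \<phi> :: "'v \<Rightarrow> 'a"
  assumes "proper_separation V J V' p J'" "inj_on \<phi> V'" "\<And>v. v \<in> V' \<Longrightarrow> r (\<phi> v) = p v"
  shows "proper_separation V J (\<phi> ` V') r (var_map \<phi> ` J')"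
  using assms
proof (induction arbitrary: \<phi> r rule: proper_separation.induct)
  case (rename p V' J')
  have fin: "finite V'" using rename(1,3) bij_betw_finite by blast
  obtain M where M: "mono_set V' M" "J' = ideal_of M" using rename(4) by (auto simp: monomial_ideal_iff)
  have c: "J' \<subseteq> carrier (poly_ring V')" using vars_ideal_of[OF M(1)] M(2) by blast
  show ?case
  proof (rule proper_separation.rename[OF rename(1,2)])
    have "inj_on r (\<phi> ` V')" using rename(3,7) by (auto simp: bij_betw_def inj_on_def)
    moreover have "r ` \<phi> ` V' = V" using rename(3,7) by (auto simp: bij_betw_def image_image)
    ultimately show "bij_betw r (\<phi> ` V') V" by (simp add: bij_betw_def)
    show "monomial_ideal (\<phi> ` V') (var_map \<phi> ` J')" by (rule monomial_ideal_image[OF rename(6) fin rename(4)])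
    have "var_map r (var_map \<phi> f) = var_map p f" if "f \<in> J'" for f
      using var_map_comp[of f V' r \<phi> p] that c rename(7) by blast
    then show "J = var_map r ` var_map \<phi> ` J'" unfolding rename(5) image_image by (intro image_cong) auto
  qed
next
  case (step V1 p J1 V2 q J2 s)
  define \<psi> where "\<psi> = \<phi> \<circ> inv_into V2 q"
  have q: "q ` V2 = V1" using step(2) by (simp add: simple_separation_def)
  have "inj_on (inv_into V2 q) V1" using q by (simp add: inj_on_inv_into)
  moreover have "inv_into V2 q ` V1 \<subseteq> V2" using q by (auto intro: inv_into_into)
  ultimately have \<psi>: "inj_on \<psi> V1" unfolding \<psi>_def using step.prems(1) by (intro comp_inj_on) (auto intro: inj_on_subset)
  define r1 where "r1 = p \<circ> inv_into V1 \<psi>"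
  define q' where "q' = \<psi> \<circ> q \<circ> inv_into V2 \<phi>"
  have 1: "proper_separation V J (\<psi> ` V1) r1 (var_map \<psi> ` J1)"
    by (rule step.IH[OF \<psi>]) (simp add: r1_def \<psi>)
  have 2: "simple_separation (\<psi> ` V1) (var_map \<psi> ` J1) (\<phi> ` V2) q' (var_map \<phi> ` J2)"
    by (rule simple_separation_rename[OF step(2) \<psi> step.prems(1)]) (simp add: q'_def step.prems(1))
  have "\<forall>v\<in>\<phi> ` V2. r v = r1 (q' v)"
  proof clarify
    fix v assume v: "v \<in> V2"
    have "q v \<in> V1" using q v by auto
    then show "r (\<phi> v) = r1 (q' (\<phi> v))"
      using v step(3) step.prems \<psi> by (simp add: r1_def q'_def)
  qed
  then show ?case using proper_separation.step[OF 1 2] by blast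
qed

section \<open>The number of variables of a proper polarization\<close>

definition occurs :: "'v set \<Rightarrow> ('v, 'k::field) mpoly set \<Rightarrow> bool"
  where "occurs V J \<longleftrightarrow> (\<forall>v\<in>V. \<exists>m\<in>min_gens J. v \<in> keys m)"

text \<open>A divisor of the lift inside the ideal maps to the same monomial by minimality.
  Identifying variables keeps the degree in each fiber, so the divisor is the lift itself.\<close>

lemma min_gens_lift:
  assumes V: "finite V'" and J': "monomial_ideal V' (J' :: ('v, 'k::field) mpoly set)"
    and m: "m \<in> min_gens (var_map p ` J')"
  obtains m' where "m' \<in> min_gens J'" "expo_map p m' = m"
proof -
  obtain M where M: "mono_set V' M" "J' = ideal_of M" using J' by (auto simp: monomial_ideal_iff)
  have e: "expos (var_map p ` J') = push p V' ` expos J'" by (rule expos_var_map[OF V J'])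
  have in_M: "mon (expo_map p m') \<in> var_map p ` J'" if "m' \<in> M" for m'
    using var_map_mon[of p m', where 'k = 'k] that M(2) by (metis imageI mon_in_ideal_of)
  have "lookup m \<in> push p V' ` expos J'" using m e mem_expos[of m "var_map p ` J'"] by (simp add: min_gens_def)
  then obtain m' where m': "lookup m = push p V' (lookup m')" "m' \<in> M" by (auto simp: M(2) expos_ideal_of)
  have mV: "keys m' \<subseteq> V'" using m'(2) M(1) by (auto simp: mono_set_def)
  have pm: "expo_map p m' = m" using lookup_expo_map[OF V mV, of p] m'(1) by (simp add: lookup_inj[symmetric])
  have "m'' = m'" if m'': "m'' \<in> M" "expo_dvd m'' m'" for m''
  proof -
    have V'': "keys m'' \<subseteq> V'" using m''(1) M(1) by (auto simp: mono_set_def)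
    have le: "lookup m'' v \<le> lookup m' v" for v using m''(2) by (simp add: expo_dvd_def)
    have "expo_dvd (expo_map p m'') m"
      unfolding expo_dvd_def pm[symmetric] lookup_expo_map[OF V mV] lookup_expo_map[OF V V''] push_def
      using le by (auto intro: sum_mono)
    then have "expo_map p m'' = m" using m in_M[OF m''(1)] by (auto simp: min_gens_def)
    then have eq: "push p V' (lookup m'') = push p V' (lookup m')"
      using lookup_expo_map[OF V V'', of p] m'(1) by simp
    have "lookup m'' v = lookup m' v" for v
    proof (cases "v \<in> V'")
      case True
      have "(\<Sum>u | u \<in> V' \<and> p u = p v. lookup m'' u) = (\<Sum>u | u \<in> V' \<and> p u = p v. lookup m' u)"
        using fun_cong[OF eq, of "p v"] by (simp add: push_def)
      then show ?thesis
        using sum_mono_inv[of "lookup m''" "{u \<in> V'. p u = p v}" "lookup m'" v] le True V by simp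
    next
      case False
      then have "v \<notin> keys m''" "v \<notin> keys m'" using V'' mV by blast+
      then show ?thesis by (simp add: in_keys_iff)
    qed
    then show ?thesis by (intro poly_mapping_eqI)
  qed
  then have "m' \<in> min_gens J'" using m'(2) M(2) by (auto simp: min_gens_def)
  then show thesis using pm that by blast
qed

lemma occurs_lift:
  assumes V: "finite V'" and J': "monomial_ideal V' (J' :: ('v, 'k::field) mpoly set)"
    and z: "m \<in> min_gens (var_map p ` J')" "p v \<in> keys m" and v: "\<And>u. u \<in> V' \<Longrightarrow> p u = p v \<Longrightarrow> u = v"
  shows "\<exists>m\<in>min_gens J'. v \<in> keys m"
proof -
  obtain m' where m': "m' \<in> min_gens J'" "expo_map p m' = m" using min_gens_lift[OF V J' z(1)] .
  obtain M where M: "mono_set V' M" "J' = ideal_of M" using J' by (auto simp: monomial_ideal_iff)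
  have "keys m' \<subseteq> V'" using m'(1) M by (auto simp: min_gens_def mono_set_def)
  moreover have "p v \<in> p ` keys m'" using z(2) m'(2) keys_expo_map[of p m'] by simp
  ultimately have "v \<in> keys m'" using v by auto
  then show ?thesis using m'(1) by blast
qed

text \<open>The two variables that are split occur by the definition of a simple separation. Any
  other variable is alone in its fiber, so a minimal generator containing its image lifts to one
  that contains it.\<close>

lemma proper_separation_occurs:
  assumes "proper_separation V J V' p (J' :: ('v, 'k::field) mpoly set)" "occurs V J"
  shows "occurs V' J'"
  using assms
proof (induction rule: proper_separation.induct)
  case (rename p V' J')
  have fin: "finite V'" using rename(1,3) bij_betw_finite by blast
  show ?case unfolding occurs_def
  proof
    fix v assume v: "v \<in> V'"
    then have "p v \<in> V" using rename(3) by (auto simp: bij_betw_def)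
    then obtain m where "m \<in> min_gens J" "p v \<in> keys m" using rename(6) by (auto simp: occurs_def)
    moreover have "u = v" if "u \<in> V'" "p u = p v" for u using rename(3) that v by (auto simp: bij_betw_def inj_on_def)
    ultimately show "\<exists>m\<in>min_gens J'. v \<in> keys m" using occurs_lift[OF fin rename(4)] rename(5) by blast
  qed
next
  case (step V1 p J1 V2 q J2 r)
  have f: "finite V1" "finite V2" "q ` V2 = V1" "card V2 = card V1 + 1" "monomial_ideal V2 J2" "J1 = var_map q ` J2"
    using step(2) by (auto simp: simple_separation_def)
  obtain x y where xy: "x \<in> V2" "y \<in> V2" "x \<noteq> y" "q x = q y"
      "\<exists>m\<in>min_gens J2. x \<in> keys m" "\<exists>m\<in>min_gens J2. y \<in> keys m"
    using step(2) unfolding simple_separation_def by blast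
  have "q y \<in> q ` (V2 - {y})" using xy(1,3,4) by (auto intro!: image_eqI[of _ _ x])
  then have "q ` (V2 - {y}) = V1" using f(3) insert_Diff[OF xy(2)] by (metis image_insert insert_absorb)
  moreover have "card (V2 - {y}) = card V1" using f(4) xy(2) by simp
  ultimately have inj: "inj_on q (V2 - {y})" using f(2) by (intro eq_card_imp_inj_on) auto
  show ?case unfolding occurs_def
  proof
    fix v assume v: "v \<in> V2"
    show "\<exists>m\<in>min_gens J2. v \<in> keys m"
    proof (cases "v = x \<or> v = y")
      case True
      then show ?thesis using xy by blast
    next
      case False
      have "q v \<in> V1" using v f(3) by auto
      then obtain m where m: "m \<in> min_gens J1" "q v \<in> keys m" using step.IH[OF step.prems] by (auto simp: occurs_def)
      have "u = v" if u: "u \<in> V2" "q u = q v" for u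
      proof (cases "u = y")
        case True
        then have "q x = q v" using u xy by simp
        then show ?thesis using inj xy(1,3) v False by (auto dest: inj_onD)
      next
        case False': False
        then show ?thesis using inj u v False by (auto dest: inj_onD)
      qed
      then show ?thesis using occurs_lift[OF f(2,5)] m f(6) by blast
    qed
  qed
qed

text \<open>The least power of a variable in the ideal is a minimal generator, and its exponent is
  positive because the ideal is proper.\<close>

lemma artin_occurs:
  assumes "artin_monomial_ideal V (J :: ('v, 'k::field) mpoly set)" shows "occurs V J"
  unfolding occurs_def
proof
  fix v assume v: "v \<in> V"
  obtain M where M: "mono_set V M" "J = ideal_of M"
    using assms by (auto simp: artin_monomial_ideal_def monomial_ideal_iff)
  obtain e0 where "var v ^ e0 \<in> J" using assms v by (auto simp: artin_monomial_ideal_def)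
  then have "single v e0 \<in> M" by (simp add: var_power M(2))
  define e where "e = (LEAST e. single v e \<in> M)"
  have eM: "single v e \<in> M" unfolding e_def using \<open>single v e0 \<in> M\<close> by (rule LeastI)
  have "e \<noteq> 0"
  proof
    assume "e = 0"
    then have "0 \<in> M" using eM by simp
    then have "m \<in> M" if "keys m \<subseteq> V" for m using M(1) that unfolding mono_set_def by (metis add_0)
    then have "J = carrier (poly_ring V)"
      using M vars_ideal_of[OF M(1)] by (auto simp: ideal_of_def mem_poly_ring)
    then show False using assms by (simp add: artin_monomial_ideal_def)
  qed
  have "m = single v e" if m: "m \<in> M" "expo_dvd m (single v e)" for m
  proof -
    have le: "lookup m u \<le> (if u = v then e else 0)" for u
      using m(2) by (auto simp: expo_dvd_def lookup_single when_def split: if_splits)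
    have ms: "m = single v (lookup m v)"
    proof (rule poly_mapping_eqI)
      fix u show "lookup m u = lookup (single v (lookup m v)) u" using le[of u] by (cases "u = v") (simp_all add: lookup_single when_def)
    qed
    then have "e \<le> lookup m v" unfolding e_def using m(1) by (intro Least_le) simp
    then have "lookup m v = e" using le[of v] by simp
    then show ?thesis using ms by simp
  qed
  then have "single v e \<in> min_gens J" using eM by (auto simp: min_gens_def M(2))
  moreover have "v \<in> keys (single v e)" using \<open>e \<noteq> 0\<close> by simp
  ultimately show "\<exists>m\<in>min_gens J. v \<in> keys m" by blast
qed

text \<open>
  The ideal contains a squarefree monomial supported on a subset \<open>F\<close> of the fiber. A free transversal
  meets \<open>F\<close>, so its element in the fiber is never outside \<open>F\<close>. By purity, a variable of the fiber
  outside \<open>F\<close> would then occur in no minimal generator.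
\<close>

lemma proper_polarization_fiber:
  assumes pol: "proper_polarization I \<jj> V' p (J' :: ('v, 'k::field) mpoly set)"
    and artin: "artin_monomial_ideal I \<jj>" and i: "i \<in> I" and pow: "var i ^ e \<in> \<jj>"
  shows "card {v \<in> V'. p v = i} \<le> e"
proof -
  have sep: "proper_separation I \<jj> V' p J'" and sq: "squarefree_monomial_ideal V' J'"
    using pol by (auto simp: proper_polarization_def)
  note ch = separation_chain[OF sep]
  have fin: "finite V'" and img: "p ` V' = I" and J': "monomial_ideal V' J'" and eJ: "expos \<jj> = push p V' ` expos J'"
    and pur: "pure p I V' (expos J')" using ch by blast+
  have up: "upset V' (expos J')" by (rule upset_expos[OF fin J'])
  have occ: "occurs V' J'" by (rule proper_separation_occurs[OF sep artin_occurs[OF artin]])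
  have "lookup (single i e) \<in> expos \<jj>" using pow by (simp add: var_power mem_expos)
  then obtain h where h: "h \<in> expos J'" "lookup (single i e) = push p V' h" using eJ by auto
  define F where "F = {v. h v \<noteq> 0}"
  have iF: "indicat F \<in> expos J'" unfolding F_def by (rule squarefree_radical[OF sq h(1)])
  have hV: "h \<in> on V'" using h(1) up by (auto simp: upset_def)
  have psum: "(\<Sum>v | v \<in> V' \<and> p v = j. h v) = (if j = i then e else 0)" for j
    using fun_cong[OF h(2), of j] by (auto simp: push_def lookup_single when_def)
  have FV: "F \<subseteq> {v \<in> V'. p v = i}"
  proof
    fix v assume v: "v \<in> F"
    then have vV: "v \<in> V'" using hV by (auto simp: F_def on_def)
    have "h v \<le> (\<Sum>u | u \<in> V' \<and> p u = p v. h u)" using vV fin by (intro member_le_sum) auto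
    then have "p v = i" using psum[of "p v"] v by (auto simp: F_def split: if_splits)
    then show "v \<in> {v \<in> V'. p v = i}" using vV by simp
  qed
  have "card F = (\<Sum>v\<in>F. 1)" by simp
  also have "\<dots> \<le> (\<Sum>v\<in>F. h v)" by (intro sum_mono) (auto simp: F_def Suc_le_eq)
  also have "\<dots> \<le> (\<Sum>v | v \<in> V' \<and> p v = i. h v)" using FV fin by (intro sum_mono2) auto
  also have "\<dots> = e" using psum[of i] by simp
  finally have cF: "card F \<le> e" .
  have "{v \<in> V'. p v = i} \<subseteq> F"
  proof (rule subsetI, rule ccontr)
    fix v assume "v \<in> {v \<in> V'. p v = i}" and vF: "v \<notin> F"
    then have v: "v \<in> V'" "p v = i" by auto
    obtain m where m: "m \<in> min_gens J'" "v \<in> keys m" using occ v(1) by (auto simp: occurs_def)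
    have mN: "lookup m \<in> expos J'" using m(1) by (simp add: min_gens_def mem_expos)
    \<comment> \<open>Removing \<open>v\<close> from a minimal generator leads out of the ideal;
      purity is applied to the resulting monomial.\<close>
    define g where "g = (lookup m)(v := 0)"
    have gV: "g \<in> on V'" using mN up by (auto simp: g_def upset_def on_def)
    have "g \<notin> expos J'"
    proof
      assume "g \<in> expos J'"
      then obtain m' where m': "g = lookup m'" "mon m' \<in> J'" by (auto simp: expos_def)
      have "lookup m' u \<le> lookup m u" for u using fun_cong[OF m'(1), of u] by (simp add: g_def split: if_splits)
      then have "expo_dvd m' m" by (simp add: expo_dvd_def)
      then have "m' = m" using m(1) m'(2) by (auto simp: min_gens_def)
      then have "lookup m v = 0" using fun_cong[OF m'(1), of v] by (simp add: g_def)
      then show False using m(2) by (simp add: in_keys_iff)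
    qed
    then obtain a where a: "a \<in> transversals p I V'" "free_on V' (expos J') a g"
      using pur gV unfolding pure_def by blast
    show False
    proof (cases "v \<in> a")
      case True
      \<comment> \<open>As \<open>a\<close> contains \<open>v\<close>, it contains no element of
        \<open>F\<close>. Enlarging \<open>g\<close> by \<open>F\<close> does not change it on
        \<open>a\<close> but puts it into the ideal.\<close>
      define k where "k u = max (g u) (indicat F u)" for u
      have "u \<notin> F" if u: "u \<in> a" for u
      proof
        assume "u \<in> F"
        then have "p u = p v" using FV v(2) by auto
        then have "u = v" using transversal_unique[OF a(1) u True] i v(2) by simp
        then show False using \<open>u \<in> F\<close> vF by simp
      qed
      then have "\<forall>u\<in>a. k u = g u" by (simp add: k_def indicat_def)
      moreover have kV: "k \<in> on V'" using gV FV by (auto simp: k_def on_def indicat_def)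
      moreover have "k \<in> expos J'" by (rule upsetD[OF up iF kV]) (simp add: k_def)
      ultimately show False using a(2) unfolding free_on_def by blast
    next
      case False
      then have "\<forall>u\<in>a. lookup m u = g u" by (auto simp: g_def)
      moreover have "lookup m \<in> on V'" using mN up by (auto simp: upset_def)
      ultimately show False using a(2) mN unfolding free_on_def by blast
    qed
  qed
  then have "{v \<in> V'. p v = i} = F" using FV by blast
  then show ?thesis using cF by simp
qed

text \<open>The bound on the fibers gives a fiberwise injection of \<open>V'\<close> into
  \<open>A\<close>, and as many fresh variables as there are elements of \<open>A\<close> left over
  extend it to a bijection. The infinite type of variables guarantees that fresh ones exist.\<close>

theorem proper_polarization_extends:
  fixes V' :: "'b::infinite set" and A :: "'a set" and J' :: "('b, 'k::field) mpoly set"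
  assumes pol: "proper_polarization I \<jj> V' p J'" and artin: "artin_monomial_ideal I \<jj>"
    and pow: "\<forall>i\<in>I. var i ^ \<alpha> i \<in> \<jj>" and A: "finite A" "\<pi> ` A \<subseteq> I" and fib: "\<forall>i\<in>I. card {a \<in> A. \<pi> a = i} = \<alpha> i"
  shows "\<exists>W q J. finite W \<and> V' \<subseteq> W \<and> q ` W \<subseteq> I \<and> (\<forall>v\<in>V'. q v = p v) \<and>
    polarization I \<jj> A \<pi> J \<and> isomorphic_over W q (gen_ideal W J') A \<pi> J"
proof -
  have sep: "proper_separation I \<jj> V' p J'" and sq: "squarefree_monomial_ideal V' J'"
    using pol by (auto simp: proper_polarization_def)
  note ch = separation_chain[OF sep]
  have fin: "finite V'" and img: "p ` V' = I" and J': "monomial_ideal V' J'" using ch by blast+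
  have "\<exists>f. inj_on f {v \<in> V'. p v = i} \<and> f ` {v \<in> V'. p v = i} \<subseteq> {a \<in> A. \<pi> a = i}" if i: "i \<in> I" for i
  proof -
    have "card {v \<in> V'. p v = i} \<le> card {a \<in> A. \<pi> a = i}"
      using proper_polarization_fiber[OF pol artin i] pow fib i by simp
    then show ?thesis using card_le_inj[of "{v \<in> V'. p v = i}" "{a \<in> A. \<pi> a = i}"] fin A(1) by auto
  qed
  then have "\<forall>i\<in>I. \<exists>f. inj_on f {v \<in> V'. p v = i} \<and> f ` {v \<in> V'. p v = i} \<subseteq> {a \<in> A. \<pi> a = i}" by blast
  from bchoice[OF this] obtain f where f: "\<And>i. i \<in> I \<Longrightarrow> inj_on (f i) {v \<in> V'. p v = i}"
      "\<And>i. i \<in> I \<Longrightarrow> f i ` {v \<in> V'. p v = i} \<subseteq> {a \<in> A. \<pi> a = i}" by auto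
  define \<iota> where "\<iota> v = f (p v) v" for v
  have \<iota>: "\<iota> v \<in> A" "\<pi> (\<iota> v) = p v" if v: "v \<in> V'" for v
    using f(2)[of "p v"] v img unfolding \<iota>_def by blast+
  have \<iota>inj: "inj_on \<iota> V'"
  proof (rule inj_onI)
    fix u v assume u: "u \<in> V'" and v: "v \<in> V'" and eq: "\<iota> u = \<iota> v"
    then have pe: "p u = p v" using \<iota> by metis
    then have "f (p v) u = f (p v) v" using eq by (simp add: \<iota>_def)
    then show "u = v" using f(1)[of "p v"] u v pe img by (auto dest: inj_onD)
  qed
  have "infinite (UNIV - V')" using fin infinite_UNIV by (simp add: Diff_infinite_finite)
  then obtain E where E: "finite E" "card E = card (A - \<iota> ` V')" "E \<subseteq> UNIV - V'"
    using infinite_arbitrarily_large by blast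
  obtain \<psi> where \<psi>: "bij_betw \<psi> E (A - \<iota> ` V')"
    using finite_same_card_bij[of E "A - \<iota> ` V'"] E A(1) by auto
  define W where "W = V' \<union> E"
  define \<phi> where "\<phi> v = (if v \<in> V' then \<iota> v else \<psi> v)" for v
  have finW: "finite W" using fin E by (simp add: W_def)
  have \<phi>V: "\<phi> v = \<iota> v" if "v \<in> V'" for v using that by (simp add: \<phi>_def)
  have "bij_betw \<phi> (V' \<union> E) (\<iota> ` V' \<union> (A - \<iota> ` V'))"
  proof (rule bij_betw_combine)
    show "bij_betw \<phi> V' (\<iota> ` V')" using \<iota>inj \<phi>V by (auto simp: bij_betw_def inj_on_def)
    show "bij_betw \<phi> E (A - \<iota> ` V')"
      using \<psi> E(3) by (subst bij_betw_cong[of E \<phi> \<psi>]) (auto simp: \<phi>_def)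
  qed blast
  moreover have "\<iota> ` V' \<union> (A - \<iota> ` V') = A" using \<iota> by blast
  ultimately have bij: "bij_betw \<phi> W A" by (simp add: W_def)
  then have \<phi>: "inj_on \<phi> W" "\<phi> ` W = A" by (auto simp: bij_betw_def)
  have VW: "V' \<subseteq> W" by (simp add: W_def)
  define q where "q = \<pi> \<circ> \<phi>"
  define J where "J = var_map \<phi> ` gen_ideal W J'"
  have q: "\<forall>v\<in>V'. q v = p v" using \<phi>V \<iota> by (simp add: q_def)
  obtain S where S: "S \<subseteq> {m. keys m \<subseteq> V' \<and> squarefree_expo m}" "J' = gen_ideal V' (mon ` S)"
    using sq by (auto simp: squarefree_monomial_ideal_def)
  have SV: "S \<subseteq> {m. keys m \<subseteq> V'}" "S \<subseteq> {m. keys m \<subseteq> W}" using S(1) VW by auto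
  have J'S: "J' = ideal_of (multiples V' S)" using S(2) gen_ideal_monomials[OF SV(1)] by simp
  have sub: "multiples V' S \<subseteq> multiples W S" unfolding multiples_def using VW by blast
  have gW: "gen_ideal W J' = ideal_of (multiples W S)"
  proof (rule gen_ideal_eq[OF SV(2)])
    show "mon ` S \<subseteq> J'" unfolding J'S using subset_multiples[OF SV(1)] by auto
    show "J' \<subseteq> ideal_of (multiples W S)" unfolding J'S ideal_of_subset by (rule sub)
  qed
  let ?S = "expo_map \<phi> ` S"
  have SA: "?S \<subseteq> {m. keys m \<subseteq> \<phi> ` V'}" using SV(1) unfolding subset_iff by (fastforce simp: keys_expo_map)
  then have SA': "?S \<subseteq> {m. keys m \<subseteq> A}" using \<phi>(2) VW by blast
  have JA: "J = ideal_of (multiples A ?S)"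
    unfolding J_def gW var_map_ideal_of[OF \<phi>(1) finW mono_set_multiples]
      expo_map_multiples[OF \<phi>(1) finW SV(2)] \<phi>(2) ..
  have \<phi>V': "inj_on \<phi> V'" using \<phi>(1) VW by (rule inj_on_subset)
  have J'': "var_map \<phi> ` J' = ideal_of (multiples (\<phi> ` V') ?S)"
    unfolding J'S var_map_ideal_of[OF \<phi>V' fin mono_set_multiples] expo_map_multiples[OF \<phi>V' fin SV(1)] ..
  have gA: "gen_ideal A (var_map \<phi> ` J') = J" unfolding JA
  proof (rule gen_ideal_eq[OF SA'])
    show "mon ` ?S \<subseteq> var_map \<phi> ` J'" unfolding J'' using subset_multiples[OF SA] by auto
    have "multiples (\<phi> ` V') ?S \<subseteq> multiples A ?S" unfolding multiples_def using \<phi>(2) VW by blast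
    then show "var_map \<phi> ` J' \<subseteq> ideal_of (multiples A ?S)" unfolding J'' ideal_of_subset .
  qed
  have "proper_separation I \<jj> (\<phi> ` V') \<pi> (var_map \<phi> ` J')"
    by (rule proper_separation_rename[OF sep \<phi>V']) (use q in \<open>simp add: q_def\<close>)
  then have "separation I \<jj> A \<pi> J"
    unfolding separation_def using A gA[symmetric] image_mono[OF VW, of \<phi>] \<phi>(2)
    by (intro conjI exI[of _ "\<phi> ` V'"] exI[of _ "var_map \<phi> ` J'"]) simp_all
  moreover have "squarefree_monomial_ideal A J"
    unfolding squarefree_monomial_ideal_def
  proof (intro exI[of _ ?S] conjI subsetI)
    show "J = gen_ideal A (mon ` ?S)" unfolding JA gen_ideal_monomials[OF SA'] ..
    fix m assume m: "m \<in> ?S"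
    then obtain s where s: "m = expo_map \<phi> s" "s \<in> S" by auto
    have sV: "keys s \<subseteq> V'" "squarefree_expo s" using S(1) s(2) by auto
    have "lookup m z \<le> 1" for z
    proof (cases "z \<in> \<phi> ` V'")
      case True
      then obtain v where v: "v \<in> V'" "z = \<phi> v" by auto
      then have "{u \<in> V'. \<phi> u = z} = {v}" using \<phi>V' by (auto dest: inj_onD)
      then show ?thesis using lookup_expo_map[OF fin sV(1), of \<phi>] s(1) sV(2) v
        by (simp add: push_single squarefree_expo_def)
    next
      case False
      then have "z \<notin> keys m" using s(1) sV(1) keys_expo_map[of \<phi> s] by auto
      then show ?thesis by (simp add: in_keys_iff)
    qed
    then show "m \<in> {m. keys m \<subseteq> A \<and> squarefree_expo m}" using SA' m by (auto simp: squarefree_expo_def)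
  qed
  ultimately have polJ: "polarization I \<jj> A \<pi> J" by (simp add: polarization_def)
  have iso: "isomorphic_over W q (gen_ideal W J') A \<pi> J"
    unfolding isomorphic_over_def using bij by (intro exI[of _ \<phi>]) (auto simp: q_def J_def)
  have qW: "q ` W \<subseteq> I" using A(2) \<phi>(2) by (auto simp: q_def)
  show ?thesis
    by (intro exI[of _ W] exI[of _ q] exI[of _ J] conjI finW VW qW q polJ iso)
qed

theorem theorem4p2:
  fixes n :: nat and \<alpha> :: "nat \<Rightarrow> nat"
    and \<cc> \<jj> :: "(nat, 'k::field) mpoly set"
    and A :: "'a set" and \<pi> :: "'a \<Rightarrow> nat"
    and \<Sigma> :: "'a set set"
  defines "\<cc> \<equiv> gen_ideal {1..n} ((\<lambda>i. var i ^ \<alpha> i) ` {1..n})"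
    and "\<Sigma> \<equiv> join_family {1..n} (\<lambda>i. boundary_simplex {a \<in> A. \<pi> a = i})"
  assumes "\<forall>i\<in>{1..n}. 1 \<le> \<alpha> i"
    and "artin_monomial_ideal {1..n} \<jj>"
    and "\<cc> \<subset> \<jj>"
    and "finite A" and "\<pi> ` A \<subseteq> {1..n}"
    and "\<forall>i\<in>{1..n}. card {a \<in> A. \<pi> a = i} = \<alpha> i"
  shows "(\<forall>J. polarization {1..n} \<jj> A \<pi> J \<longrightarrow>
      (\<exists>X. complex_on A X \<and> X \<subseteq> \<Sigma> \<and> complex_dim X = complex_dim \<Sigma> \<and>
           simplicial_ball X \<and> J = stanley_reisner_ideal A X)) \<and>
    (\<forall>(V' :: 'b::infinite set) p J'. proper_polarization {1..n} \<jj> V' p J' \<longrightarrow>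
      (\<exists>W q J. finite W \<and> V' \<subseteq> W \<and> q ` W \<subseteq> {1..n} \<and> (\<forall>v\<in>V'. q v = p v) \<and>
         polarization {1..n} \<jj> A \<pi> J \<and>
         isomorphic_over W q (gen_ideal W J') A \<pi> J))"
proof (intro conjI allI impI)
  fix J assume "polarization {1..n} \<jj> A \<pi> J"
  then show "\<exists>X. complex_on A X \<and> X \<subseteq> \<Sigma> \<and> complex_dim X = complex_dim \<Sigma> \<and>
      simplicial_ball X \<and> J = stanley_reisner_ideal A X"
    using polarization_ball[OF assms(4) assms(5)[unfolded \<cc>_def] assms(8)] unfolding \<Sigma>_def by blast
next
  have pow: "\<forall>i\<in>{1..n}. var i ^ \<alpha> i \<in> \<jj>"
  proof
    fix i assume i: "i \<in> {1..n}"
    interpret R: ring "poly_ring {1..n} :: (nat, 'k) mpoly ring" by (rule ring_poly_ring)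
    have "(\<lambda>i. var i ^ \<alpha> i :: (nat, 'k) mpoly) ` {1..n} \<subseteq> carrier (poly_ring {1..n})"
      by (auto simp: var_power mem_poly_ring split: if_splits)
    then have "(\<lambda>i. var i ^ \<alpha> i) ` {1..n} \<subseteq> \<cc>" unfolding \<cc>_def by (rule R.genideal_self)
    then show "var i ^ \<alpha> i \<in> \<jj>" using i assms(5) by blast
  qed
  fix V' :: "'b set" and p J' assume "proper_polarization {1..n} \<jj> V' p J'"
  then show "\<exists>W q J. finite W \<and> V' \<subseteq> W \<and> q ` W \<subseteq> {1..n} \<and> (\<forall>v\<in>V'. q v = p v) \<and>
      polarization {1..n} \<jj> A \<pi> J \<and> isomorphic_over W q (gen_ideal W J') A \<pi> J"
    by (rule proper_polarization_extends[OF _ assms(4) pow assms(6,7,8)])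
qed

end
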